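(* Let $0<s\le1$, $q=3$, and $b_1=b_3=\frac{1}{2-2^{1/3}}$, $b_2=1-2b_1$. For $0\le n\le M-1$ let $Z^{n,0}=u^N(t_n)$ and let $Z^{n,j}\in S_N$ be defined by $$Z^{n,j}=Z^{n,j-1}+kb_jF\Big(\frac{Z^{n,j}+Z^{n,j-1}}2\Big),\quad j=1,2,3,$$ and let $\Theta^n=u^N(t_{n+1})-Z^{n,3}$. Let $u$ be the solution of the periodic problem $iu_t-(-\partial_{xx})^su+|u|^2u=0$, $u(x,0)=u_0(x)$, and assume that $u\in H^\mu$ for $0\le t\le T$ and $\mu$ large enough. Then, for $k$ small enough (with $3\|P_Nu_0\|^2kN\max_{1\le j\le3}|b_j|<1$), there is a constant $C$, independent of $k$ and $N$, such that $$\max_{0\le n\le M-1}\|\Theta^n\|\le Ck^5 .$$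
   Context: $T>0$ fixed; $u_0$ is smooth and $2\pi$-periodic. Functions are complex-valued, $2\pi$-periodic in $x$; $\|\cdot\|$ is the norm of $L^2(-\pi,\pi)$. $\widehat u(k)=\frac1{2\pi}\int_{-\pi}^{\pi}u(x)e^{-ikx}dx$; $H^\mu$ has norm $\|u\|_\mu=(\sum_{k\in\mathbb Z}(1+k^2)^\mu|\widehat u(k)|^2)^{1/2}$; "$u\in H^\mu$ for $0\le t\le T$" means with norm bounded on $[0,T]$. $(-\partial_{xx})^s$ has Fourier symbol $|k|^{2s}$. $N\ge1$ is an integer, $S_N=\mathrm{span}\{e^{ikx}:-N\le k\le N\}$, $P_Nu=\sum_{|k|\le N}\widehat u(k)e^{ikx}$, and $F:S_N\to S_N$, $F(u)=-i(-\partial_{xx})^su+iP_N(|u|^2u)$. The semidiscrete solution $u^N$ with values in $S_N$ solves $\frac{d}{dt}u^N=F(u^N)$, $u^N(0)=P_Nu_0$. $k>0$ is the time step, $M$ an integer with $T=Mk$, $t_n=nk$. If needed, $u$ and $u^N$ are understood as extended to $[-k,T+k]$ with the same properties. *)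

theory Defs
  imports "HOL-Analysis.Analysis" "HOL-Library.Periodic_Fun"
begin

definition L2_norm :: "(real \<Rightarrow> complex) \<Rightarrow> real" where
  "L2_norm f = sqrt (LINT x:{-pi..pi}|lebesgue. (cmod (f x))\<^sup>2)"

definition fourier_coeff :: "(real \<Rightarrow> complex) \<Rightarrow> int \<Rightarrow> complex" where
  "fourier_coeff f m =
     (1 / (2 * pi)) * (LINT x:{-pi..pi}|lebesgue. f x * cis (- (of_int m * x)))"

(* Only used for large \<mu>, so the elements of H^\<mu> are square-integrable functions. *)
definition in_H :: "real \<Rightarrow> (real \<Rightarrow> complex) \<Rightarrow> bool" where
  "in_H \<mu> f \<longleftrightarrow>
     periodic_fun_simple f (2 * pi) \<and>
     set_borel_measurable lebesgue {-pi..pi} f \<and>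
     set_integrable lebesgue {-pi..pi} (\<lambda>x. (cmod (f x))\<^sup>2) \<and>
     (\<lambda>m::int. (1 + (of_int m)\<^sup>2) powr \<mu> * (cmod (fourier_coeff f m))\<^sup>2) summable_on UNIV"

definition H_norm :: "real \<Rightarrow> (real \<Rightarrow> complex) \<Rightarrow> real" where
  "H_norm \<mu> f =
     sqrt (\<Sum>\<^sub>\<infinity>m::int. (1 + (of_int m)\<^sup>2) powr \<mu> * (cmod (fourier_coeff f m))\<^sup>2)"

definition bounded_in_H :: "real \<Rightarrow> real \<Rightarrow> (real \<Rightarrow> real \<Rightarrow> complex) \<Rightarrow> bool" where
  "bounded_in_H \<mu> T u \<longleftrightarrow> (\<exists>B. \<forall>t\<in>{0..T}. in_H \<mu> (u t) \<and> H_norm \<mu> (u t) \<le> B)"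

(* The multiplier |m|^(2s), summed pointwise; the series converges absolutely for
   f in H^\<mu> with \<mu> > 2s + 1/2. *)
definition frac_lap :: "real \<Rightarrow> (real \<Rightarrow> complex) \<Rightarrow> real \<Rightarrow> complex" where
  "frac_lap s f x =
     (\<Sum>\<^sub>\<infinity>m::int. of_real (\<bar>of_int m\<bar> powr (2 * s)) * fourier_coeff f m * cis (of_int m * x))"

definition smooth_fun :: "(real \<Rightarrow> complex) \<Rightarrow> bool" where
  "smooth_fun f \<longleftrightarrow>
     (\<exists>D :: nat \<Rightarrow> real \<Rightarrow> complex. D 0 = f \<and>
        (\<forall>n x. (D n has_vector_derivative D (Suc n) x) (at x)))"

definition trig_space :: "nat \<Rightarrow> (real \<Rightarrow> complex) set" where
  "trig_space N =
     {f. \<exists>c :: int \<Rightarrow> complex. f = (\<lambda>x. \<Sum>m\<in>{- int N..int N}. c m * cis (of_int m * x))}"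

definition trig_proj :: "nat \<Rightarrow> (real \<Rightarrow> complex) \<Rightarrow> real \<Rightarrow> complex" where
  "trig_proj N f x = (\<Sum>m\<in>{- int N..int N}. fourier_coeff f m * cis (of_int m * x))"

definition nls_rhs :: "real \<Rightarrow> nat \<Rightarrow> (real \<Rightarrow> complex) \<Rightarrow> real \<Rightarrow> complex" where
  "nls_rhs s N v x =
     - \<i> * frac_lap s v x + \<i> * trig_proj N (\<lambda>y. of_real ((cmod (v y))\<^sup>2) * v y) x"

(* Classical solution of i u_t - (-d_xx)^s u + |u|^2 u = 0 on [0,T], with one-sided time
   derivatives at the endpoints. *)
definition nls_solution ::
  "real \<Rightarrow> real \<Rightarrow> (real \<Rightarrow> complex) \<Rightarrow> (real \<Rightarrow> real \<Rightarrow> complex) \<Rightarrow> bool" where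
  "nls_solution s T u0 u \<longleftrightarrow>
     u 0 = u0 \<and>
     (\<forall>t\<in>{0..T}. periodic_fun_simple (u t) (2 * pi)) \<and>
     continuous_on ({0..T} \<times> UNIV) (\<lambda>(t, x). u t x) \<and>
     (\<forall>t\<in>{0..T}. \<forall>x. \<exists>u\<^sub>t.
        ((\<lambda>\<tau>. u \<tau> x) has_vector_derivative u\<^sub>t) (at t within {0..T}) \<and>
        \<i> * u\<^sub>t - frac_lap s (u t) x + of_real ((cmod (u t x))\<^sup>2) * u t x = 0)"

(* On the finite-dimensional space trig_space N the pointwise time derivative is the derivative in
   any norm. *)
definition semidiscrete_solution ::
  "real \<Rightarrow> real \<Rightarrow> nat \<Rightarrow> (real \<Rightarrow> complex) \<Rightarrow> (real \<Rightarrow> real \<Rightarrow> complex) \<Rightarrow> bool" where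
  "semidiscrete_solution s T N u0 uN \<longleftrightarrow>
     uN 0 = trig_proj N u0 \<and>
     (\<forall>t\<in>{0..T}. uN t \<in> trig_space N \<and>
        (\<forall>x. ((\<lambda>\<tau>. uN \<tau> x) has_vector_derivative nls_rhs s N (uN t) x) (at t within {0..T})))"

(* The symmetric three-stage choice satisfying the fourth-order conditions
   b_1 + b_2 + b_3 = 1 and b_1^3 + b_2^3 + b_3^3 = 0; b_2 is negative. *)
definition comp_coeff :: "nat \<Rightarrow> real" where
  "comp_coeff j =
     (if j = 2 then 1 - 2 * (1 / (2 - 2 powr (1 / 3))) else 1 / (2 - 2 powr (1 / 3)))"

(* Z 0, ..., Z q are the stages of the composition of implicit midpoint steps of lengths
   k b_1, ..., k b_q, started at Z0. *)
definition composition_stages ::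
  "real \<Rightarrow> nat \<Rightarrow> real \<Rightarrow> nat \<Rightarrow> (nat \<Rightarrow> real) \<Rightarrow> (real \<Rightarrow> complex) \<Rightarrow>
   (nat \<Rightarrow> real \<Rightarrow> complex) \<Rightarrow> bool" where
  "composition_stages s N k q b Z0 Z \<longleftrightarrow>
     Z 0 = Z0 \<and>
     (\<forall>j\<in>{1..q}. Z j \<in> trig_space N \<and>
        (\<forall>x. Z j x = Z (j - 1) x
           + of_real (k * b j) * nls_rhs s N (\<lambda>y. (Z j y + Z (j - 1) y) / 2) x))"

end

theory Submission
  imports Defs
begin

text \<open>
  All comparisons in \<open>L\<^sup>2\<close> rest on one cancellation: with \<open>e = z - w\<close>, the term
  \<open>|z|\<^sup>2 z - |w|\<^sup>2 w\<close> contributes to the energy identity for \<open>e\<close> at most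
  \<open>|w| (|w| + |z|) |e|\<^sup>2\<close>, which is linear in the rough function \<open>z\<close>. The smallness of \<open>k N\<close>
  and mass conservation give \<open>\<surd>k |z| \<le> 1\<close> for the stage midpoints, so an implicit midpoint step
  is stable around every bounded approximation once \<open>k\<close> is below a threshold independent of
  \<open>N\<close>; above the threshold the trivial bound by twice the mass suffices.

  The approximation is obtained by expanding about the centre \<open>t\<^sub>n + k/2\<close>, where the composition is
  symmetric: the four stages are polynomials \<open>Y(-k/2), G(k), G(-k), Y(k/2)\<close> in \<open>k\<close>, with \<open>Y\<close> the
  Taylor polynomial of the flow. The outer steps are exchanged by \<open>k \<mapsto> -k\<close>, the middle one only
  constrains odd coefficients of \<open>G\<close>, and what remains of the order conditions is
  \<open>4 (b - 1/2)\<^sup>3 = b\<^sup>3\<close> and \<open>6 b (b - 1)\<^sup>2 = 1\<close> for \<open>b = b\<^sub>1\<close>.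

  Five applications of \<open>F\<close> cost at most ten derivatives, so one needs \<open>u\<^sup>N\<close> bounded in the weighted
  Wiener algebra of order 10, uniformly in \<open>N\<close>. For large \<open>N\<close> this follows by comparison with
  \<open>P\<^sub>N u\<close>, the error being smaller than any needed power of \<open>N\<close>; for the remaining \<open>N\<close> from mass
  conservation and equivalence of norms.
\<close>

section \<open>Trigonometric polynomials\<close>

text \<open>The computed stages are controlled a priori only through their mass: with the inverse
  inequality and the smallness of k N this gives |Z| <= k^(-1/2) pointwise and no more. A Lipschitz
  bound for the cubic term, quadratic in Z, would contribute k |Z|^2 per step, which is of order one
  and is not made small by shrinking k. The estimate linear in Z turns this into k K (K + k^(-1/2)),
  of order k^(1/2), where K bounds the approximation. All regularity therefore has to come from the
  approximation, which must satisfy the three steps up to O(k^5) with bounds independent of N. As F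
  is polynomial in v and its conjugate, inserting a polynomial in k gives an identity with an
  explicit remainder. Both conditions on b are rearrangements of 2 b^3 + (1 - 2b)^3 = 0, the order
  condition on the sum of the cubes. One application of F costs two derivatives because 2s <= 2.
  Decay of the coefficients of u like |m|^(-20) pays for the ten derivatives, for the passage from
  L2 to the Wiener norm, and for the exponential factor of the energy estimate.\<close>

definition L2_inner :: "(real \<Rightarrow> complex) \<Rightarrow> (real \<Rightarrow> complex) \<Rightarrow> complex" where
  "L2_inner f g = integral {-pi..pi} (\<lambda>x. f x * cnj (g x))"

definition modes :: "nat \<Rightarrow> int set" where
  "modes N = {- int N..int N}"

lemma finite_modes [simp]: "finite (modes N)"
  by (simp add: modes_def)

lemma modes_iff: "m \<in> modes N \<longleftrightarrow> \<bar>m\<bar> \<le> int N"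
  by (auto simp: modes_def)

text \<open>Bridge between the Lebesgue integrals of the given definitions and the gauge integral,
  in which \<open>L2_inner\<close> is written because its rules for continuous integrands are more
  direct.\<close>

lemma set_lebesgue_integral_continuous:
  fixes f :: "real \<Rightarrow> 'a::euclidean_space"
  assumes "continuous_on {a..b} f"
  shows "(LINT x:{a..b}|lebesgue. f x) = integral {a..b} f"
    and "set_integrable lebesgue {a..b} f"
proof -
  have "set_integrable lborel {a..b} f"
    by (rule borel_integrable_atLeastAtMost') fact
  then show *: "set_integrable lebesgue {a..b} f"
    unfolding set_integrable_def
    by (subst integrable_completion) (auto simp: set_integrable_def)
  then show "(LINT x:{a..b}|lebesgue. f x) = integral {a..b} f"
    by (rule set_lebesgue_integral_eq_integral(2))
qed

lemma fourier_coeff_L2_inner: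
  assumes "continuous_on {-pi..pi} f"
  shows "fourier_coeff f m = L2_inner f (\<lambda>x. cis (of_int m * x)) / (2 * pi)"
  unfolding fourier_coeff_def L2_inner_def
  by (subst set_lebesgue_integral_continuous)
     (use assms in \<open>auto intro!: continuous_intros simp: cis_cnj\<close>)

lemma L2_norm_L2_inner:
  assumes "continuous_on {-pi..pi} f"
  shows "L2_inner f f = of_real ((L2_norm f)\<^sup>2)" and "(L2_norm f)\<^sup>2 = integral {-pi..pi} (\<lambda>x. (cmod (f x))\<^sup>2)"
proof -
  have c: "continuous_on {-pi..pi} (\<lambda>x. (cmod (f x))\<^sup>2)"
    using assms by (intro continuous_intros)
  have "integral {-pi..pi} (\<lambda>x. (cmod (f x))\<^sup>2) \<ge> 0"
    by (intro integral_nonneg integrable_continuous_interval c) auto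
  then show *: "(L2_norm f)\<^sup>2 = integral {-pi..pi} (\<lambda>x. (cmod (f x))\<^sup>2)"
    unfolding L2_norm_def by (simp add: set_lebesgue_integral_continuous[OF c])
  have "((\<lambda>x. of_real ((cmod (f x))\<^sup>2)) has_integral
      (complex_of_real (integral {-pi..pi} (\<lambda>x. (cmod (f x))\<^sup>2)))) {-pi..pi}"
    by (intro has_integral_of_real integrable_integral integrable_continuous_interval c)
  then show "L2_inner f f = of_real ((L2_norm f)\<^sup>2)"
    unfolding * L2_inner_def by (simp add: complex_mult_cnj cmod_power2 integral_unique)
qed

lemma L2_norm_nonneg [simp]: "L2_norm f \<ge> 0"
  unfolding L2_norm_def set_lebesgue_integral_def
  by (intro real_sqrt_ge_zero Bochner_Integration.integral_nonneg) auto

lemma L2_inner_add_left: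
  assumes "continuous_on {-pi..pi} f" "continuous_on {-pi..pi} g" "continuous_on {-pi..pi} h"
  shows "L2_inner (\<lambda>x. f x + g x) h = L2_inner f h + L2_inner g h"
  unfolding L2_inner_def distrib_right
  by (intro integral_add integrable_continuous_interval continuous_intros assms)

lemma L2_inner_scale_left: "L2_inner (\<lambda>x. c * f x) h = c * L2_inner f h"
  unfolding L2_inner_def by (simp add: mult.assoc)

lemma L2_inner_lincomb_left:
  assumes "continuous_on {-pi..pi} f" "continuous_on {-pi..pi} g" "continuous_on {-pi..pi} h"
  shows "L2_inner (\<lambda>x. c * f x + d * g x) h = c * L2_inner f h + d * L2_inner g h"
  using assms by (subst L2_inner_add_left) (auto intro!: continuous_intros simp: L2_inner_scale_left)

lemma L2_inner_sum_left:
  assumes "\<And>i. i \<in> I \<Longrightarrow> continuous_on {-pi..pi} (f i)" "continuous_on {-pi..pi} h"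
  shows "L2_inner (\<lambda>x. \<Sum>i\<in>I. f i x) h = (\<Sum>i\<in>I. L2_inner (f i) h)"
proof (cases "finite I")
  case True
  then show ?thesis unfolding L2_inner_def sum_distrib_right
    by (intro integral_sum integrable_continuous_interval continuous_intros assms)
qed (simp add: L2_inner_def)

lemma L2_inner_cnj: "cnj (L2_inner f g) = L2_inner g f"
  unfolding L2_inner_def by (subst integral_cnj) (simp add: mult.commute)

lemma integral_cis_int:
  "integral {-pi..pi} (\<lambda>x. cis (of_int m * x)) = (if m = 0 then 2 * pi else 0)"
proof (cases "m = 0")
  case False
  have "((\<lambda>x. cis (of_int m * x)) has_integral
      (cis (of_int m * pi) / (\<i> * of_int m) - cis (of_int m * (-pi)) / (\<i> * of_int m))) {-pi..pi}"
  proof (rule fundamental_theorem_of_calculus)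
    fix x :: real
    have "((\<lambda>z. exp (\<i> * of_int m * z) / (\<i> * of_int m)) has_field_derivative exp (\<i> * of_int m * of_real x))
        (at (of_real x))"
      using False by (auto intro!: derivative_eq_intros)
    from has_vector_derivative_real_field[OF this]
    show "((\<lambda>x. cis (of_int m * x) / (\<i> * of_int m)) has_vector_derivative cis (of_int m * x))
        (at x within {-pi..pi})"
      by (simp add: cis_conv_exp mult.assoc)
  qed simp
  moreover have "cis (of_int m * pi) = cis (of_int m * (-pi))"
    by (simp add: complex_eq_iff sin_times_pi_eq_0)
  ultimately show ?thesis using False by (simp add: integral_unique)
qed (simp add: scaleR_conv_of_real)

lemma cis_cnj_mult: "cis (of_int m * x) * cnj (cis (of_int n * x)) = cis (of_int (m - n) * x)"
  by (simp add: cis_cnj cis_mult algebra_simps)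

lemma L2_inner_cis: "L2_inner (\<lambda>x. cis (of_int m * x)) (\<lambda>x. cis (of_int n * x)) = (if m = n then 2 * pi else 0)"
  unfolding L2_inner_def cis_cnj_mult by (simp only: integral_cis_int) auto

lemma fourier_coeff_sum_cis:
  assumes "finite I"
  shows "fourier_coeff (\<lambda>x. \<Sum>i\<in>I. c i * cis (of_int (p i) * x)) m = (\<Sum>i\<in>I. if p i = m then c i else 0)"
proof -
  have "fourier_coeff (\<lambda>x. \<Sum>i\<in>I. c i * cis (of_int (p i) * x)) m =
      (\<Sum>i\<in>I. L2_inner (\<lambda>x. c i * cis (of_int (p i) * x)) (\<lambda>x. cis (of_int m * x))) / (2 * pi)"
    by (subst fourier_coeff_L2_inner) (auto intro!: continuous_intros arg_cong2[of _ _ _ _ "(/)"] L2_inner_sum_left)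
  then show ?thesis
    by (auto simp: L2_inner_scale_left L2_inner_cis sum_divide_distrib intro!: sum.cong)
qed

lemma trig_space_iff: "f \<in> trig_space N \<longleftrightarrow> (\<exists>c. f = (\<lambda>x. \<Sum>m\<in>modes N. c m * cis (of_int m * x)))"
  by (simp add: trig_space_def modes_def)

lemma trig_proj_in_trig_space [simp, intro]: "trig_proj N f \<in> trig_space N"
  unfolding trig_space_def trig_proj_def by blast

lemma fourier_coeff_modes_sum:
  "fourier_coeff (\<lambda>x. \<Sum>m\<in>modes N. c m * cis (of_int m * x)) m = (if m \<in> modes N then c m else 0)"
  by (simp add: fourier_coeff_sum_cis)

lemma fourier_coeff_trig_proj:
  "fourier_coeff (trig_proj N f) m = (if m \<in> modes N then fourier_coeff f m else 0)"
  using fourier_coeff_modes_sum[of "fourier_coeff f" N m]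
  by (simp add: trig_proj_def[abs_def] modes_def)

lemma fourier_coeff_trig_space_0: "f \<in> trig_space N \<Longrightarrow> m \<notin> modes N \<Longrightarrow> fourier_coeff f m = 0"
  by (auto simp: trig_space_iff fourier_coeff_modes_sum)

lemma trig_proj_modes: "trig_proj N f x = (\<Sum>m\<in>modes N. fourier_coeff f m * cis (of_int m * x))"
  by (simp add: trig_proj_def modes_def)

lemma trig_proj_trig_space:
  assumes "f \<in> trig_space N" shows "trig_proj N f = f"
proof -
  obtain c where c: "f = (\<lambda>x. \<Sum>m\<in>modes N. c m * cis (of_int m * x))"
    using assms by (auto simp: trig_space_iff)
  show ?thesis unfolding c by (simp add: fun_eq_iff trig_proj_modes fourier_coeff_modes_sum)
qed

lemma trig_space_expand:
  assumes "f \<in> trig_space N"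
  shows "f x = (\<Sum>m\<in>modes N. fourier_coeff f m * cis (of_int m * x))"
  using trig_proj_trig_space[OF assms] trig_proj_modes by metis

lemma continuous_on_trig_space: "f \<in> trig_space N \<Longrightarrow> continuous_on S f"
  by (auto simp: trig_space_iff intro!: continuous_intros)

lemma trig_space_add: "f \<in> trig_space N \<Longrightarrow> g \<in> trig_space N \<Longrightarrow> (\<lambda>x. f x + g x) \<in> trig_space N"
  unfolding trig_space_iff
  by (elim exE, rule_tac x="\<lambda>m. c m + ca m" in exI) (simp add: algebra_simps sum.distrib)

lemma trig_space_scale: "f \<in> trig_space N \<Longrightarrow> (\<lambda>x. c * f x) \<in> trig_space N"
  unfolding trig_space_iff
  by (elim exE, rule_tac x="\<lambda>m. c * ca m" in exI) (simp add: algebra_simps sum_distrib_left)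

lemma trig_space_0: "(\<lambda>x. 0) \<in> trig_space N"
  unfolding trig_space_iff by (rule exI[of _ "\<lambda>m. 0"]) simp

lemma trig_space_diff: "f \<in> trig_space N \<Longrightarrow> g \<in> trig_space N \<Longrightarrow> (\<lambda>x. f x - g x) \<in> trig_space N"
  using trig_space_add[of f N "\<lambda>x. (-1) * g x"] trig_space_scale[of g N "-1"] by simp

lemma trig_space_sum: "(\<And>i. i \<in> I \<Longrightarrow> f i \<in> trig_space N) \<Longrightarrow> (\<lambda>x. \<Sum>i\<in>I. f i x) \<in> trig_space N"
  by (induction I rule: infinite_finite_induct) (auto simp: trig_space_0 trig_space_add)

lemmas trig_space_intros = trig_space_add trig_space_scale trig_space_0 trig_space_diff trig_space_sum

lemma fourier_coeff_add:
  assumes "continuous_on {-pi..pi} f" "continuous_on {-pi..pi} g"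
  shows "fourier_coeff (\<lambda>x. f x + g x) m = fourier_coeff f m + fourier_coeff g m"
  using assms by (simp add: fourier_coeff_L2_inner continuous_intros L2_inner_add_left add_divide_distrib)

lemma fourier_coeff_scale: "fourier_coeff (\<lambda>x. c * f x) m = c * fourier_coeff f m"
  unfolding fourier_coeff_def by (simp add: mult.assoc)

lemma fourier_coeff_diff:
  assumes "continuous_on {-pi..pi} f" "continuous_on {-pi..pi} g"
  shows "fourier_coeff (\<lambda>x. f x - g x) m = fourier_coeff f m - fourier_coeff g m"
  using fourier_coeff_add[OF assms(1), of "\<lambda>x. (-1) * g x" m] assms fourier_coeff_scale[of "-1" g m]
  by (simp add: continuous_intros)

lemma fourier_coeff_sum:
  assumes "\<And>i. i \<in> I \<Longrightarrow> continuous_on {-pi..pi} (f i)"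
  shows "fourier_coeff (\<lambda>x. \<Sum>i\<in>I. f i x) m = (\<Sum>i\<in>I. fourier_coeff (f i) m)"
  using assms by (simp add: fourier_coeff_L2_inner continuous_intros L2_inner_sum_left sum_divide_distrib)

section \<open>Parseval's identity, sampling, and time derivatives of the L2 norm\<close>

lemma L2_inner_trig_space_right:
  assumes f: "continuous_on {-pi..pi} f" and g: "g \<in> trig_space N"
  shows "L2_inner f g = 2 * pi * (\<Sum>m\<in>modes N. fourier_coeff f m * cnj (fourier_coeff g m))"
proof -
  have "L2_inner g f = (\<Sum>m\<in>modes N. L2_inner (\<lambda>x. fourier_coeff g m * cis (of_int m * x)) f)"
    unfolding L2_inner_sum_left[symmetric, where f="\<lambda>m x. fourier_coeff g m * cis (of_int m * x)", OF _ f]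
    by (subst L2_inner_sum_left[symmetric]) (auto intro!: continuous_intros f simp flip: trig_space_expand[OF g])
  also have "\<dots> = (\<Sum>m\<in>modes N. fourier_coeff g m * cnj (2 * pi * fourier_coeff f m))"
    by (intro sum.cong refl) (simp add: L2_inner_scale_left fourier_coeff_L2_inner[OF f] L2_inner_cnj)
  finally have "cnj (L2_inner g f) = cnj \<dots>" by simp
  then show ?thesis by (simp add: L2_inner_cnj sum_distrib_left mult_ac)
qed

lemma parseval_trig_space:
  assumes "f \<in> trig_space N"
  shows "(L2_norm f)\<^sup>2 = 2 * pi * (\<Sum>m\<in>modes N. (cmod (fourier_coeff f m))\<^sup>2)"
proof -
  have "complex_of_real ((L2_norm f)\<^sup>2) = complex_of_real (2 * pi * (\<Sum>m\<in>modes N. (cmod (fourier_coeff f m))\<^sup>2))"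
    using L2_norm_L2_inner(1)[OF continuous_on_trig_space[OF assms]]
      L2_inner_trig_space_right[OF continuous_on_trig_space[OF assms] assms]
    by (simp add: complex_mult_cnj cmod_power2)
  then show ?thesis by (simp only: of_real_eq_iff)
qed

lemma L2_inner_trig_proj:
  assumes "continuous_on {-pi..pi} f" "g \<in> trig_space N"
  shows "L2_inner (trig_proj N f) g = L2_inner f g"
  by (simp add: L2_inner_trig_space_right[OF _ assms(2)] assms(1) continuous_on_trig_space[OF trig_proj_in_trig_space]
      fourier_coeff_trig_proj)

text \<open>Sampling at n = 2N+1 equidistant points is exact on \<open>trig_space N\<close>: two
  frequencies of the band differ by less than n, so the roots of unity cancel unless the frequencies
  agree. A coefficient is thus a fixed finite linear combination of point values, which transfers
  pointwise time derivatives to coefficients.\<close>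

lemma dft:
  fixes N :: nat
  defines "n \<equiv> 2 * N + 1"
  assumes f: "f \<in> trig_space N" and m: "m \<in> modes N"
  shows "fourier_coeff f m = (\<Sum>j<n. f (2 * pi * real j / real n) * cis (- (of_int m * (2 * pi * real j / real n)))) / of_nat n"
proof -
  define X where "X j = 2 * pi * real j / real n" for j
  have orth: "(\<Sum>j<n. cis (of_int l * X j)) = (if l = 0 then of_nat n else 0)" if "\<bar>l\<bar> < int n" for l :: int
  proof (cases "l = 0")
    case False
    define z where "z = cis (2 * pi * of_int l / real n)"
    have zj: "cis (of_int l * X j) = z ^ j" for j
      by (simp add: z_def X_def Complex.DeMoivre mult_ac)
    have "z \<noteq> 1"
    proof
      assume "z = 1"
      then have "cis (2 * pi * of_int l / real n) = cis 0" by (simp add: z_def)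
      then obtain k :: int where "2 * pi * of_int l / real n = of_int k * 2 * pi"
        by (auto simp: complex_eq_iff cos_one_2pi_int)
      then have "2 * pi * (of_int l / real n - of_int k) = 0" by (simp add: algebra_simps)
      then have "of_int l / real n = of_int k" by simp
      then have "of_int l = of_int k * real n" by (simp add: n_def divide_eq_eq)
      then have "l = k * int n" by (metis of_int_eq_iff of_int_mult of_int_of_nat_eq)
      then show False using that False
        by (metis abs_mult abs_of_nat dvd_imp_le_int dvd_triv_right not_less)
    qed
    moreover have "z ^ n = 1"
    proof -
      have "real n * (2 * pi * of_int l / real n) = 2 * pi * of_int l" by (simp add: n_def)
      then show ?thesis by (simp only: z_def Complex.DeMoivre) (simp add: cis_multiple_2pi)
    qed
    ultimately show ?thesis using False by (simp add: zj sum_gp_strict)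
  qed simp
  have "(\<Sum>j<n. f (X j) * cis (- (of_int m * X j))) =
      (\<Sum>j<n. \<Sum>p\<in>modes N. fourier_coeff f p * cis (of_int (p - m) * X j))"
    by (subst trig_space_expand[OF f])
       (simp add: sum_distrib_right mult.assoc cis_mult left_diff_distrib)
  also have "\<dots> = (\<Sum>p\<in>modes N. fourier_coeff f p * (\<Sum>j<n. cis (of_int (p - m) * X j)))"
    by (subst sum.swap) (simp add: sum_distrib_left)
  also have "\<dots> = (\<Sum>p\<in>modes N. if p = m then fourier_coeff f p * of_nat n else 0)"
    using m by (intro sum.cong refl) (subst orth, auto simp: modes_iff n_def)
  also have "\<dots> = fourier_coeff f m * of_nat n" using m by simp
  finally have "(\<Sum>j<n. f (X j) * cis (- (of_int m * X j))) = fourier_coeff f m * of_nat n" .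
  moreover have "n \<noteq> 0" by (simp add: n_def)
  ultimately show ?thesis by (simp add: X_def eq_divide_eq)
qed

lemma fourier_coeff_has_vector_derivative:
  assumes e: "\<And>t. t \<in> S \<Longrightarrow> e t \<in> trig_space N" and e': "e' \<in> trig_space N" and t: "t \<in> S"
    and d: "\<And>x. ((\<lambda>\<tau>. e \<tau> x) has_vector_derivative e' x) (at t within S)"
    and m: "m \<in> modes N"
  shows "((\<lambda>\<tau>. fourier_coeff (e \<tau>) m) has_vector_derivative fourier_coeff e' m) (at t within S)"
proof -
  let ?n = "2 * N + 1" let ?X = "\<lambda>j. 2 * pi * real j / real ?n"
  have "((\<lambda>\<tau>. (\<Sum>j<?n. e \<tau> (?X j) * cis (- (of_int m * ?X j))) / of_nat ?n) has_vector_derivative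
      (\<Sum>j<?n. e' (?X j) * cis (- (of_int m * ?X j))) / of_nat ?n) (at t within S)"
    by (intro has_vector_derivative_divide has_vector_derivative_sum has_vector_derivative_mult_left d)
  then show ?thesis
    by (subst dft[OF e' m], elim has_vector_derivative_transform[OF t, rotated])
       (use dft[OF e m] in auto)
qed

text \<open>By Parseval the squared norm is a finite sum of squares of real functions of time, so
  differentiability at each point x is enough.\<close>

lemma L2_norm_sq_has_derivative:
  assumes e: "\<And>t. t \<in> S \<Longrightarrow> e t \<in> trig_space N" and e': "e' \<in> trig_space N" and t: "t \<in> S"
    and d: "\<And>x. ((\<lambda>\<tau>. e \<tau> x) has_vector_derivative e' x) (at t within S)"
  shows "((\<lambda>\<tau>. (L2_norm (e \<tau>))\<^sup>2) has_real_derivative 2 * Re (L2_inner e' (e t))) (at t within S)"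
proof -
  let ?c = "\<lambda>\<tau> m. fourier_coeff (e \<tau>) m"
  have "((\<lambda>\<tau>. 2 * pi * (\<Sum>m\<in>modes N. (Re (?c \<tau> m))\<^sup>2 + (Im (?c \<tau> m))\<^sup>2)) has_real_derivative
     2 * pi * (\<Sum>m\<in>modes N. (2 * (Re (?c t m) * Re (fourier_coeff e' m)) + 2 * (Im (?c t m) * Im (fourier_coeff e' m)))))
     (at t within S)"
  proof (intro DERIV_cmult DERIV_sum)
    fix m assume m: "m \<in> modes N"
    note fd = fourier_coeff_has_vector_derivative[OF e e' t d m]
    have R: "((\<lambda>\<tau>. Re (?c \<tau> m)) has_real_derivative Re (fourier_coeff e' m)) (at t within S)"
      using bounded_linear.has_vector_derivative[OF bounded_linear_Re fd]
      by (simp add: has_real_derivative_iff_has_vector_derivative)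
    have I: "((\<lambda>\<tau>. Im (?c \<tau> m)) has_real_derivative Im (fourier_coeff e' m)) (at t within S)"
      using bounded_linear.has_vector_derivative[OF bounded_linear_Im fd]
      by (simp add: has_real_derivative_iff_has_vector_derivative)
    show "((\<lambda>\<tau>. (Re (?c \<tau> m))\<^sup>2 + (Im (?c \<tau> m))\<^sup>2) has_real_derivative
        2 * (Re (?c t m) * Re (fourier_coeff e' m)) + 2 * (Im (?c t m) * Im (fourier_coeff e' m))) (at t within S)"
      by (rule derivative_eq_intros R I refl | simp)+
  qed
  moreover have "2 * pi * (\<Sum>m\<in>modes N. (2 * (Re (?c t m) * Re (fourier_coeff e' m)) + 2 * (Im (?c t m) * Im (fourier_coeff e' m))))
      = 2 * Re (L2_inner e' (e t))"
    by (subst L2_inner_trig_space_right[OF continuous_on_trig_space[OF e'] e[OF t]])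
       (simp add: sum_distrib_left algebra_simps flip: sum.distrib)
  ultimately have "((\<lambda>\<tau>. 2 * pi * (\<Sum>m\<in>modes N. (Re (?c \<tau> m))\<^sup>2 + (Im (?c \<tau> m))\<^sup>2)) has_real_derivative
      2 * Re (L2_inner e' (e t))) (at t within S)" by simp
  then show ?thesis
    by (rule has_field_derivative_transform_within[OF _ zero_less_one t])
       (auto simp: parseval_trig_space[OF e] cmod_power2)
qed

section \<open>Energy estimates\<close>

lemma frac_lap_trig_space:
  assumes "f \<in> trig_space N"
  shows "frac_lap s f x = (\<Sum>m\<in>modes N. of_real (\<bar>of_int m\<bar> powr (2 * s)) * fourier_coeff f m * cis (of_int m * x))"
proof -
  have "frac_lap s f x = (\<Sum>\<^sub>\<infinity>m\<in>modes N. of_real (\<bar>of_int m\<bar> powr (2 * s)) * fourier_coeff f m * cis (of_int m * x))"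
    unfolding frac_lap_def
    by (rule infsum_cong_neutral) (use fourier_coeff_trig_space_0[OF assms] in auto)
  then show ?thesis by simp
qed

lemma frac_lap_in_trig_space [intro]:
  assumes "f \<in> trig_space N" shows "frac_lap s f \<in> trig_space N"
  unfolding trig_space_iff using frac_lap_trig_space[OF assms]
  by (intro exI[of _ "\<lambda>m. of_real (\<bar>of_int m\<bar> powr (2 * s)) * fourier_coeff f m"]) auto

lemma fourier_coeff_frac_lap:
  assumes "f \<in> trig_space N"
  shows "fourier_coeff (frac_lap s f) m = of_real (\<bar>of_int m\<bar> powr (2 * s)) * fourier_coeff f m"
proof -
  have "frac_lap s f = (\<lambda>x. (\<Sum>m\<in>modes N. of_real (\<bar>of_int m\<bar> powr (2 * s)) * fourier_coeff f m * cis (of_int m * x)))"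
    using frac_lap_trig_space[OF assms] by blast
  then show ?thesis
    by (simp add: fourier_coeff_modes_sum fourier_coeff_trig_space_0[OF assms])
qed

lemma trig_space_eqI:
  assumes "f \<in> trig_space N" "g \<in> trig_space N" "\<And>m. m \<in> modes N \<Longrightarrow> fourier_coeff f m = fourier_coeff g m"
  shows "f x = g x"
  using assms by (subst (1 2) trig_space_expand) auto

lemma frac_lap_sum:
  assumes "\<And>i. i \<in> I \<Longrightarrow> f i \<in> trig_space N"
  shows "frac_lap s (\<lambda>x. \<Sum>i\<in>I. c i * f i x) x = (\<Sum>i\<in>I. c i * frac_lap s (f i) x)"
proof (rule trig_space_eqI)
  show "frac_lap s (\<lambda>x. \<Sum>i\<in>I. c i * f i x) \<in> trig_space N"
    by (intro frac_lap_in_trig_space trig_space_intros assms)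
  show "(\<lambda>x. \<Sum>i\<in>I. c i * frac_lap s (f i) x) \<in> trig_space N"
    by (intro frac_lap_in_trig_space trig_space_intros assms)
  have tp: "(\<lambda>x. \<Sum>i\<in>I. c i * f i x) \<in> trig_space N"
    by (intro trig_space_intros assms)
  have c: "continuous_on {-pi..pi} (f i)" "continuous_on {-pi..pi} (frac_lap s (f i))" if "i \<in> I" for i
    using assms[OF that] by (auto intro: continuous_on_trig_space frac_lap_in_trig_space)
  show "fourier_coeff (frac_lap s (\<lambda>x. \<Sum>i\<in>I. c i * f i x)) m =
      fourier_coeff (\<lambda>x. \<Sum>i\<in>I. c i * frac_lap s (f i) x) m" for m
    unfolding fourier_coeff_frac_lap[OF tp]
    by (subst (1 2) fourier_coeff_sum)
       (auto intro!: continuous_intros c simp: fourier_coeff_scale fourier_coeff_frac_lap[OF assms] sum_distrib_left mult.left_commute)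
qed

lemma trig_proj_sum:
  assumes "\<And>i. i \<in> I \<Longrightarrow> continuous_on {-pi..pi} (f i)"
  shows "trig_proj N (\<lambda>x. \<Sum>i\<in>I. c i * f i x) x = (\<Sum>i\<in>I. c i * trig_proj N (f i) x)"
proof -
  have "fourier_coeff (\<lambda>x. \<Sum>i\<in>I. c i * f i x) m = (\<Sum>i\<in>I. c i * fourier_coeff (f i) m)" for m
    by (subst fourier_coeff_sum) (auto intro!: continuous_intros assms simp: fourier_coeff_scale)
  then show ?thesis
    by (simp add: trig_proj_modes sum_distrib_right sum_distrib_left mult.assoc sum.swap[of _ I])
qed

lemma trig_proj_diff:
  assumes "continuous_on {-pi..pi} f" "continuous_on {-pi..pi} g"
  shows "trig_proj N (\<lambda>x. f x - g x) x = trig_proj N f x - trig_proj N g x"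
  by (simp add: trig_proj_modes fourier_coeff_diff[OF assms] algebra_simps sum_subtractf)

lemma frac_lap_diff:
  assumes "f \<in> trig_space N" "g \<in> trig_space N"
  shows "frac_lap s (\<lambda>x. f x - g x) x = frac_lap s f x - frac_lap s g x"
  using frac_lap_sum[of "{0,1::nat}" "\<lambda>i. if i = 0 then f else g" N s "\<lambda>i. if i = 0 then 1 else -1" x] assms
  by simp

lemma nls_rhs_in_trig_space [intro]:
  assumes "v \<in> trig_space N" shows "nls_rhs s N v \<in> trig_space N"
  unfolding nls_rhs_def[abs_def]
  by (intro trig_space_intros frac_lap_in_trig_space trig_proj_in_trig_space assms)

section \<open>Inequalities between inner product, L2 norm and sup norm\<close>

lemma cauchy_schwarz_L2_inner:
  assumes f: "continuous_on {-pi..pi} f" and g: "continuous_on {-pi..pi} g"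
  shows "cmod (L2_inner f g) \<le> L2_norm f * L2_norm g"
proof -
  define J where "J = integral {-pi..pi} (\<lambda>x. cmod (f x) * cmod (g x))"
  have int: "(\<lambda>x. cmod (f x) * cmod (g x)) integrable_on {-pi..pi}" "(\<lambda>x. (cmod (f x))\<^sup>2) integrable_on {-pi..pi}"
      "(\<lambda>x. (cmod (g x))\<^sup>2) integrable_on {-pi..pi}" "(\<lambda>x. f x * cnj (g x)) integrable_on {-pi..pi}"
    by (intro integrable_continuous_interval continuous_intros f g)+
  have "cmod (L2_inner f g) \<le> J"
    unfolding L2_inner_def J_def by (rule integral_norm_bound_integral) (use int in \<open>auto simp: norm_mult\<close>)
  have quad: "0 \<le> (L2_norm f)\<^sup>2 - 2 * l * J + l\<^sup>2 * (L2_norm g)\<^sup>2" for l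
  proof -
    have "0 \<le> integral {-pi..pi} (\<lambda>x. (cmod (f x) - l * cmod (g x))\<^sup>2)"
      by (intro integral_nonneg integrable_continuous_interval continuous_intros f g) auto
    also have "(\<lambda>x. (cmod (f x) - l * cmod (g x))\<^sup>2) =
        (\<lambda>x. ((cmod (f x))\<^sup>2 - (2 * l) * (cmod (f x) * cmod (g x))) + l\<^sup>2 * (cmod (g x))\<^sup>2)"
      by (auto simp: power2_eq_square algebra_simps)
    also have "integral {-pi..pi} \<dots> = (L2_norm f)\<^sup>2 - 2 * l * J + l\<^sup>2 * (L2_norm g)\<^sup>2"
      using int unfolding L2_norm_L2_inner(2)[OF f] L2_norm_L2_inner(2)[OF g] J_def
      by (subst integral_add integral_diff integral_mult_right;
          (intro integrable_diff integrable_on_mult_right int)?)+ simp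
    finally show ?thesis .
  qed
  have "J \<le> L2_norm f * L2_norm g"
  proof (cases "L2_norm g = 0")
    case True
    have "J \<le> 0"
    proof (rule ccontr)
      assume "\<not> J \<le> 0"
      \<comment> \<open>With \<open>L2_norm g = 0\<close> the quadratic is affine in l, and this l
        gives it the value -1.\<close>
      then show False using quad[of "((L2_norm f)\<^sup>2 + 1) / (2 * J)"] True by simp
    qed
    then show ?thesis using True by simp
  next
    case False
    have "0 \<le> (L2_norm f)\<^sup>2 - J\<^sup>2 / (L2_norm g)\<^sup>2"
      using quad[of "J / (L2_norm g)\<^sup>2"] False by (simp add: power2_eq_square field_simps)
    then have "J\<^sup>2 \<le> (L2_norm f * L2_norm g)\<^sup>2" using False by (simp add: field_simps power_mult_distrib)
    then show ?thesis by (rule power2_le_imp_le) simp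
  qed
  then show ?thesis using \<open>cmod (L2_inner f g) \<le> J\<close> by simp
qed

lemma L2_norm_add_sq:
  assumes f: "continuous_on {-pi..pi} f" and g: "continuous_on {-pi..pi} g"
  shows "(L2_norm (\<lambda>x. f x + g x))\<^sup>2 = (L2_norm f)\<^sup>2 + 2 * Re (L2_inner f g) + (L2_norm g)\<^sup>2"
proof -
  have right: "L2_inner h (\<lambda>x. f x + g x) = L2_inner h f + L2_inner h g" if "continuous_on {-pi..pi} h" for h
    using L2_inner_add_left[OF f g that] by (metis complex_cnj_add L2_inner_cnj)
  have "complex_of_real ((L2_norm (\<lambda>x. f x + g x))\<^sup>2) = L2_inner f f + L2_inner f g + (L2_inner g f + L2_inner g g)"
    using f g by (subst L2_norm_L2_inner(1)[symmetric]) (simp_all add: continuous_intros L2_inner_add_left right)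
  then have "(L2_norm (\<lambda>x. f x + g x))\<^sup>2 = Re (L2_inner f f + L2_inner f g + (cnj (L2_inner f g) + L2_inner g g))"
    by (metis Re_complex_of_real L2_inner_cnj)
  then show ?thesis by (simp add: L2_norm_L2_inner(1) f g)
qed

lemma L2_norm_scale: "L2_norm (\<lambda>x. c * f x) = cmod c * L2_norm f"
  by (simp add: L2_norm_def norm_mult power_mult_distrib real_sqrt_mult)

lemma L2_norm_triangle:
  assumes f: "continuous_on {-pi..pi} f" and g: "continuous_on {-pi..pi} g"
  shows "L2_norm (\<lambda>x. f x + g x) \<le> L2_norm f + L2_norm g"
proof (rule power2_le_imp_le)
  have "Re (L2_inner f g) \<le> L2_norm f * L2_norm g"
    using cauchy_schwarz_L2_inner[OF f g] complex_Re_le_cmod order_trans by blast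
  then show "(L2_norm (\<lambda>x. f x + g x))\<^sup>2 \<le> (L2_norm f + L2_norm g)\<^sup>2"
    by (simp add: L2_norm_add_sq[OF f g] power2_sum)
qed simp

lemma L2_norm_triangle_diff:
  assumes f: "continuous_on {-pi..pi} f" and g: "continuous_on {-pi..pi} g"
  shows "L2_norm (\<lambda>x. f x - g x) \<le> L2_norm f + L2_norm g"
  using L2_norm_triangle[OF f, of "\<lambda>x. (-1) * g x"] g L2_norm_scale[of "-1" g] by (simp add: continuous_intros)

text \<open>The 3 is a round upper bound for sqrt (2 pi), as 2 pi <= 9.\<close>

lemma L2_norm_le_sup:
  assumes f: "continuous_on {-pi..pi} f" and b: "\<And>x. cmod (f x) \<le> K"
  shows "L2_norm f \<le> 3 * K"
proof (rule power2_le_imp_le)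
  have K: "K \<ge> 0" using b[of 0] norm_ge_zero order_trans by blast
  have "(L2_norm f)\<^sup>2 \<le> integral {-pi..pi} (\<lambda>x. K\<^sup>2)"
    unfolding L2_norm_L2_inner(2)[OF f]
    by (intro integral_le integrable_continuous_interval continuous_intros f power_mono b) auto
  also have "\<dots> \<le> 9 * K\<^sup>2" using pi_less_4 pi_approx by (simp add: mult_right_mono)
  finally show "(L2_norm f)\<^sup>2 \<le> (3 * K)\<^sup>2" by (simp add: power_mult_distrib)
  show "0 \<le> 3 * K" using K by simp
qed

text \<open>Inverse inequality by Cauchy-Schwarz over the 2N+1 coefficients. For N >= 1 one has 2N+1
  <= 2 pi N, and this 2 pi is the one in Parseval, so the constant is exactly 1 and the bound fits
  the condition on k N.\<close>

lemma trig_space_sup_le: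
  assumes "N \<ge> 1" "f \<in> trig_space N"
  shows "(cmod (f x))\<^sup>2 \<le> real N * (L2_norm f)\<^sup>2"
proof -
  have card: "card (modes N) = 2 * N + 1" by (simp add: modes_def)
  have "cmod (f x) \<le> (\<Sum>m\<in>modes N. cmod (fourier_coeff f m))"
    by (subst trig_space_expand[OF assms(2)]) (rule order_trans[OF norm_sum], simp add: norm_mult)
  then have "(cmod (f x))\<^sup>2 \<le> (\<Sum>m\<in>modes N. cmod (fourier_coeff f m))\<^sup>2"
    by (intro power_mono) auto
  also have "\<dots> \<le> real (card (modes N)) * (\<Sum>m\<in>modes N. (cmod (fourier_coeff f m))\<^sup>2)"
    using sum_squared_le_sum_of_squares by (metis finite_modes mult.commute)
  also have "\<dots> \<le> (2 * pi * real N) * (\<Sum>m\<in>modes N. (cmod (fourier_coeff f m))\<^sup>2)"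
  proof (intro mult_right_mono sum_nonneg)
    have "6 * real N \<le> 2 * pi * real N" using pi_approx by (intro mult_right_mono) auto
    then show "real (card (modes N)) \<le> 2 * pi * real N" using assms(1) unfolding card by linarith
  qed auto
  finally show ?thesis by (simp add: parseval_trig_space[OF assms(2)] mult_ac)
qed

text \<open>Write |z|^2 z - |w|^2 w = |z|^2 (z - w) + (|z|^2 - |w|^2) w. Against cnj (z - w) the
  first part is real, so the square of |z| drops out of the imaginary part; in the second, |z|^2 -
  |w|^2 = (|z| + |w|) (|z| - |w|) leaves one power of |z|.\<close>

lemma cubic_monotone:
  fixes z w :: complex
  shows "\<bar>Im ((of_real ((cmod z)\<^sup>2) * z - of_real ((cmod w)\<^sup>2) * w) * cnj (z - w))\<bar>
    \<le> cmod w * (cmod w + cmod z) * (cmod (z - w))\<^sup>2"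
proof -
  have "Im ((of_real ((cmod z)\<^sup>2) * z - of_real ((cmod w)\<^sup>2) * w) * cnj (z - w)) =
      ((cmod w)\<^sup>2 - (cmod z)\<^sup>2) * Im ((z - w) * cnj w)"
    by (simp add: algebra_simps)
  also have "\<bar>\<dots>\<bar> = (cmod w + cmod z) * \<bar>cmod w - cmod z\<bar> * \<bar>Im ((z - w) * cnj w)\<bar>"
  proof -
    have "(cmod w)\<^sup>2 - (cmod z)\<^sup>2 = (cmod w + cmod z) * (cmod w - cmod z)"
      by (simp add: power2_eq_square algebra_simps)
    then show ?thesis by (simp add: abs_mult)
  qed
  also have "\<dots> \<le> (cmod w + cmod z) * cmod (z - w) * (cmod (z - w) * cmod w)"
  proof (intro mult_mono)
    show "\<bar>cmod w - cmod z\<bar> \<le> cmod (z - w)" by (metis norm_minus_commute norm_triangle_ineq3)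
    show "\<bar>Im ((z - w) * cnj w)\<bar> \<le> cmod (z - w) * cmod w"
      by (metis abs_Im_le_cmod complex_mod_cnj norm_mult)
  qed auto
  finally show ?thesis by (simp add: power2_eq_square mult_ac)
qed

text \<open>The multiplier of \<open>frac_lap\<close> is real, so -i times it contributes nothing to
  the real part, and the projection drops out against a test function in
  \<open>trig_space N\<close>. Only the cubic term remains. The absolute value is kept because the
  estimate is also applied with negative step lengths and backward in time.\<close>

lemma nls_rhs_monotone:
  assumes z: "z \<in> trig_space N" and w: "w \<in> trig_space N"
    and zb: "\<And>x. cmod (z x) \<le> Kz" and wb: "\<And>x. cmod (w x) \<le> K"
  shows "\<bar>Re (L2_inner (\<lambda>x. nls_rhs s N z x - nls_rhs s N w x) (\<lambda>x. z x - w x))\<bar>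
    \<le> K * (K + Kz) * (L2_norm (\<lambda>x. z x - w x))\<^sup>2"
proof -
  define e where "e = (\<lambda>x. z x - w x)"
  define cz where "cz = (\<lambda>x. of_real ((cmod (z x))\<^sup>2) * z x)"
  define cw where "cw = (\<lambda>x. of_real ((cmod (w x))\<^sup>2) * w x)"
  have e: "e \<in> trig_space N" unfolding e_def by (intro trig_space_intros z w)
  note cont = continuous_on_trig_space[OF e, of "{-pi..pi}"]
    continuous_on_trig_space[OF z, of "{-pi..pi}"] continuous_on_trig_space[OF w, of "{-pi..pi}"]
  have c: "continuous_on {-pi..pi} cz" "continuous_on {-pi..pi} cw"
    unfolding cz_def cw_def by (intro continuous_intros cont)+
  have K: "K \<ge> 0" "Kz \<ge> 0" using wb[of 0] zb[of 0] norm_ge_zero order_trans by blast+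
  have "nls_rhs s N z x - nls_rhs s N w x = (-\<i>) * frac_lap s e x + \<i> * trig_proj N (\<lambda>x. cz x - cw x) x" for x
    unfolding nls_rhs_def trig_proj_diff[OF c] e_def frac_lap_diff[OF z w]
    by (simp add: cz_def cw_def algebra_simps)
  then have "L2_inner (\<lambda>x. nls_rhs s N z x - nls_rhs s N w x) e =
      L2_inner (\<lambda>x. (-\<i>) * frac_lap s e x + \<i> * trig_proj N (\<lambda>x. cz x - cw x) x) e" by presburger
  also have "\<dots> = (-\<i>) * L2_inner (frac_lap s e) e + \<i> * L2_inner (trig_proj N (\<lambda>x. cz x - cw x)) e"
    by (intro L2_inner_lincomb_left cont continuous_on_trig_space[OF frac_lap_in_trig_space[OF e]]
        continuous_on_trig_space[OF trig_proj_in_trig_space])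
  also have "L2_inner (trig_proj N (\<lambda>x. cz x - cw x)) e = L2_inner (\<lambda>x. cz x - cw x) e"
    by (intro L2_inner_trig_proj continuous_intros c e)
  finally have "L2_inner (\<lambda>x. nls_rhs s N z x - nls_rhs s N w x) e =
      (-\<i>) * L2_inner (frac_lap s e) e + \<i> * L2_inner (\<lambda>x. cz x - cw x) e" .
  moreover have "Im (L2_inner (frac_lap s e) e) = 0"
    by (subst L2_inner_trig_space_right[OF continuous_on_trig_space[OF frac_lap_in_trig_space[OF e]] e])
       (simp add: fourier_coeff_frac_lap[OF e] Im_sum mult.assoc)
  ultimately have "\<bar>Re (L2_inner (\<lambda>x. nls_rhs s N z x - nls_rhs s N w x) e)\<bar> = \<bar>Im (L2_inner (\<lambda>x. cz x - cw x) e)\<bar>"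
    by simp
  also have "Im (L2_inner (\<lambda>x. cz x - cw x) e) = integral {-pi..pi} (\<lambda>x. Im ((cz x - cw x) * cnj (e x)))"
    unfolding L2_inner_def
    by (subst integral_linear[OF _ bounded_linear_Im, unfolded o_def, symmetric])
       (auto intro!: integrable_continuous_interval continuous_intros c cont)
  also have "\<bar>\<dots>\<bar> \<le> integral {-pi..pi} (\<lambda>x. K * (K + Kz) * (cmod (e x))\<^sup>2)"
    unfolding real_norm_def[symmetric]
  proof (rule integral_norm_bound_integral)
    fix x
    have "norm (Im ((cz x - cw x) * cnj (e x))) \<le> cmod (w x) * (cmod (w x) + cmod (z x)) * (cmod (e x))\<^sup>2"
      using cubic_monotone[of "z x" "w x"] by (simp add: cz_def cw_def e_def)
    also have "\<dots> \<le> K * (K + Kz) * (cmod (e x))\<^sup>2"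
      by (intro mult_right_mono mult_mono add_mono wb zb K) auto
    finally show "norm (Im ((cz x - cw x) * cnj (e x))) \<le> K * (K + Kz) * (cmod (e x))\<^sup>2" .
  qed (intro integrable_continuous_interval continuous_intros c cont)+
  also have "\<dots> = K * (K + Kz) * (L2_norm e)\<^sup>2"
    by (simp add: L2_norm_L2_inner(2)[OF cont(1)])
  finally show ?thesis by (simp add: e_def)
qed

lemma nls_rhs_0: "nls_rhs s N (\<lambda>x. 0) x = 0"
  by (simp add: nls_rhs_def frac_lap_trig_space[OF trig_space_0[of N]] trig_proj_modes fourier_coeff_def)

text \<open>Test the difference of the two steps with the midpoint error \<open>em\<close>: its
  increment d = e1 - e0 satisfies |e1|^2 - |e0|^2 = 2 Re <d, em>. As |em| <= (a + b) / 2, everything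
  carries a factor a + b, which cancels. The rough bound \<open>Kz\<close> enters only linearly, and
  h may have either sign.\<close>

lemma midpoint_stability:
  assumes tp: "Z0 \<in> trig_space N" "Z1 \<in> trig_space N" "W0 \<in> trig_space N" "W1 \<in> trig_space N"
    and R: "R \<in> trig_space N"
    and Z: "\<And>x. Z1 x = Z0 x + of_real h * nls_rhs s N (\<lambda>y. (Z1 y + Z0 y) / 2) x"
    and W: "\<And>x. W1 x = W0 x + of_real h * nls_rhs s N (\<lambda>y. (W1 y + W0 y) / 2) x + R x"
    and zb: "\<And>x. cmod ((Z1 x + Z0 x) / 2) \<le> Kz" and wb: "\<And>x. cmod ((W1 x + W0 x) / 2) \<le> K"
  defines "a \<equiv> L2_norm (\<lambda>x. Z1 x - W1 x)" and "b \<equiv> L2_norm (\<lambda>x. Z0 x - W0 x)"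
  shows "a - b \<le> \<bar>h\<bar> * K * (K + Kz) * (a + b) / 2 + L2_norm R"
proof (cases "a + b = 0")
  case True
  then have "a = 0" "b = 0" using L2_norm_nonneg by (auto simp: a_def b_def add_nonneg_eq_0_iff)
  then show ?thesis by simp
next
  case False
  then have pos: "a + b > 0" using L2_norm_nonneg by (simp add: a_def b_def less_le)
  define zm where "zm = (\<lambda>y. (Z1 y + Z0 y) / 2)"
  define wm where "wm = (\<lambda>y. (W1 y + W0 y) / 2)"
  define e1 where "e1 = (\<lambda>x. Z1 x - W1 x)"
  define e0 where "e0 = (\<lambda>x. Z0 x - W0 x)"
  define em where "em = (\<lambda>x. zm x - wm x)"
  have half: "(\<lambda>y. (f y + g y) / 2) \<in> trig_space N" if "f \<in> trig_space N" "g \<in> trig_space N" for f g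
    using trig_space_scale[OF trig_space_add[OF that], of "1/2"] by simp
  have zm: "zm \<in> trig_space N" and wm: "wm \<in> trig_space N"
    unfolding zm_def wm_def by (intro half tp)+
  have e: "e1 \<in> trig_space N" "e0 \<in> trig_space N" "em \<in> trig_space N"
    unfolding e1_def e0_def em_def by (intro trig_space_intros tp zm wm)+
  note cont = continuous_on_trig_space[of _ N "{-pi..pi}"]
  have K: "K \<ge> 0" "Kz \<ge> 0" using zb[of 0] wb[of 0] norm_ge_zero order_trans by blast+
  define D where "D = (\<lambda>x. nls_rhs s N zm x - nls_rhs s N wm x)"
  have D: "D \<in> trig_space N" unfolding D_def by (intro trig_space_intros nls_rhs_in_trig_space zm wm)
  have diff: "e1 x - e0 x = of_real h * D x + (-1) * R x" for x
    using Z[of x] W[of x] by (simp add: e1_def e0_def D_def zm_def wm_def algebra_simps)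
  have em_le: "L2_norm em \<le> (a + b) / 2"
  proof -
    have "em = (\<lambda>x. (1/2) * (e1 x + e0 x))"
      by (auto simp: em_def zm_def wm_def e1_def e0_def field_simps)
    then have "L2_norm em = (1/2) * L2_norm (\<lambda>x. e1 x + e0 x)" by (simp only: L2_norm_scale) simp
    also have "\<dots> \<le> (1/2) * (a + b)"
      unfolding a_def b_def using L2_norm_triangle[OF cont[OF e(1)] cont[OF e(2)]] by (simp add: e1_def e0_def)
    finally show ?thesis by simp
  qed
  define d where "d = (\<lambda>x. e1 x - e0 x)"
  have d: "d \<in> trig_space N" unfolding d_def by (intro trig_space_intros e)
  have "a\<^sup>2 - b\<^sup>2 = 2 * Re (L2_inner d em)"
  proof -
    have "e1 = (\<lambda>x. em x + (1/2) * d x)" "e0 = (\<lambda>x. em x + (-1/2) * d x)"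
      by (auto simp: d_def em_def zm_def wm_def e1_def e0_def field_simps)
    then have "a\<^sup>2 = (L2_norm (\<lambda>x. em x + (1/2) * d x))\<^sup>2" "b\<^sup>2 = (L2_norm (\<lambda>x. em x + (-1/2) * d x))\<^sup>2"
      by (simp_all add: a_def b_def flip: e1_def e0_def)
    moreover have "L2_inner em (\<lambda>x. c * d x) = cnj c * cnj (L2_inner d em)" for c
      by (metis complex_cnj_mult L2_inner_cnj L2_inner_scale_left)
    ultimately show ?thesis
      by (simp only: L2_norm_add_sq[OF cont[OF e(3)] cont[OF trig_space_scale[OF d]]] L2_norm_scale) simp
  qed
  also have "L2_inner d em = of_real h * L2_inner D em + (-1) * L2_inner R em"
    unfolding d_def diff
    by (intro L2_inner_lincomb_left cont e D R)
  also have "2 * Re \<dots> \<le> 2 * (\<bar>h\<bar> * (K * (K + Kz) * (L2_norm em)\<^sup>2)) + 2 * (L2_norm R * L2_norm em)"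
  proof -
    have "\<bar>Re (L2_inner D em)\<bar> \<le> K * (K + Kz) * (L2_norm em)\<^sup>2"
      unfolding D_def em_def
      by (rule nls_rhs_monotone[OF zm wm]) (use zb wb in \<open>auto simp: zm_def wm_def\<close>)
    then have "\<bar>h * Re (L2_inner D em)\<bar> \<le> \<bar>h\<bar> * (K * (K + Kz) * (L2_norm em)\<^sup>2)"
      by (simp add: abs_mult mult_left_mono)
    moreover have "\<bar>Re (L2_inner R em)\<bar> \<le> L2_norm R * L2_norm em"
      using cauchy_schwarz_L2_inner[OF cont[OF R] cont[OF e(3)]] abs_Re_le_cmod order_trans by blast
    ultimately show ?thesis by simp
  qed
  also have "\<dots> \<le> 2 * (\<bar>h\<bar> * (K * (K + Kz) * ((a + b) / 2)\<^sup>2)) + 2 * (L2_norm R * ((a + b) / 2))"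
    by (intro add_mono mult_left_mono power_mono em_le) (use K in auto)
  also have "\<dots> = (\<bar>h\<bar> * K * (K + Kz) * (a + b) / 2 + L2_norm R) * (a + b)"
    by (simp add: power2_eq_square field_simps)
  finally have "(a - b) * (a + b) \<le> (\<bar>h\<bar> * K * (K + Kz) * (a + b) / 2 + L2_norm R) * (a + b)"
    by (simp add: power2_eq_square algebra_simps)
  then show ?thesis using pos by simp
qed

text \<open>Stability around the zero solution: with \<open>K = 0\<close> the rough bound
  \<open>Kz\<close> is multiplied by zero, so any finite bound on the midpoint will do, even one
  that depends on N.\<close>

lemma midpoint_mass:
  assumes "N \<ge> 1" and tp: "Z0 \<in> trig_space N" "Z1 \<in> trig_space N"
    and Z: "\<And>x. Z1 x = Z0 x + of_real h * nls_rhs s N (\<lambda>y. (Z1 y + Z0 y) / 2) x"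
  shows "L2_norm Z1 \<le> L2_norm Z0"
proof -
  define zm where "zm = (\<lambda>y. (Z1 y + Z0 y) / 2)"
  have zm: "zm \<in> trig_space N" unfolding zm_def
    using trig_space_scale[OF trig_space_add[OF tp(2,1)], of "1/2"] by simp
  have "cmod ((Z1 x + Z0 x) / 2) \<le> sqrt (real N * (L2_norm zm)\<^sup>2)" for x
    using trig_space_sup_le[OF assms(1) zm, of x] by (intro real_le_rsqrt) (simp add: zm_def)
  from midpoint_stability[OF tp trig_space_0 trig_space_0 trig_space_0 Z _ this, of 0]
  show ?thesis by (simp add: nls_rhs_0 L2_norm_def)
qed

section \<open>Wiener algebra\<close>

text \<open>Weighted l1 norm of the coefficients. It dominates the sup norm and is multiplicative
  with constant 1 for every weight exponent, so estimates in it are independent of N. Summing over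
  \<open>modes N\<close> only makes it blind to \<open>trig_proj N\<close>.\<close>

definition wiener :: "nat \<Rightarrow> nat \<Rightarrow> (real \<Rightarrow> complex) \<Rightarrow> real" where
  "wiener N r f = (\<Sum>m\<in>modes N. (1 + \<bar>of_int m\<bar>) ^ r * cmod (fourier_coeff f m))"

lemma wiener_nonneg [simp]: "wiener N r f \<ge> 0"
  unfolding wiener_def by (intro sum_nonneg) auto

lemma wiener_mono: "r \<le> r' \<Longrightarrow> wiener N r f \<le> wiener N r' f"
  unfolding wiener_def by (intro sum_mono mult_right_mono power_increasing) auto

lemma wiener_sup: "f \<in> trig_space N \<Longrightarrow> cmod (f x) \<le> wiener N r f"
proof -
  assume f: "f \<in> trig_space N"
  have "cmod (f x) \<le> wiener N 0 f"
    unfolding wiener_def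
    by (subst trig_space_expand[OF f]) (rule order_trans[OF norm_sum], simp add: norm_mult)
  then show ?thesis using wiener_mono[of 0 r N f] by simp
qed

lemma L2_norm_le_wiener: "f \<in> trig_space N \<Longrightarrow> L2_norm f \<le> 3 * wiener N r f"
  by (intro L2_norm_le_sup wiener_sup continuous_on_trig_space)

lemma wiener_add:
  assumes "continuous_on {-pi..pi} f" "continuous_on {-pi..pi} g"
  shows "wiener N r (\<lambda>x. f x + g x) \<le> wiener N r f + wiener N r g"
  unfolding wiener_def sum.distrib[symmetric] fourier_coeff_add[OF assms] distrib_left[symmetric]
  by (intro sum_mono mult_left_mono norm_triangle_ineq) auto

lemma wiener_scale: "wiener N r (\<lambda>x. c * f x) = cmod c * wiener N r f"
  by (simp add: wiener_def fourier_coeff_scale norm_mult sum_distrib_left mult_ac)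

lemma wiener_0: "wiener N r (\<lambda>x. 0) = 0"
  using wiener_scale[of N r 0 "\<lambda>x. 0"] by simp

lemma wiener_sum:
  assumes "\<And>i. i \<in> I \<Longrightarrow> continuous_on {-pi..pi} (f i)"
  shows "wiener N r (\<lambda>x. \<Sum>i\<in>I. f i x) \<le> (\<Sum>i\<in>I. wiener N r (f i))"
  using assms
proof (induction I rule: infinite_finite_induct)
  case (insert i I)
  then show ?case
    using order_trans[OF wiener_add[of "f i" "\<lambda>x. \<Sum>i\<in>I. f i x" N r] add_left_mono[OF insert.IH, of "wiener N r (f i)"]]
    by (simp add: continuous_intros)
qed (simp_all add: wiener_0)

lemma wiener_trig_proj: "wiener N r (trig_proj N f) = wiener N r f"
  by (simp add: wiener_def fourier_coeff_trig_proj)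

lemma frac_lap_symbol_le:
  assumes "0 < s" "s \<le> 1"
  shows "\<bar>real_of_int m\<bar> powr (2 * s) \<le> (1 + \<bar>of_int m\<bar>) ^ 2"
proof -
  have "\<bar>real_of_int m\<bar> powr (2 * s) \<le> (1 + \<bar>of_int m\<bar>) powr (2 * s)"
    using assms by (intro powr_mono2) auto
  also have "\<dots> \<le> (1 + \<bar>of_int m\<bar>) powr 2"
    using assms by (intro powr_mono) auto
  finally show ?thesis by simp
qed

lemma wiener_frac_lap:
  assumes s: "0 < s" "s \<le> 1" and f: "f \<in> trig_space N"
  shows "wiener N r (frac_lap s f) \<le> wiener N (r + 2) f"
  unfolding wiener_def fourier_coeff_frac_lap[OF f]
proof (intro sum_mono)
  fix m :: int
  have "\<bar>real_of_int m\<bar> powr (2 * s) \<le> (1 + \<bar>of_int m\<bar>) ^ 2" by (rule frac_lap_symbol_le[OF s])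
  then have "(1 + \<bar>of_int m\<bar>) ^ r * (\<bar>of_int m\<bar> powr (2 * s) * cmod (fourier_coeff f m)) \<le>
      (1 + \<bar>of_int m\<bar>) ^ r * ((1 + \<bar>of_int m\<bar>) ^ 2 * cmod (fourier_coeff f m))"
    by (intro mult_left_mono mult_right_mono) auto
  then show "(1 + \<bar>of_int m\<bar>) ^ r * cmod (of_real (\<bar>of_int m\<bar> powr (2 * s)) * fourier_coeff f m) \<le>
      (1 + \<bar>of_int m\<bar>) ^ (r + 2) * cmod (fourier_coeff f m)"
    by (simp add: norm_mult power_add power2_eq_square mult.assoc)
qed

text \<open>The frequencies \<open>p i\<close> may coincide or lie outside the band: equal ones are
  handled by the triangle inequality, the others only enlarge the right-hand side. Products can thus
  be expanded without collecting equal frequencies.\<close>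

lemma wiener_sum_cis:
  assumes "finite I"
  shows "wiener N r (\<lambda>x. \<Sum>i\<in>I. c i * cis (of_int (p i) * x)) \<le> (\<Sum>i\<in>I. (1 + \<bar>of_int (p i)\<bar>) ^ r * cmod (c i))"
proof -
  have "wiener N r (\<lambda>x. \<Sum>i\<in>I. c i * cis (of_int (p i) * x)) \<le>
      (\<Sum>m\<in>modes N. \<Sum>i\<in>I. (1 + \<bar>of_int m\<bar>) ^ r * cmod (if p i = m then c i else 0))"
    unfolding wiener_def fourier_coeff_sum_cis[OF assms] sum_distrib_left[symmetric]
    by (intro sum_mono mult_left_mono norm_sum) auto
  also have "\<dots> = (\<Sum>i\<in>I. \<Sum>m\<in>modes N. if m = p i then (1 + \<bar>of_int m\<bar>) ^ r * cmod (c i) else 0)"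
    by (subst sum.swap) (intro sum.cong refl, auto)
  also have "\<dots> \<le> (\<Sum>i\<in>I. (1 + \<bar>of_int (p i)\<bar>) ^ r * cmod (c i))"
    by (intro sum_mono) simp
  finally show ?thesis .
qed

text \<open>The weight is submultiplicative: 1 + |p - q + l| is at most the product of the three
  factors for p, q and l. After expansion into triples of frequencies the sum separates.\<close>

lemma wiener_triple:
  assumes a: "a \<in> trig_space N" and b: "b \<in> trig_space N" and c: "c \<in> trig_space N"
  shows "wiener N r (\<lambda>x. a x * cnj (b x) * c x) \<le> wiener N r a * wiener N r b * wiener N r c"
proof -
  let ?f = "fourier_coeff"
  let ?I = "modes N \<times> modes N \<times> modes N"
  let ?w = "\<lambda>m::int. (1 + \<bar>real_of_int m\<bar>) ^ r"
  have prod3: "(\<Sum>p\<in>modes N. A p) * (\<Sum>q\<in>modes N. B q) * (\<Sum>l\<in>modes N. D l) =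
      (\<Sum>(p, q, l)\<in>?I. A p * B q * D l)" for A B D :: "int \<Rightarrow> 'z::comm_semiring_1"
  proof -
    have "(\<Sum>p\<in>modes N. A p) * ((\<Sum>q\<in>modes N. B q) * (\<Sum>l\<in>modes N. D l)) =
        (\<Sum>p\<in>modes N. \<Sum>z\<in>modes N \<times> modes N. A p * (case z of (q, l) \<Rightarrow> B q * D l))"
      by (simp only: sum_product sum.cartesian_product)
    then show ?thesis
      by (simp add: sum.cartesian_product mult.assoc split_def)
  qed
  have exp: "a x * cnj (b x) * c x =
      (\<Sum>(p, q, l)\<in>?I. (?f a p * cnj (?f b q) * ?f c l) * cis (of_int (p - q + l) * x))" for x
  proof -
    have "a x * cnj (b x) * c x = (\<Sum>p\<in>modes N. ?f a p * cis (of_int p * x)) *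
        (\<Sum>q\<in>modes N. cnj (?f b q * cis (of_int q * x))) * (\<Sum>l\<in>modes N. ?f c l * cis (of_int l * x))"
      by (subst trig_space_expand[OF a], subst trig_space_expand[OF b], subst trig_space_expand[OF c]) simp
    also have "\<dots> = (\<Sum>(p, q, l)\<in>?I. (?f a p * cnj (?f b q) * ?f c l) * cis (of_int (p - q + l) * x))"
      unfolding prod3
    proof (intro sum.cong refl, clarify)
      fix p q l
      have "cis (of_int (p - q + l) * x) = cis (of_int p * x) * cnj (cis (of_int q * x)) * cis (of_int l * x)"
        by (simp add: cis_cnj cis_mult algebra_simps)
      then show "?f a p * cis (of_int p * x) * cnj (?f b q * cis (of_int q * x)) * (?f c l * cis (of_int l * x)) =
          (?f a p * cnj (?f b q) * ?f c l) * cis (of_int (p - q + l) * x)" by simp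
    qed
    finally show ?thesis .
  qed
  have "wiener N r (\<lambda>x. a x * cnj (b x) * c x) \<le>
      (\<Sum>i\<in>?I. (1 + \<bar>of_int (case i of (p, q, l) \<Rightarrow> p - q + l)\<bar>) ^ r *
          cmod (case i of (p, q, l) \<Rightarrow> ?f a p * cnj (?f b q) * ?f c l))"
    unfolding exp
    using wiener_sum_cis[of ?I N r "\<lambda>i. case i of (p, q, l) \<Rightarrow> ?f a p * cnj (?f b q) * ?f c l"
       "\<lambda>i. case i of (p, q, l) \<Rightarrow> p - q + l"]
    by (simp add: split_def)
  also have "\<dots> \<le> (\<Sum>(p, q, l)\<in>?I. (?w p * cmod (?f a p)) * (?w q * cmod (?f b q)) * (?w l * cmod (?f c l)))"
  proof (intro sum_mono, clarify)
    fix p q l :: int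
    have "1 + \<bar>real_of_int (p - q + l)\<bar> \<le> 1 + (\<bar>real_of_int p\<bar> + \<bar>real_of_int q\<bar> + \<bar>real_of_int l\<bar>)"
      by auto
    also have "\<dots> \<le> (1 + \<bar>real_of_int p\<bar>) * (1 + \<bar>real_of_int q\<bar>) * (1 + \<bar>real_of_int l\<bar>)"
      by (simp add: algebra_simps)
    finally have "?w (p - q + l) \<le> ((1 + \<bar>real_of_int p\<bar>) * (1 + \<bar>real_of_int q\<bar>) * (1 + \<bar>real_of_int l\<bar>)) ^ r"
      by (rule power_mono) simp
    then have "?w (p - q + l) * (cmod (?f a p) * cmod (?f b q) * cmod (?f c l)) \<le>
        (?w p * ?w q * ?w l) * (cmod (?f a p) * cmod (?f b q) * cmod (?f c l))"
      by (intro mult_right_mono) (auto simp: power_mult_distrib)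
    then show "?w (p - q + l) * cmod (?f a p * cnj (?f b q) * ?f c l) \<le>
        (?w p * cmod (?f a p)) * (?w q * cmod (?f b q)) * (?w l * cmod (?f c l))"
      by (simp add: norm_mult mult_ac)
  qed
  also have "\<dots> = wiener N r a * wiener N r b * wiener N r c"
    unfolding wiener_def prod3 ..
  finally show ?thesis .
qed

section \<open>Polynomials in the step size and the vector field on them\<close>

text \<open>A sequence \<open>a\<close> stands for the polynomial \<open>\<Sum>j<5. k ^ j * a j\<close> in the real parameter \<open>k\<close>;
  only \<open>a 0, \<dots>, a 4\<close> matter. \<open>F_coeff\<close> is the coefficient of \<open>k ^ d\<close> in \<^const>\<open>nls_rhs\<close> of it
  (for \<open>d < 4\<close>).\<close>

definition triples :: "(nat \<times> nat \<times> nat) set" where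
  "triples = {..<5} \<times> {..<5} \<times> {..<5}"

definition triple_deg :: "nat \<times> nat \<times> nat \<Rightarrow> nat" where
  "triple_deg = (\<lambda>(i, j, l). i + j + l)"

definition triple_term :: "(nat \<Rightarrow> real \<Rightarrow> complex) \<Rightarrow> nat \<times> nat \<times> nat \<Rightarrow> real \<Rightarrow> complex" where
  "triple_term a = (\<lambda>(i, j, l) x. a i x * cnj (a j x) * a l x)"

definition cubic_coeff :: "(nat \<Rightarrow> real \<Rightarrow> complex) \<Rightarrow> nat \<Rightarrow> real \<Rightarrow> complex" where
  "cubic_coeff a d x = (\<Sum>t\<in>{t \<in> triples. triple_deg t = d}. triple_term a t x)"

definition F_coeff :: "real \<Rightarrow> nat \<Rightarrow> (nat \<Rightarrow> real \<Rightarrow> complex) \<Rightarrow> nat \<Rightarrow> real \<Rightarrow> complex" where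
  "F_coeff s N a d x = - \<i> * frac_lap s (a d) x + \<i> * trig_proj N (cubic_coeff a d) x"

definition poly4 :: "(nat \<Rightarrow> real \<Rightarrow> complex) \<Rightarrow> real \<Rightarrow> real \<Rightarrow> complex" where
  "poly4 a k x = (\<Sum>j<5. of_real (k ^ j) * a j x)"

text \<open>All contributions of degree 4 and more, divided by k^4. The linear part has only degree
  4 there, the cubic one reaches degree 12; the truncated subtraction is exact because of the
  restriction on the degree.\<close>

definition F_remainder :: "real \<Rightarrow> nat \<Rightarrow> (nat \<Rightarrow> real \<Rightarrow> complex) \<Rightarrow> real \<Rightarrow> real \<Rightarrow> complex" where
  "F_remainder s N a k x = - \<i> * frac_lap s (a 4) x +
     \<i> * (\<Sum>t\<in>{t \<in> triples. triple_deg t \<ge> 4}. of_real (k ^ (triple_deg t - 4)) * trig_proj N (triple_term a t) x)"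

lemma finite_triples [simp]: "finite triples" "finite {t \<in> triples. Q t}"
  by (simp_all add: triples_def)

lemma card_triples: "card triples = 125"
  by (simp add: triples_def)

lemma continuous_on_triple_term:
  assumes "\<And>j. j < 5 \<Longrightarrow> a j \<in> trig_space N" "t \<in> triples"
  shows "continuous_on S (triple_term a t)"
proof -
  have "continuous_on S (a j)" if "j < 5" for j
    using assms(1)[OF that] by (rule continuous_on_trig_space)
  then show ?thesis
    using assms(2) by (auto simp: triples_def triple_term_def intro!: continuous_intros)
qed

text \<open>An exact identity, because the vector field is linear plus cubic in v and its conjugate.
  As k is real, conjugation leaves its powers alone and the terms can be sorted by total
  degree.\<close>

lemma nls_rhs_poly4:
  assumes a: "\<And>j. j < 5 \<Longrightarrow> a j \<in> trig_space N"
  shows "nls_rhs s N (poly4 a k) x = (\<Sum>d<4. of_real (k ^ d) * F_coeff s N a d x) + of_real (k ^ 4) * F_remainder s N a k x"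
proof -
  have split: "(\<Sum>t\<in>triples. of_real (k ^ triple_deg t) * g t) =
      (\<Sum>d<4. of_real (k ^ d) * (\<Sum>t\<in>{t \<in> triples. triple_deg t = d}. g t)) +
      of_real (k ^ 4) * (\<Sum>t\<in>{t \<in> triples. triple_deg t \<ge> 4}. of_real (k ^ (triple_deg t - 4)) * g t)"
    for g :: "_ \<Rightarrow> complex"
  proof -
    have "(\<Sum>t\<in>triples. of_real (k ^ triple_deg t) * g t) =
        (\<Sum>t\<in>{t \<in> triples. triple_deg t < 4}. of_real (k ^ triple_deg t) * g t) +
        (\<Sum>t\<in>{t \<in> triples. triple_deg t \<ge> 4}. of_real (k ^ triple_deg t) * g t)"
      by (subst sum.union_disjoint[symmetric]) (auto intro!: sum.cong)
    also have "(\<Sum>t\<in>{t \<in> triples. triple_deg t < 4}. of_real (k ^ triple_deg t) * g t) =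
        (\<Sum>d<4. \<Sum>t\<in>{t \<in> {t \<in> triples. triple_deg t < 4}. triple_deg t = d}. of_real (k ^ triple_deg t) * g t)"
      by (subst sum.group) auto
    also have "\<dots> = (\<Sum>d<4. of_real (k ^ d) * (\<Sum>t\<in>{t \<in> triples. triple_deg t = d}. g t))"
      by (auto simp: sum_distrib_left intro!: sum.cong)
    also have "(\<Sum>t\<in>{t \<in> triples. triple_deg t \<ge> 4}. of_real (k ^ triple_deg t) * g t) =
        of_real (k ^ 4) * (\<Sum>t\<in>{t \<in> triples. triple_deg t \<ge> 4}. of_real (k ^ (triple_deg t - 4)) * g t)"
      unfolding sum_distrib_left
      by (intro sum.cong refl) (simp add: mult.assoc[symmetric] flip: power_add of_real_mult of_real_power)
    finally show ?thesis .
  qed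
  have cub: "of_real ((cmod (poly4 a k x))\<^sup>2) * poly4 a k x = (\<Sum>t\<in>triples. of_real (k ^ triple_deg t) * triple_term a t x)" for x
  proof -
    have "of_real ((cmod (poly4 a k x))\<^sup>2) * poly4 a k x = poly4 a k x * (cnj (poly4 a k x) * poly4 a k x)"
      by (simp only: complex_norm_square mult_ac)
    also have "\<dots> = (\<Sum>i<5. \<Sum>z\<in>{..<5} \<times> {..<5}. of_real (k ^ i) * a i x *
          (case z of (j, l) \<Rightarrow> cnj (of_real (k ^ j) * a j x) * (of_real (k ^ l) * a l x)))"
      unfolding poly4_def cnj_sum by (simp only: sum_product sum.cartesian_product)
    also have "\<dots> = (\<Sum>t\<in>triples. of_real (k ^ triple_deg t) * triple_term a t x)"
      unfolding triples_def sum.cartesian_product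
      by (intro sum.cong refl) (auto simp: triple_deg_def triple_term_def power_add)
    finally show ?thesis .
  qed
  have "frac_lap s (poly4 a k) x = (\<Sum>j<5. of_real (k ^ j) * frac_lap s (a j) x)"
    unfolding poly4_def[abs_def] by (rule frac_lap_sum) (use a in auto)
  also have "\<dots> = (\<Sum>d<4. of_real (k ^ d) * frac_lap s (a d) x) + of_real (k ^ 4) * frac_lap s (a 4) x"
    by (simp add: numeral_eq_Suc)
  finally have lap: "frac_lap s (poly4 a k) x = \<dots>" .
  define C where "C d = trig_proj N (cubic_coeff a d) x" for d
  define R where "R = (\<Sum>t\<in>{t \<in> triples. triple_deg t \<ge> 4}. of_real (k ^ (triple_deg t - 4)) * trig_proj N (triple_term a t) x)"
  have C: "C d = (\<Sum>t\<in>{t \<in> triples. triple_deg t = d}. trig_proj N (triple_term a t) x)" for d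
    using trig_proj_sum[of "{t \<in> triples. triple_deg t = d}" "triple_term a" N "\<lambda>_. 1" x]
      continuous_on_triple_term[OF a] by (simp add: cubic_coeff_def[abs_def] C_def)
  have "trig_proj N (\<lambda>y. of_real ((cmod (poly4 a k y))\<^sup>2) * poly4 a k y) x =
      (\<Sum>t\<in>triples. of_real (k ^ triple_deg t) * trig_proj N (triple_term a t) x)"
    unfolding cub by (rule trig_proj_sum) (rule continuous_on_triple_term[OF a])
  also have "\<dots> = (\<Sum>d<4. of_real (k ^ d) * C d) + of_real (k ^ 4) * R"
    unfolding C R_def by (rule split)
  finally have proj: "trig_proj N (\<lambda>y. of_real ((cmod (poly4 a k y))\<^sup>2) * poly4 a k y) x = \<dots>" .
  have sum: "(\<Sum>d<4. of_real (k ^ d) * (- \<i> * L d + \<i> * C d)) =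
      - \<i> * (\<Sum>d<4. of_real (k ^ d) * L d) + \<i> * (\<Sum>d<4. of_real (k ^ d) * C d)" for L
    unfolding sum_distrib_left by (subst sum.distrib[symmetric], intro sum.cong refl) (simp add: algebra_simps)
  have alg: "- \<i> * (A + q * B) + \<i> * (D + q * E) = - \<i> * A + \<i> * D + q * (- \<i> * B + \<i> * E)" for A B D E q
    by (simp add: algebra_simps)
  show ?thesis
    unfolding nls_rhs_def lap proj F_coeff_def C_def[symmetric] F_remainder_def R_def[symmetric] sum by (rule alg)
qed

lemma wiener_triple_term:
  assumes a: "\<And>j. j < 5 \<Longrightarrow> j \<le> triple_deg t \<Longrightarrow> a j \<in> trig_space N \<and> wiener N r (a j) \<le> M" and t: "t \<in> triples"
  shows "wiener N r (triple_term a t) \<le> M ^ 3"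
proof -
  obtain i j l where [simp]: "t = (i, j, l)" by (cases t)
  have *: "a i \<in> trig_space N \<and> wiener N r (a i) \<le> M" "a j \<in> trig_space N \<and> wiener N r (a j) \<le> M"
      "a l \<in> trig_space N \<and> wiener N r (a l) \<le> M"
    using t by (auto intro!: a simp: triples_def triple_deg_def)
  have M: "M \<ge> 0" using *(1) wiener_nonneg order_trans by blast
  have "wiener N r (triple_term a t) \<le> wiener N r (a i) * wiener N r (a j) * wiener N r (a l)"
    unfolding triple_term_def by (simp, intro wiener_triple) (use * in auto)
  also have "\<dots> \<le> M * M * M"
    using * M by (intro mult_mono) auto
  finally show ?thesis by (simp add: power3_eq_cube)
qed

text \<open>Effect of one application of the vector field on coefficients bounded by M: the linear
  part gives M, and each of at most 125 = 5^3 triples gives M^3. Iterates bound nested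
  applications.\<close>

definition growth :: "real \<Rightarrow> real" where "growth M = M + 125 * M ^ 3"

lemma growth_ge: "M \<ge> 0 \<Longrightarrow> M \<le> growth M"
  by (simp add: growth_def)

lemma continuous_on_cubic_coeff:
  assumes "\<And>j. j \<le> d \<Longrightarrow> a j \<in> trig_space N"
  shows "continuous_on S (cubic_coeff a d)"
proof -
  have "continuous_on S (a j)" if "j \<le> d" for j
    using assms(1)[OF that] by (rule continuous_on_trig_space)
  then show ?thesis
    unfolding cubic_coeff_def[abs_def]
    by (auto intro!: continuous_intros simp: triple_term_def triple_deg_def)
qed

lemma F_coeff_in_trig_space:
  assumes "a d \<in> trig_space N" shows "F_coeff s N a d \<in> trig_space N"
  unfolding F_coeff_def[abs_def]
  by (intro trig_space_intros frac_lap_in_trig_space trig_proj_in_trig_space assms)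

text \<open>The loss of two orders of the weight comes from the symbol of order 2s <= 2; the cubic
  term loses none. Only degrees up to d are involved, so the bound can be used inside a recursion on
  the degree.\<close>

lemma wiener_F_coeff:
  assumes s: "0 < s" "s \<le> 1"
    and a: "\<And>j. j \<le> d \<Longrightarrow> a j \<in> trig_space N" and b: "\<And>j. j \<le> d \<Longrightarrow> wiener N (r + 2) (a j) \<le> M"
  shows "wiener N r (F_coeff s N a d) \<le> growth M"
proof -
  have b': "wiener N r (a j) \<le> M" if "j \<le> d" for j
    using b[OF that] wiener_mono[of r "r + 2" N "a j"] by simp
  have M: "M \<ge> 0" using b[of 0] wiener_nonneg order_trans by blast
  have c: "continuous_on {-pi..pi} (triple_term a t)" if "triple_deg t = d" for t
  proof -
    have "continuous_on {-pi..pi} (a j)" if "j \<le> d" for j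
      using a[OF that] by (rule continuous_on_trig_space)
    then show ?thesis
      using that by (cases t) (auto simp: triple_term_def triple_deg_def intro!: continuous_intros)
  qed
  have "wiener N r (cubic_coeff a d) \<le> (\<Sum>t\<in>{t \<in> triples. triple_deg t = d}. wiener N r (triple_term a t))"
    unfolding cubic_coeff_def[abs_def] by (rule wiener_sum) (use c in auto)
  also have "\<dots> \<le> (\<Sum>t\<in>{t \<in> triples. triple_deg t = d}. M ^ 3)"
    by (intro sum_mono wiener_triple_term) (use a b' in auto)
  also have "\<dots> \<le> 125 * M ^ 3"
    using card_mono[of triples "{t \<in> triples. triple_deg t = d}"] M by (simp add: card_triples mult_right_mono)
  finally have "wiener N r (trig_proj N (cubic_coeff a d)) \<le> 125 * M ^ 3" by (simp add: wiener_trig_proj)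
  moreover have "wiener N r (frac_lap s (a d)) \<le> M"
    using order_trans[OF wiener_frac_lap[OF s a[OF order_refl]] b[OF order_refl]] .
  moreover have "wiener N r (F_coeff s N a d) \<le> wiener N r (\<lambda>x. (-\<i>) * frac_lap s (a d) x) + wiener N r (\<lambda>x. \<i> * trig_proj N (cubic_coeff a d) x)"
    unfolding F_coeff_def[abs_def]
    by (intro wiener_add continuous_on_trig_space[of _ N] trig_space_intros frac_lap_in_trig_space trig_proj_in_trig_space a order_refl)
  ultimately show ?thesis by (simp only: wiener_scale growth_def) simp
qed

lemma F_remainder_in_trig_space:
  assumes "a 4 \<in> trig_space N" shows "F_remainder s N a k \<in> trig_space N"
  unfolding F_remainder_def[abs_def]
  by (intro trig_space_intros frac_lap_in_trig_space trig_proj_in_trig_space assms)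

lemma wiener_F_remainder:
  assumes s: "0 < s" "s \<le> 1" and k: "\<bar>k\<bar> \<le> 1"
    and a: "\<And>j. j < 5 \<Longrightarrow> a j \<in> trig_space N" and b: "\<And>j. j < 5 \<Longrightarrow> wiener N 2 (a j) \<le> M"
  shows "wiener N 0 (F_remainder s N a k) \<le> growth M"
proof -
  have b': "wiener N 0 (a j) \<le> M" if "j < 5" for j
    using b[OF that] wiener_mono[of 0 2 N "a j"] by simp
  have M: "M \<ge> 0" using b[of 0] wiener_nonneg[of N 2 "a 0"] by linarith
  let ?T = "{t \<in> triples. triple_deg t \<ge> 4}"
  let ?S = "\<lambda>x. \<Sum>t\<in>?T. of_real (k ^ (triple_deg t - 4)) * trig_proj N (triple_term a t) x"
  have S: "?S \<in> trig_space N" by (intro trig_space_intros trig_proj_in_trig_space)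
  have "wiener N 0 ?S \<le> (\<Sum>t\<in>?T. wiener N 0 (\<lambda>x. of_real (k ^ (triple_deg t - 4)) * trig_proj N (triple_term a t) x))"
    by (intro wiener_sum continuous_on_trig_space[of _ N] trig_space_intros trig_proj_in_trig_space)
  also have "\<dots> \<le> (\<Sum>t\<in>?T. M ^ 3)"
  proof (intro sum_mono)
    fix t assume t: "t \<in> ?T"
    have "\<bar>k\<bar> ^ (triple_deg t - 4) \<le> 1" using k by (simp add: power_le_one)
    moreover have "wiener N 0 (triple_term a t) \<le> M ^ 3"
      by (intro wiener_triple_term) (use a b' t in auto)
    ultimately have "\<bar>k\<bar> ^ (triple_deg t - 4) * wiener N 0 (triple_term a t) \<le> 1 * M ^ 3"
      by (intro mult_mono) auto
    then show "wiener N 0 (\<lambda>x. of_real (k ^ (triple_deg t - 4)) * trig_proj N (triple_term a t) x) \<le> M ^ 3"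
      by (simp only: wiener_scale wiener_trig_proj) (simp add: power_abs norm_power)
  qed
  also have "\<dots> \<le> 125 * M ^ 3"
    using card_mono[of triples ?T] M by (simp add: card_triples mult_right_mono)
  finally have "wiener N 0 ?S \<le> 125 * M ^ 3" .
  moreover have "wiener N 0 (frac_lap s (a 4)) \<le> M"
    using order_trans[OF wiener_frac_lap[OF s a[of 4], of 0, unfolded add_0], of M] b[of 4] by simp
  moreover have "wiener N 0 (F_remainder s N a k) \<le> wiener N 0 (\<lambda>x. (-\<i>) * frac_lap s (a 4) x) + wiener N 0 (\<lambda>x. \<i> * ?S x)"
    unfolding F_remainder_def[abs_def]
    by (intro wiener_add continuous_on_trig_space[of _ N] trig_space_intros frac_lap_in_trig_space trig_proj_in_trig_space a) simp
  ultimately show ?thesis by (simp only: wiener_scale growth_def) simp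
qed

lemma F_coeff_cong:
  assumes "\<And>j. j \<le> d \<Longrightarrow> a j = b j"
  shows "F_coeff s N a d = F_coeff s N b d"
proof -
  have "cubic_coeff a d = cubic_coeff b d"
    unfolding cubic_coeff_def[abs_def] using assms
    by (intro ext sum.cong refl) (auto simp: triple_term_def triple_deg_def)
  then show ?thesis by (simp add: F_coeff_def[abs_def] assms)
qed

section \<open>Expansion of the flow and of the stages\<close>

text \<open>\<open>F_coeff\<close> takes a whole sequence, so the recursion carries the sequence
  built so far and updates one entry; \<open>taylor\<close> reads off the diagonal. This is
  consistent because \<open>F_coeff\<close> in degree d depends only on the entries up to d.\<close>

primrec taylor_seq :: "real \<Rightarrow> nat \<Rightarrow> (real \<Rightarrow> complex) \<Rightarrow> nat \<Rightarrow> nat \<Rightarrow> real \<Rightarrow> complex" where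
  "taylor_seq s N y0 0 = (\<lambda>_. y0)"
| "taylor_seq s N y0 (Suc d) =
    (taylor_seq s N y0 d)(Suc d := \<lambda>x. of_real (1 / real (Suc d)) * F_coeff s N (taylor_seq s N y0 d) d x)"

definition taylor :: "real \<Rightarrow> nat \<Rightarrow> (real \<Rightarrow> complex) \<Rightarrow> nat \<Rightarrow> real \<Rightarrow> complex" where
  "taylor s N y0 j = taylor_seq s N y0 j j"

lemma taylor_seq_eq: "j \<le> d \<Longrightarrow> taylor_seq s N y0 d j = taylor s N y0 j"
  by (induction d) (auto simp: taylor_def le_Suc_eq)

lemma taylor_0: "taylor s N y0 0 = y0"
  by (simp add: taylor_def)

text \<open>Comparison of the coefficients of degree d in y' = F(y), y(0) = y0.\<close>

lemma taylor_Suc: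
  "taylor s N y0 (Suc d) = (\<lambda>x. of_real (1 / real (Suc d)) * F_coeff s N (taylor s N y0) d x)"
proof -
  have "F_coeff s N (taylor_seq s N y0 d) d = F_coeff s N (taylor s N y0) d"
    by (rule F_coeff_cong) (simp add: taylor_seq_eq)
  then show ?thesis by (simp add: taylor_def)
qed

lemma taylor_in_trig_space:
  assumes "y0 \<in> trig_space N" shows "taylor s N y0 j \<in> trig_space N"
  by (induction j) (auto simp only: taylor_0 taylor_Suc assms intro!: trig_space_intros F_coeff_in_trig_space)

lemma growth_nonneg: "M \<ge> 0 \<Longrightarrow> growth M \<ge> 0"
  by (simp add: growth_def)

lemma growth_pow_nonneg: "M \<ge> 0 \<Longrightarrow> (growth ^^ n) M \<ge> 0"
  by (induction n) (auto intro: growth_nonneg)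

lemma growth_pow_mono: "M \<ge> 0 \<Longrightarrow> i \<le> j \<Longrightarrow> (growth ^^ i) M \<le> (growth ^^ j) M"
  by (rule lift_Suc_mono_le[of "\<lambda>n. (growth ^^ n) M"]) (auto intro: growth_ge growth_pow_nonneg)

text \<open>Each step of the recursion applies the vector field once, at the price of two orders of
  the weight and one \<open>growth\<close>. Earlier coefficients have orders to spare, so the entry
  just before decides.\<close>

lemma wiener_taylor:
  assumes s: "0 < s" "s \<le> 1" and y0: "y0 \<in> trig_space N" and b: "wiener N 10 y0 \<le> M"
  shows "j \<le> 5 \<Longrightarrow> wiener N (10 - 2 * j) (taylor s N y0 j) \<le> (growth ^^ j) M"
proof (induction j rule: less_induct)
  case (less j)
  have M: "M \<ge> 0" using b wiener_nonneg order_trans by blast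
  show ?case
  proof (cases j)
    case (Suc d)
    have d: "10 - 2 * d = (10 - 2 * j) + 2" using Suc less.prems by auto
    have "wiener N (10 - 2 * j) (F_coeff s N (taylor s N y0) d) \<le> growth ((growth ^^ d) M)"
    proof (rule wiener_F_coeff[OF s])
      fix i assume i: "i \<le> d"
      show "taylor s N y0 i \<in> trig_space N" by (rule taylor_in_trig_space[OF y0])
      have "wiener N (10 - 2 * j + 2) (taylor s N y0 i) \<le> wiener N (10 - 2 * i) (taylor s N y0 i)"
        by (rule wiener_mono) (use i Suc less.prems in auto)
      also have "\<dots> \<le> (growth ^^ i) M" using i Suc less by auto
      also have "\<dots> \<le> (growth ^^ d) M" by (rule growth_pow_mono[OF M i])
      finally show "wiener N (10 - 2 * j + 2) (taylor s N y0 i) \<le> (growth ^^ d) M" .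
    qed
    moreover have "wiener N (10 - 2 * j) (taylor s N y0 j) = (1 / real (Suc d)) * wiener N (10 - 2 * j) (F_coeff s N (taylor s N y0) d)"
      unfolding Suc taylor_Suc by (simp only: wiener_scale norm_of_real) simp
    moreover have "(1 / real (Suc d)) * wiener N (10 - 2 * j) (F_coeff s N (taylor s N y0) d) \<le>
        1 * wiener N (10 - 2 * j) (F_coeff s N (taylor s N y0) d)"
      by (intro mult_right_mono) auto
    ultimately show ?thesis by (simp add: Suc)
  qed (simp add: taylor_0 b)
qed

lemma poly4_in_trig_space: "(\<And>j. j < 5 \<Longrightarrow> a j \<in> trig_space N) \<Longrightarrow> poly4 a k \<in> trig_space N"
  unfolding poly4_def[abs_def] by (intro trig_space_intros) auto

lemma poly4_bound:
  assumes a: "\<And>j. j < 5 \<Longrightarrow> a j \<in> trig_space N" and k: "\<bar>k\<bar> \<le> 1"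
    and b: "\<And>j. j < 5 \<Longrightarrow> wiener N r (a j) \<le> M"
  shows "cmod (poly4 a k x) \<le> 5 * M"
proof -
  have M: "M \<ge> 0" using b[of 0] wiener_nonneg[of N r "a 0"] by linarith
  have "cmod (poly4 a k x) \<le> (\<Sum>j<5. \<bar>k\<bar> ^ j * cmod (a j x))"
    unfolding poly4_def by (rule order_trans[OF norm_sum]) (simp add: norm_mult norm_power)
  also have "\<dots> \<le> (\<Sum>j<5::nat. 1 * M)"
  proof (intro sum_mono mult_mono)
    fix j :: nat assume "j \<in> {..<5}"
    then show "cmod (a j x) \<le> M" using order_trans[OF wiener_sup[OF a] b] by auto
    show "\<bar>k\<bar> ^ j \<le> 1" using k by (simp add: power_le_one)
  qed (use M in auto)
  finally show ?thesis by simp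
qed

lemma poly4_has_vector_derivative:
  "((\<lambda>\<tau>. poly4 a \<tau> x) has_vector_derivative (\<Sum>d<4. of_real (real (Suc d) * \<tau> ^ d) * a (Suc d) x)) (at \<tau> within S)"
proof -
  have "((\<lambda>\<tau>. \<Sum>j<5. of_real (\<tau> ^ j) * a j x) has_vector_derivative
      (\<Sum>j<5. of_real (real j * \<tau> ^ (j - 1)) * a j x)) (at \<tau> within S)"
  proof (intro has_vector_derivative_sum has_vector_derivative_mult_left has_vector_derivative_of_real)
    fix j :: nat
    show "((\<lambda>\<tau>. \<tau> ^ j) has_real_derivative real j * \<tau> ^ (j - 1)) (at \<tau> within S)"
      by (auto intro!: derivative_eq_intros)
  qed
  also have "(\<Sum>j<5. of_real (real j * \<tau> ^ (j - 1)) * a j x) = (\<Sum>d<4. of_real (real (Suc d) * \<tau> ^ d) * a (Suc d) x)"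
    using sum.lessThan_Suc_shift[of "\<lambda>j. of_real (real j * \<tau> ^ (j - 1)) * a j x" 4] by simp
  finally show ?thesis unfolding poly4_def .
qed

text \<open>Degrees 0 to 3 of the differential equation hold by the recursion. The residual has
  order \<tau>^4, which becomes k^5 when integrated over a half step.\<close>

lemma taylor_poly4_derivative:
  assumes y0: "y0 \<in> trig_space N"
  shows "((\<lambda>\<tau>. poly4 (taylor s N y0) \<tau> x) has_vector_derivative
     nls_rhs s N (poly4 (taylor s N y0) \<tau>) x - of_real (\<tau> ^ 4) * F_remainder s N (taylor s N y0) \<tau> x) (at \<tau> within S)"
proof -
  have "(\<Sum>d<4. of_real (real (Suc d) * \<tau> ^ d) * taylor s N y0 (Suc d) x) =
      (\<Sum>d<4. of_real (\<tau> ^ d) * F_coeff s N (taylor s N y0) d x)"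
    unfolding taylor_Suc by (intro sum.cong refl) (simp add: field_simps del: of_nat_Suc)
  then show ?thesis
    using poly4_has_vector_derivative[of "taylor s N y0" x \<tau> S] nls_rhs_poly4[of "taylor s N y0" N s \<tau> x]
      taylor_in_trig_space[OF y0] by simp
qed

text \<open>The factor k in the step shifts degrees by one: degrees 1 to 4 of the difference are
  matched with degrees 0 to 3 of the vector field. The rest of the latter starts at k^4, so the
  defect has order k^5. The last step of the composition uses this with negative k.\<close>

lemma midpoint_poly4:
  assumes tp: "\<And>j. j < 5 \<Longrightarrow> p j \<in> trig_space N" "\<And>j. j < 5 \<Longrightarrow> q j \<in> trig_space N"
    and 0: "\<And>x. p 0 x = q 0 x"
    and rec: "\<And>d x. d < 4 \<Longrightarrow> p (Suc d) x - q (Suc d) x = of_real b * F_coeff s N (\<lambda>j x. (p j x + q j x) / 2) d x"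
  shows "poly4 p k x = poly4 q k x + of_real (k * b) * nls_rhs s N (\<lambda>y. (poly4 p k y + poly4 q k y) / 2) x
     + of_real (- b * k ^ 5) * F_remainder s N (\<lambda>j x. (p j x + q j x) / 2) k x"
proof -
  define h where "h = (\<lambda>j x. (p j x + q j x) / 2)"
  have h: "h j \<in> trig_space N" if "j < 5" for j
    using trig_space_scale[OF trig_space_add[OF tp(1)[OF that] tp(2)[OF that]], of "1/2"] by (simp add: h_def)
  have mid: "(\<lambda>y. (poly4 p k y + poly4 q k y) / 2) = poly4 h k"
    by (auto simp: poly4_def h_def sum_divide_distrib algebra_simps sum.distrib add_divide_distrib)
  have "poly4 p k x - poly4 q k x = (\<Sum>j<5. of_real (k ^ j) * (p j x - q j x))"
    by (simp add: poly4_def algebra_simps sum_subtractf)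
  also have "\<dots> = (\<Sum>d<4. of_real (k ^ Suc d) * (p (Suc d) x - q (Suc d) x))"
    using sum.lessThan_Suc_shift[of "\<lambda>j. of_real (k ^ j) * (p j x - q j x)" 4] 0 by simp
  also have "\<dots> = of_real (k * b) * (\<Sum>d<4. of_real (k ^ d) * F_coeff s N h d x)"
    unfolding sum_distrib_left using rec by (intro sum.cong refl) (simp add: h_def)
  also have "\<dots> = of_real (k * b) * (nls_rhs s N (poly4 h k) x - of_real (k ^ 4) * F_remainder s N h k x)"
    using nls_rhs_poly4[of h N s k x, OF h] by simp
  finally have "poly4 p k x = poly4 q k x + of_real (k * b) * (nls_rhs s N (poly4 h k) x - of_real (k ^ 4) * F_remainder s N h k x)"
    by (simp add: algebra_simps)
  then show ?thesis unfolding mid by (simp add: h_def[symmetric] algebra_simps numeral_eq_Suc)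
qed

section \<open>Order conditions for the coefficients of the stages\<close>

lemma triples_low:
  "{t \<in> triples. triple_deg t = 0} = {(0, 0, 0)}"
  "{t \<in> triples. triple_deg t = 1} = {(0, 0, 1), (0, 1, 0), (1, 0, 0)}"
  "{t \<in> triples. triple_deg t = 2} = {(0, 0, 2), (0, 2, 0), (2, 0, 0), (0, 1, 1), (1, 0, 1), (1, 1, 0)}"
proof -
  have two: "i + j + l = 2 \<longleftrightarrow> i = 0 \<and> j = 0 \<and> l = 2 \<or> i = 0 \<and> j = 2 \<and> l = 0 \<or> i = 2 \<and> j = 0 \<and> l = 0 \<or>
      i = 0 \<and> j = 1 \<and> l = 1 \<or> i = 1 \<and> j = 0 \<and> l = 1 \<or> i = 1 \<and> j = 1 \<and> l = 0" for i j l :: nat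
    by (cases i; cases j; cases l; auto)
  show "{t \<in> triples. triple_deg t = 0} = {(0, 0, 0)}"
    by (rule set_eqI) (simp add: triples_def triple_deg_def split_paired_all, auto)
  show "{t \<in> triples. triple_deg t = 1} = {(0, 0, 1), (0, 1, 0), (1, 0, 0)}"
    by (rule set_eqI) (simp add: triples_def triple_deg_def split_paired_all add_is_1, auto)
  show "{t \<in> triples. triple_deg t = 2} = {(0, 0, 2), (0, 2, 0), (2, 0, 0), (0, 1, 1), (1, 0, 1), (1, 1, 0)}"
    by (rule set_eqI) (simp add: triples_def triple_deg_def split_paired_all two, auto)
qed

text \<open>The degree 2 formula keeps the part linear in \<open>a 2\<close>, from the first
  derivative of the cubic map, apart from the part quadratic in \<open>a 1\<close>, from its second
  derivative. The two scale differently along the stages.\<close>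

lemma cubic_coeff_low:
  "cubic_coeff a 0 x = a 0 x * cnj (a 0 x) * a 0 x"
  "cubic_coeff a 1 x = 2 * (a 0 x * cnj (a 0 x) * a 1 x) + a 0 x * cnj (a 1 x) * a 0 x"
  "cubic_coeff a 2 x = (2 * (a 0 x * cnj (a 0 x) * a 2 x) + a 0 x * cnj (a 2 x) * a 0 x)
     + (2 * (a 0 x * cnj (a 1 x) * a 1 x) + a 1 x * cnj (a 0 x) * a 1 x)"
    apply (unfold cubic_coeff_def triples_low)
    apply (simp add: triple_term_def)
   apply (simp add: triple_term_def)
  apply (simp add: triple_term_def)
  done

lemma cubic_coeff_odd:
  assumes "\<And>j x. odd j \<Longrightarrow> a j x = 0" "odd d"
  shows "cubic_coeff a d x = 0"
  unfolding cubic_coeff_def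
proof (intro sum.neutral ballI)
  fix t assume t: "t \<in> {t \<in> triples. triple_deg t = d}"
  obtain i j l where [simp]: "t = (i, j, l)" by (cases t)
  have "odd i \<or> odd j \<or> odd l" using t assms(2) by (auto simp: triple_deg_def)
  then show "triple_term a t x = 0" using assms(1) by (auto simp: triple_term_def)
qed

text \<open>\<open>F_coeff\<close> is not linear in the sequence, but it is linear in the entry
  \<open>h d\<close> and the cubic coefficient of degree d taken together, so a common relation for
  these passes on. With \<beta> = 0 this serves for rescaling.\<close>

lemma F_coeff_lincomb:
  assumes tp: "\<And>j. j \<le> d \<Longrightarrow> a j \<in> trig_space N" "\<And>j. j \<le> d \<Longrightarrow> b j \<in> trig_space N"
    and ad: "\<And>x. h d x = of_real \<alpha> * a d x + of_real \<beta> * b d x"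
    and cub: "\<And>x. cubic_coeff h d x = of_real \<alpha> * cubic_coeff a d x + of_real \<beta> * cubic_coeff b d x"
  shows "F_coeff s N h d x = of_real \<alpha> * F_coeff s N a d x + of_real \<beta> * F_coeff s N b d x"
proof -
  have "h d = (\<lambda>x. \<Sum>i\<in>{0,1::nat}. of_real (if i = 0 then \<alpha> else \<beta>) * (if i = 0 then a d else b d) x)"
    by (simp add: fun_eq_iff ad)
  then have "frac_lap s (h d) x = (\<Sum>i\<in>{0,1::nat}. of_real (if i = 0 then \<alpha> else \<beta>) * frac_lap s (if i = 0 then a d else b d) x)"
    by (simp only:) (rule frac_lap_sum, use tp in auto)
  moreover have "cubic_coeff h d = (\<lambda>x. \<Sum>i\<in>{0,1::nat}. of_real (if i = 0 then \<alpha> else \<beta>) * (if i = 0 then cubic_coeff a d else cubic_coeff b d) x)"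
    by (simp add: fun_eq_iff cub)
  then have "trig_proj N (cubic_coeff h d) x = (\<Sum>i\<in>{0,1::nat}. of_real (if i = 0 then \<alpha> else \<beta>) * trig_proj N (if i = 0 then cubic_coeff a d else cubic_coeff b d) x)"
    by (simp only:) (rule trig_proj_sum, use tp in \<open>auto intro!: continuous_on_cubic_coeff\<close>)
  ultimately show ?thesis unfolding F_coeff_def by (simp add: algebra_simps)
qed

lemma trig_space_midpoint: "f \<in> trig_space N \<Longrightarrow> h \<in> trig_space N \<Longrightarrow> (\<lambda>x. (f x + h x) / 2) \<in> trig_space N"
  using trig_space_scale[OF trig_space_add, of f N h "1/2"] by simp

text \<open>The second \<open>F_coeff\<close> of this sequence is \<open>F'(y\<^sub>0) y\<^sub>2\<close>, that is the Taylor coefficient without the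
  contribution of \<open>F''(y\<^sub>0)(y\<^sub>1, y\<^sub>1)\<close>.\<close>

definition truncated_taylor :: "real \<Rightarrow> nat \<Rightarrow> (real \<Rightarrow> complex) \<Rightarrow> nat \<Rightarrow> real \<Rightarrow> complex" where
  "truncated_taylor s N y0 = (\<lambda>j. if j = 0 then y0 else if j = 2 then taylor s N y0 2 else (\<lambda>x. 0))"

text \<open>Coefficients in k of Y(-k/2), the start of the step seen from its centre; evaluated at
  -k they give the end of the step.\<close>

definition start_coeff :: "real \<Rightarrow> nat \<Rightarrow> (real \<Rightarrow> complex) \<Rightarrow> nat \<Rightarrow> real \<Rightarrow> complex" where
  "start_coeff s N y0 j x = of_real ((-1/2) ^ j) * taylor s N y0 j x"

text \<open>Coefficients of \<open>G\<close>: degrees up to 2 are those of \<open>Y((b - 1/2) k)\<close>, degree 3 is forced by the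
  middle step, and degree 4, which the middle step ignores, cancels the \<open>k\<^sup>4\<close> defect of the first step.\<close>

definition stage_low :: "real \<Rightarrow> nat \<Rightarrow> real \<Rightarrow> (real \<Rightarrow> complex) \<Rightarrow> nat \<Rightarrow> real \<Rightarrow> complex" where
  "stage_low s N b y0 j x = (if j \<le> 2 then of_real ((b - 1/2) ^ j) * taylor s N y0 j x
     else of_real ((b - 1/2) ^ 3) * F_coeff s N (truncated_taylor s N y0) 2 x)"

definition stage_coeff :: "real \<Rightarrow> nat \<Rightarrow> real \<Rightarrow> (real \<Rightarrow> complex) \<Rightarrow> nat \<Rightarrow> real \<Rightarrow> complex" where
  "stage_coeff s N b y0 j x = (if j \<le> 3 then stage_low s N b y0 j x
     else start_coeff s N y0 4 x + of_real b * F_coeff s N (\<lambda>j x. (stage_low s N b y0 j x + start_coeff s N y0 j x) / 2) 3 x)"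

context
  fixes s :: real and N :: nat and y0 :: "real \<Rightarrow> complex" and b \<gamma> :: real
  assumes y0: "y0 \<in> trig_space N"
  defines "\<gamma> \<equiv> b - 1/2"
begin

private abbreviation "y \<equiv> taylor s N y0"
private abbreviation "z \<equiv> truncated_taylor s N y0"
private abbreviation "q \<equiv> start_coeff s N y0"
private abbreviation "g \<equiv> stage_coeff s N b y0"
private abbreviation "g' \<equiv> stage_low s N b y0"

lemma taylor_coeff_in_trig_space: "y j \<in> trig_space N" by (rule taylor_in_trig_space[OF y0])

lemma truncated_taylor_in_trig_space: "z j \<in> trig_space N" by (auto simp: truncated_taylor_def y0 taylor_coeff_in_trig_space trig_space_0)

lemma start_coeff_in_trig_space: "q j \<in> trig_space N"
  unfolding start_coeff_def[abs_def] by (intro trig_space_intros taylor_coeff_in_trig_space)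

lemma stage_low_in_trig_space: "g' j \<in> trig_space N"
  by (cases "j \<le> 2") (auto simp: stage_low_def[abs_def] intro!: trig_space_intros taylor_coeff_in_trig_space F_coeff_in_trig_space truncated_taylor_in_trig_space)

lemma stage_coeff_in_trig_space: "g j \<in> trig_space N"
  by (cases "j \<le> 3") (auto simp: stage_coeff_def[abs_def] intro!: trig_space_intros stage_low_in_trig_space start_coeff_in_trig_space F_coeff_in_trig_space trig_space_midpoint)

lemma F_coeff_taylor: "F_coeff s N y d x = of_nat (Suc d) * y (Suc d) x"
  by (simp add: taylor_Suc del: of_nat_Suc)

text \<open>In degrees 1 and 2 both ends lie on Y, and \<gamma> + 1/2 = b makes the relation hold
  for every b. In degree 3 the vector field splits into F'(y0) y2 and the full Taylor coefficient;
  matching these separately is what \<open>c1\<close> and \<open>c2\<close> say. Degree 4 holds by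
  construction.\<close>

lemma stage_step1:
  assumes c1: "4 * \<gamma> ^ 3 = b ^ 3" and c2: "6 * b * (b - 1)\<^sup>2 = 1" and d: "d < 4"
  shows "g (Suc d) x - q (Suc d) x = of_real b * F_coeff s N (\<lambda>j x. (g j x + q j x) / 2) d x"
proof -
  define h where "h = (\<lambda>j x. (g j x + q j x) / 2)"
  define p where "p j = (\<gamma> ^ j + (-1/2) ^ j) / 2" for j :: nat
  have h: "h j x = of_real (p j) * y j x" if "j \<le> 2" for j x
    using that by (simp add: h_def stage_coeff_def stage_low_def start_coeff_def p_def \<gamma>_def algebra_simps add_divide_distrib)
  have p0: "p 0 = 1" by (simp add: p_def)
  have h0: "h 0 x = y0 x" for x using h[of 0 x] by (simp add: p0 taylor_0)
  have h1: "h 1 x = of_real (p 1) * y 1 x" for x using h[of 1 x] by simp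
  have h2: "h 2 x = of_real (p 2) * y 2 x" for x using h[of 2 x] by simp
  consider "d = 0" | "d = 1" | "d = 2" | "d = 3" using d by linarith
  then have "g (Suc d) x - q (Suc d) x = of_real b * F_coeff s N h d x"
  proof cases
    case 1
    have "F_coeff s N h 0 x = of_real 1 * F_coeff s N y 0 x + of_real 0 * F_coeff s N y 0 x"
      by (rule F_coeff_lincomb) (simp_all add: y0 taylor_coeff_in_trig_space cubic_coeff_low[unfolded One_nat_def] h0 taylor_0)
    then show ?thesis
      using 1 by (simp add: F_coeff_taylor stage_coeff_def stage_low_def start_coeff_def algebra_simps)
  next
    case 2
    have "F_coeff s N h 1 x = of_real (p 1) * F_coeff s N y 1 x + of_real 0 * F_coeff s N y 1 x"
      by (rule F_coeff_lincomb) (simp_all add: y0 taylor_coeff_in_trig_space cubic_coeff_low[unfolded One_nat_def] h0 h1[simplified] taylor_0 algebra_simps)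
    moreover have "(b - 1/2)\<^sup>2 - (-1/2)\<^sup>2 = b * (2 * p 1)"
      by (simp add: p_def \<gamma>_def power2_eq_square field_simps)
    then have "of_real ((b - 1/2)\<^sup>2) - of_real ((-1/2)\<^sup>2) = (of_real b * (2 * of_real (p 1)) :: complex)"
      by (metis of_real_diff of_real_mult of_real_numeral)
    then have "of_real ((b - 1/2)\<^sup>2) * y 2 x - of_real ((-1/2)\<^sup>2) * y 2 x = of_real b * (2 * of_real (p 1)) * y 2 x"
      by (metis left_diff_distrib)
    ultimately show ?thesis
      using 2 F_coeff_taylor[of 1 x]
      by (simp add: stage_coeff_def stage_low_def start_coeff_def numeral_2_eq_2[symmetric])
  next
    case 3
    \<comment> \<open>The part linear in y2 has weight \<open>p 2\<close>, the part quadratic in y1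
      has weight (p 1)^2. So the full coefficient of Y is taken with weight (p 1)^2, and the excess
      p 2 - (p 1)^2 falls on the truncated sequence.\<close>
    have Fh: "F_coeff s N h 2 x = of_real (p 2 - (p 1)\<^sup>2) * F_coeff s N z 2 x + of_real ((p 1)\<^sup>2) * F_coeff s N y 2 x"
      by (rule F_coeff_lincomb)
         (simp_all add: y0 taylor_coeff_in_trig_space trig_space_0 truncated_taylor_in_trig_space cubic_coeff_low[unfolded One_nat_def] h0 h1[simplified] h2 taylor_0 truncated_taylor_def algebra_simps power2_eq_square)
    \<comment> \<open>\<open>p 1\<close> is the mean of \<gamma> and -1/2, \<open>p 2\<close> the
      mean of their squares; the difference p 2 - (p 1)^2 is their variance, ((\<gamma> + 1/2) /
      2)^2 = b^2 / 4.\<close>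
    have e1: "\<gamma> ^ 3 = b * (p 2 - (p 1)\<^sup>2)"
    proof -
      have "b * (p 2 - (p 1)\<^sup>2) = b ^ 3 / 4"
        by (simp add: p_def \<gamma>_def power2_eq_square power3_eq_cube field_simps)
      then show ?thesis using c1 by simp
    qed
    \<comment> \<open>Here p 1 = (b - 1) / 2. The 1/8 is the cube of 1/2 in Y(-k/2), the 3 is the
      factor between y3 and the degree 2 coefficient of F(Y).\<close>
    have e2: "1 / 8 = b * (3 * (p 1)\<^sup>2)"
      using c2 by (simp add: p_def \<gamma>_def power2_eq_square field_simps)
    have "of_real (\<gamma> ^ 3) * F_coeff s N z 2 x + of_real (1/8) * y 3 x =
        of_real (b * (p 2 - (p 1)\<^sup>2)) * F_coeff s N z 2 x + of_real (b * (3 * (p 1)\<^sup>2)) * y 3 x"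
      by (simp only: e1 e2)
    also have "\<dots> = of_real b * (of_real (p 2 - (p 1)\<^sup>2) * F_coeff s N z 2 x + of_real ((p 1)\<^sup>2) * (3 * y 3 x))"
      by (simp add: algebra_simps)
    also have "\<dots> = of_real b * F_coeff s N h 2 x"
      using F_coeff_taylor[of 2 x] unfolding Fh by simp
    finally have *: "of_real (\<gamma> ^ 3) * F_coeff s N z 2 x + of_real (1/8) * y 3 x = of_real b * F_coeff s N h 2 x" .
    have "(-1/2::real) ^ 3 = - (1/8)" by (simp add: power3_eq_cube)
    then have q3: "q 3 x = of_real (-(1/8)) * y 3 x" unfolding start_coeff_def by presburger
    have "g 3 x = of_real (\<gamma> ^ 3) * F_coeff s N z 2 x"
      by (simp add: stage_coeff_def stage_low_def \<gamma>_def)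
    then have "g 3 x - q 3 x = of_real b * F_coeff s N h 2 x"
      unfolding *[symmetric] q3 by simp
    then show ?thesis using 3 by (simp add: eval_nat_numeral)
  next
    case 4
    have "F_coeff s N h 3 = F_coeff s N (\<lambda>j x. (g' j x + q j x) / 2) 3"
      by (rule F_coeff_cong) (simp add: h_def stage_coeff_def)
    moreover have "g 4 x - q 4 x = of_real b * F_coeff s N (\<lambda>j x. (g' j x + q j x) / 2) 3 x"
      by (simp add: stage_coeff_def)
    ultimately show ?thesis using 4 by (simp add: eval_nat_numeral)
  qed
  then show ?thesis by (simp add: h_def)
qed

text \<open>The midpoint of G(k) and G(-k) is even in k, so its odd coefficients and those of the
  vector field on it vanish, as do the even ones of the difference. Conditions remain in degrees 1
  and 3: the first is 1 - 2b = -2 \<gamma>. Since y1 is absent from the midpoint, the second forces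
  the degree 3 coefficient of G to be \<gamma>^3 F'(y0) y2.\<close>

lemma stage_step2:
  assumes d: "d < 4"
  shows "of_real ((-1) ^ Suc d) * g (Suc d) x - g (Suc d) x =
    of_real (1 - 2 * b) * F_coeff s N (\<lambda>j x. (of_real ((-1) ^ j) * g j x + g j x) / 2) d x"
proof -
  define h where "h = (\<lambda>j x. (of_real ((-1) ^ j) * g j x + g j x) / 2)"
  have odd: "h j x = 0" if "odd j" for j x using that by (simp add: h_def)
  have h0: "h 0 x = y0 x" for x by (simp add: h_def stage_coeff_def stage_low_def taylor_0)
  have h2: "h 2 x = of_real (\<gamma>\<^sup>2) * y 2 x" for x by (simp add: h_def stage_coeff_def stage_low_def \<gamma>_def)
  have Fodd: "F_coeff s N h d x = 0" if "odd d" for d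
  proof -
    have "F_coeff s N h d x = of_real 0 * F_coeff s N y d x + of_real 0 * F_coeff s N y d x"
      using that by (intro F_coeff_lincomb) (simp_all add: y0 taylor_coeff_in_trig_space cubic_coeff_odd[OF odd] odd)
    then show ?thesis by simp
  qed
  have b: "1 - 2 * b = - 2 * \<gamma>" by (simp add: \<gamma>_def)
  have "d = 0 \<or> odd d \<or> d = 2" using d by presburger
  then consider "d = 0" | "odd d" | "d = 2" by blast
  then have "of_real ((-1) ^ Suc d) * g (Suc d) x - g (Suc d) x = of_real (1 - 2 * b) * F_coeff s N h d x"
  proof cases
    case 1
    have "F_coeff s N h 0 x = of_real 1 * F_coeff s N y 0 x + of_real 0 * F_coeff s N y 0 x"
      by (rule F_coeff_lincomb) (simp_all add: y0 taylor_coeff_in_trig_space cubic_coeff_low[unfolded One_nat_def] h0 taylor_0)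
    then have "F_coeff s N h 0 x = y 1 x" by (simp add: F_coeff_taylor)
    moreover have "g 1 x = of_real \<gamma> * y 1 x" by (simp add: stage_coeff_def stage_low_def \<gamma>_def)
    ultimately show ?thesis unfolding b using 1 by simp
  next
    case 2
    then show ?thesis by (simp add: Fodd)
  next
    case 3
    have "F_coeff s N h 2 x = of_real (\<gamma>\<^sup>2) * F_coeff s N z 2 x + of_real 0 * F_coeff s N z 2 x"
      using odd[of 1]
      by (intro F_coeff_lincomb) (simp_all add: y0 taylor_coeff_in_trig_space trig_space_0 truncated_taylor_in_trig_space cubic_coeff_low[unfolded One_nat_def] h0 h2 truncated_taylor_def algebra_simps)
    moreover have "g 3 x = of_real (\<gamma> ^ 3) * F_coeff s N z 2 x"
      by (simp add: stage_coeff_def stage_low_def \<gamma>_def)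
    ultimately show ?thesis unfolding b using 3 by (simp add: eval_nat_numeral)
  qed
  then show ?thesis by (simp add: h_def)
qed

text \<open>Budget of derivatives: y_j keeps 10 - 2j of the initial weight 10, so y_2 keeps 6,
  \<open>F_coeff\<close> of the truncated sequence keeps 4, and the vector field in degree 3, which
  enters the degree 4 coefficient, keeps 2. These last two are left for the remainder. The 3 covers
  the sum L + 2 growth (growth L), using b <= 2; the range of b gives |b - 1/2| <= 1, so its powers
  stay bounded.\<close>

lemma wiener_stage_coeff:
  assumes s: "0 < s" "s \<le> 1" and b: "0 \<le> b" "b \<le> 3/2" and M: "wiener N 10 y0 \<le> M" and j: "j < 5"
  defines "L \<equiv> (growth ^^ 5) M"
  shows "wiener N 2 (y j) \<le> 3 * growth (growth L)" and "wiener N 2 (q j) \<le> 3 * growth (growth L)"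
    and "wiener N 2 (g j) \<le> 3 * growth (growth L)"
proof -
  have M0: "M \<ge> 0" using M wiener_nonneg order_trans by blast
  have L0: "L \<ge> 0" unfolding L_def by (rule growth_pow_nonneg[OF M0])
  have Ls: "L \<le> growth L" "growth L \<le> growth (growth L)" "0 \<le> growth L"
    using L0 by (auto intro: growth_ge growth_nonneg)
  have yL: "wiener N r (y j) \<le> L" if "r + 2 * j \<le> 10" "j \<le> 4" for r j
  proof -
    have "wiener N r (y j) \<le> wiener N (10 - 2 * j) (y j)" by (rule wiener_mono) (use that in auto)
    also have "\<dots> \<le> (growth ^^ j) M" by (rule wiener_taylor[OF s y0 M]) (use that in auto)
    also have "\<dots> \<le> L" unfolding L_def by (rule growth_pow_mono[OF M0]) (use that in auto)
    finally show ?thesis .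
  qed
  show "wiener N 2 (y j) \<le> 3 * growth (growth L)" using yL[of 2 j] j Ls by simp
  have scale: "wiener N r (\<lambda>x. of_real c * f x) \<le> B" if "\<bar>c\<bar> \<le> 1" "wiener N r f \<le> B" for c r f B
  proof -
    have "\<bar>c\<bar> * wiener N r f \<le> 1 * B" using that by (intro mult_mono) (auto intro: order_trans[OF wiener_nonneg])
    then show ?thesis by (simp add: wiener_scale)
  qed
  have qL: "wiener N r (q j) \<le> L" if "r + 2 * j \<le> 10" "j \<le> 4" for r j
    unfolding start_coeff_def[abs_def] by (intro scale yL that) (simp add: power_abs power_le_one)
  show "wiener N 2 (q j) \<le> 3 * growth (growth L)" using qL[of 2 j] j Ls by simp
  have \<gamma>: "\<bar>(b - 1/2) ^ j\<bar> \<le> 1" for j :: nat using b by (auto simp: power_abs intro!: power_le_one)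
  have A: "wiener N 4 (F_coeff s N z 2) \<le> growth L"
  proof (rule wiener_F_coeff[OF s truncated_taylor_in_trig_space])
    fix j :: nat assume "j \<le> 2"
    then show "wiener N (4 + 2) (z j) \<le> L"
      using yL[of 6 0] yL[of 6 2] L0 by (auto simp: truncated_taylor_def wiener_0 taylor_0)
  qed
  have g': "wiener N 4 (g' j) \<le> growth L" if "j \<le> 3" for j
  proof (cases "j \<le> 2")
    case True
    then show ?thesis
      using scale[OF \<gamma>, of 4 "y j" L j] yL[of 4 j] Ls by (simp add: stage_low_def[abs_def])
  next
    case False
    then show ?thesis using scale[OF \<gamma> A, of 3] by (simp add: stage_low_def[abs_def])
  qed
  have cont: "f \<in> trig_space N \<Longrightarrow> continuous_on {-pi..pi} f" for f by (rule continuous_on_trig_space)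
  have h: "wiener N 4 (\<lambda>x. (g' j x + q j x) / 2) \<le> growth L" if "j \<le> 3" for j
  proof -
    have "(\<lambda>x. (g' j x + q j x) / 2) = (\<lambda>x. (1/2) * (g' j x + q j x))" by auto
    then have "wiener N 4 (\<lambda>x. (g' j x + q j x) / 2) = (1/2) * wiener N 4 (\<lambda>x. g' j x + q j x)"
      by (simp only: wiener_scale) simp
    also have "\<dots> \<le> (1/2) * (wiener N 4 (g' j) + wiener N 4 (q j))"
      by (intro mult_left_mono wiener_add cont stage_low_in_trig_space start_coeff_in_trig_space) simp
    also have "\<dots> \<le> (1/2) * (growth L + growth L)"
      using g'[OF that] qL[of 4 j] that Ls by simp
    finally show ?thesis by simp
  qed
  have F3: "wiener N 2 (F_coeff s N (\<lambda>j x. (g' j x + q j x) / 2) 3) \<le> growth (growth L)"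
    by (rule wiener_F_coeff[OF s]) (use h in \<open>auto intro!: trig_space_midpoint stage_low_in_trig_space start_coeff_in_trig_space\<close>)
  show "wiener N 2 (g j) \<le> 3 * growth (growth L)"
  proof (cases "j \<le> 3")
    case True
    then have "wiener N 2 (g j) \<le> wiener N 4 (g' j)" by (simp add: stage_coeff_def[abs_def] wiener_mono)
    then show ?thesis using g'[OF True] Ls by linarith
  next
    case False
    then have "j = 4" using j by simp
    then have "wiener N 2 (g j) \<le> wiener N 2 (q 4) + b * wiener N 2 (F_coeff s N (\<lambda>j x. (g' j x + q j x) / 2) 3)"
      using wiener_add[of "q 4" "\<lambda>x. of_real b * F_coeff s N (\<lambda>j x. (g' j x + q j x) / 2) 3 x" N 2] b
      by (simp add: stage_coeff_def[abs_def] wiener_scale cont start_coeff_in_trig_space trig_space_scale F_coeff_in_trig_space trig_space_midpoint stage_low_in_trig_space)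
    also have "\<dots> \<le> L + 2 * growth (growth L)"
      by (intro add_mono mult_mono F3 qL) (use b in auto)
    finally show ?thesis using Ls by linarith
  qed
qed

end

section \<open>The stages as polynomials in k and their defects\<close>

lemma poly4_flip: "poly4 (\<lambda>j x. of_real ((-1) ^ j) * a j x) k x = poly4 a (- k) x"
proof -
  have "(- k) ^ j = (-1) ^ j * k ^ j" for j by (metis power_mult_distrib mult_minus1)
  then show ?thesis by (simp add: poly4_def mult_ac)
qed

lemma poly4_start: "poly4 (start_coeff s N y0) k x = poly4 (taylor s N y0) (- k / 2) x"
proof -
  have "(- k / 2) ^ j = (-1/2) ^ j * k ^ j" for j
    by (metis power_mult_distrib mult_minus1 times_divide_eq_left mult.commute)
  then show ?thesis
    unfolding poly4_def start_coeff_def by (intro sum.cong refl) (simp add: mult_ac del: of_real_power)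
qed

text \<open>The third step is the first one at -k read backwards: the midpoint is symmetric in its
  ends, so a step of length -kb from Y(k/2) to G(-k) is also a step of length kb from G(-k) to
  Y(k/2). Five coefficients bounded by K give 5 K. In the defect, 6 = 2 * 3: both b and |1 - 2b| are
  at most 2, and the L2 norm is at most 3 times the Wiener norm.\<close>

lemma approximate_stages:
  assumes s: "0 < s" "s \<le> 1" and b: "0 \<le> b" "b \<le> 3/2"
    and c1: "4 * (b - 1/2) ^ 3 = b ^ 3" and c2: "6 * b * (b - 1)\<^sup>2 = 1"
    and y0: "y0 \<in> trig_space N" and M: "wiener N 10 y0 \<le> M" and k: "0 \<le> k" "k \<le> 1"
  defines "K \<equiv> 3 * growth (growth ((growth ^^ 5) M))"
  obtains W R where
    "W 0 = poly4 (taylor s N y0) (- k / 2)" "W 3 = poly4 (taylor s N y0) (k / 2)"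
    "\<And>j. j \<le> 3 \<Longrightarrow> W j \<in> trig_space N" "\<And>j x. j \<le> 3 \<Longrightarrow> cmod (W j x) \<le> 5 * K"
    "\<And>j. j < 3 \<Longrightarrow> R j \<in> trig_space N" "\<And>j. j < 3 \<Longrightarrow> L2_norm (R j) \<le> 6 * growth K * k ^ 5"
    "\<And>j x. j < 3 \<Longrightarrow> W (Suc j) x = W j x +
       of_real (k * (if j = 1 then 1 - 2 * b else b)) * nls_rhs s N (\<lambda>y. (W (Suc j) y + W j y) / 2) x + R j x"
proof -
  let ?y = "taylor s N y0" and ?q = "start_coeff s N y0" and ?g = "stage_coeff s N b y0"
  define f where "f = (\<lambda>j x. of_real ((-1) ^ j) * ?g j x)"
  have tp: "?y j \<in> trig_space N" "?q j \<in> trig_space N" "?g j \<in> trig_space N" "f j \<in> trig_space N" for j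
    unfolding f_def by (intro taylor_coeff_in_trig_space start_coeff_in_trig_space stage_coeff_in_trig_space trig_space_scale y0)+
  have bd: "wiener N 2 (?y j) \<le> K" "wiener N 2 (?q j) \<le> K" "wiener N 2 (?g j) \<le> K" "wiener N 2 (f j) \<le> K"
    if "j < 5" for j
  proof -
    show "wiener N 2 (?y j) \<le> K" "wiener N 2 (?q j) \<le> K" "wiener N 2 (?g j) \<le> K"
      unfolding K_def by (rule wiener_stage_coeff[OF y0 s b M that])+
    then show "wiener N 2 (f j) \<le> K"
      by (simp add: f_def wiener_scale norm_power del: of_real_power)
  qed
  have K0: "K \<ge> 0" using bd(1)[of 0] wiener_nonneg[of N 2 "?y 0"] by linarith
  have mid: "(\<lambda>x. (a j x + c j x) / 2) \<in> trig_space N" "wiener N 2 (\<lambda>x. (a j x + c j x) / 2) \<le> K"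
    if "a j \<in> trig_space N" "c j \<in> trig_space N" "wiener N 2 (a j) \<le> K" "wiener N 2 (c j) \<le> K"
    for a c :: "nat \<Rightarrow> real \<Rightarrow> complex" and j
  proof -
    show "(\<lambda>x. (a j x + c j x) / 2) \<in> trig_space N" using that by (intro trig_space_midpoint)
    have eq: "(\<lambda>x. (a j x + c j x) / 2) = (\<lambda>x. (1/2) * (a j x + c j x))" by auto
    have "wiener N 2 (\<lambda>x. (a j x + c j x) / 2) = (1/2) * wiener N 2 (\<lambda>x. a j x + c j x)"
      unfolding eq wiener_scale by simp
    also have "\<dots> \<le> (1/2) * (wiener N 2 (a j) + wiener N 2 (c j))"
      by (intro mult_left_mono wiener_add continuous_on_trig_space[of _ N] that) simp
    also have "\<dots> \<le> (1/2) * (K + K)"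
      by (intro mult_left_mono add_mono that) simp
    finally show "wiener N 2 (\<lambda>x. (a j x + c j x) / 2) \<le> K" by simp
  qed
  define h1 where "h1 = (\<lambda>j x. (?g j x + ?q j x) / 2)"
  define h2 where "h2 = (\<lambda>j x. (f j x + ?g j x) / 2)"
  have Rem: "F_remainder s N h \<kappa> \<in> trig_space N" "L2_norm (\<lambda>x. of_real c * F_remainder s N h \<kappa> x) \<le> 6 * growth K * k ^ 5"
    if "h = h1 \<or> h = h2" "\<bar>\<kappa>\<bar> \<le> 1" "\<bar>c\<bar> \<le> 2 * k ^ 5" for h \<kappa> c
  proof -
    have h: "h j \<in> trig_space N" "j < 5 \<Longrightarrow> wiener N 2 (h j) \<le> K" for j
      using that(1) mid(2)[of ?g j ?q] mid(2)[of f j ?g] trig_space_midpoint[OF tp(3)[of j] tp(2)[of j]] trig_space_midpoint[OF tp(4)[of j] tp(3)[of j]] bd[of j] tp[of j]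
      by (auto simp: h1_def h2_def)
    show R: "F_remainder s N h \<kappa> \<in> trig_space N" by (rule F_remainder_in_trig_space[OF h(1)])
    have "L2_norm (\<lambda>x. of_real c * F_remainder s N h \<kappa> x) = \<bar>c\<bar> * L2_norm (F_remainder s N h \<kappa>)"
      by (simp add: L2_norm_scale)
    also have "\<dots> \<le> (2 * k ^ 5) * (3 * growth K)"
    proof (intro mult_mono that)
      have "wiener N 0 (F_remainder s N h \<kappa>) \<le> growth K" by (rule wiener_F_remainder[OF s that(2) h])
      then show "L2_norm (F_remainder s N h \<kappa>) \<le> 3 * growth K" using L2_norm_le_wiener[OF R, of 0] by simp
    qed (use k in auto)
    finally show "L2_norm (\<lambda>x. of_real c * F_remainder s N h \<kappa> x) \<le> 6 * growth K * k ^ 5" by (simp add: mult_ac)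
  qed
  have "g0": "?g 0 x = y0 x" "?q 0 x = y0 x" for x
    by (simp_all add: stage_coeff_def stage_low_def start_coeff_def taylor_0)
  have step1: "poly4 ?g \<kappa> x = poly4 ?q \<kappa> x + of_real (\<kappa> * b) * nls_rhs s N (\<lambda>y. (poly4 ?g \<kappa> y + poly4 ?q \<kappa> y) / 2) x
      + of_real (- b * \<kappa> ^ 5) * F_remainder s N h1 \<kappa> x" for \<kappa> x
    unfolding h1_def
    by (rule midpoint_poly4[OF tp(3) tp(2)]) (use stage_step1[OF y0 c1 c2] in \<open>simp_all add: g0\<close>)
  have step2: "poly4 f k x = poly4 ?g k x + of_real (k * (1 - 2 * b)) * nls_rhs s N (\<lambda>y. (poly4 f k y + poly4 ?g k y) / 2) x
      + of_real (- (1 - 2 * b) * k ^ 5) * F_remainder s N h2 k x" for x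
    unfolding h2_def
    by (rule midpoint_poly4[OF tp(4) tp(3)]) (use stage_step2[OF y0] in \<open>simp_all add: g0 f_def\<close>)
  define W where "W j = (if j = 0 then poly4 ?q k else if j = 1 then poly4 ?g k else if j = 2 then poly4 ?g (-k) else poly4 ?q (-k))" for j :: nat
  define R where "R j = (if j = 0 then (\<lambda>x. of_real (- b * k ^ 5) * F_remainder s N h1 k x)
     else if j = 1 then (\<lambda>x. of_real (- (1 - 2 * b) * k ^ 5) * F_remainder s N h2 k x)
     else (\<lambda>x. of_real (b * (- k) ^ 5) * F_remainder s N h1 (- k) x))" for j :: nat
  have fW: "poly4 f k = W 2" by (simp add: fun_eq_iff f_def W_def poly4_flip del: of_real_power)
  have k5: "0 \<le> k ^ 5" using k by simp
  show ?thesis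
  proof
    show "W 0 = poly4 ?y (- k / 2)" "W 3 = poly4 ?y (k / 2)"
      by (simp_all add: W_def fun_eq_iff poly4_start)
    show "W j \<in> trig_space N" for j unfolding W_def using tp by (simp add: poly4_in_trig_space)
    have "cmod (poly4 ?g \<kappa> x) \<le> 5 * K" "cmod (poly4 ?q \<kappa> x) \<le> 5 * K" if "\<bar>\<kappa>\<bar> \<le> 1" for \<kappa> x
      by (rule poly4_bound[of ?g N \<kappa> 2 K x, OF tp(3) that bd(3)] poly4_bound[of ?q N \<kappa> 2 K x, OF tp(2) that bd(2)], assumption)+
    then show "cmod (W j x) \<le> 5 * K" for j x
      using k unfolding W_def by simp
    have k1: "\<bar>k\<bar> \<le> 1" "\<bar>- k\<bar> \<le> 1" using k by auto
    have c: "\<bar>- b * k ^ 5\<bar> \<le> 2 * k ^ 5" "\<bar>- (1 - 2 * b) * k ^ 5\<bar> \<le> 2 * k ^ 5" "\<bar>b * (- k) ^ 5\<bar> \<le> 2 * k ^ 5"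
      unfolding abs_mult power_abs abs_minus_cancel using k b by (auto intro!: mult_right_mono)
    note R1 = Rem[of h1 k, OF disjI1[OF refl] k1(1) c(1)] and R2 = Rem[of h2 k, OF disjI2[OF refl] k1(1) c(2)]
      and R3 = Rem[of h1 "- k", OF disjI1[OF refl] k1(2) c(3)]
    show "R j \<in> trig_space N" for j
      unfolding R_def using trig_space_scale[OF R1(1)] trig_space_scale[OF R2(1)] trig_space_scale[OF R3(1)]
      by presburger
    show "L2_norm (R j) \<le> 6 * growth K * k ^ 5" for j
      unfolding R_def using R1(2) R2(2) R3(2) by presburger
    fix j :: nat and x assume "j < 3"
    then consider "j = 0" | "j = 1" | "j = 2" by linarith
    then show "W (Suc j) x = W j x +
       of_real (k * (if j = 1 then 1 - 2 * b else b)) * nls_rhs s N (\<lambda>y. (W (Suc j) y + W j y) / 2) x + R j x"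
    proof cases
      case 1
      have "W (Suc j) = poly4 ?g k" "W j = poly4 ?q k" "R j = (\<lambda>x. of_real (- b * k ^ 5) * F_remainder s N h1 k x)"
          "(if j = 1 then 1 - 2 * b else b) = b"
        using 1 by (simp_all add: W_def R_def)
      then show ?thesis using step1[of k x] by (simp only:)
    next
      case 2
      have "W (Suc j) = poly4 f k" "W j = poly4 ?g k" "R j = (\<lambda>x. of_real (- (1 - 2 * b) * k ^ 5) * F_remainder s N h2 k x)"
          "(if j = 1 then 1 - 2 * b else b) = 1 - 2 * b"
        using 2 by (simp_all add: fW W_def R_def)
      then show ?thesis using step2[of x] by (simp only:)
    next
      case 3
      have eqs: "W (Suc j) = poly4 ?q (- k)" "W j = poly4 ?g (- k)"
          "R j = (\<lambda>x. of_real (b * (- k) ^ 5) * F_remainder s N h1 (- k) x)"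
          "(if j = 1 then 1 - 2 * b else b) = b"
        using 3 by (simp_all add: W_def R_def)
      have swap: "(\<lambda>y. (poly4 ?g (- k) y + poly4 ?q (- k) y) / 2) = (\<lambda>y. (poly4 ?q (- k) y + poly4 ?g (- k) y) / 2)"
        by (simp only: add.commute)
      have alg: "Q = G + of_real (k * b) * F + of_real (b * (- k) ^ 5) * E"
        if "G = Q + of_real (- k * b) * F + of_real (- b * (- k) ^ 5) * E" for Q G F E :: complex
        unfolding that by (simp add: algebra_simps)
      show ?thesis unfolding eqs by (rule alg) (rule step1[of "- k" x, unfolded swap])
    qed
  qed
qed

section \<open>Local error\<close>

text \<open>The integrating factor exp (-a t) removes the linear term and, being at most 1, lets c t
  dominate the source; the resulting function \<phi> is nonincreasing.\<close>

lemma gronwall: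
  fixes f :: "real \<Rightarrow> real"
  assumes h: "0 \<le> h" and d: "\<And>t. t \<in> {0..h} \<Longrightarrow> (f has_real_derivative f' t) (at t within {0..h})"
    and le: "\<And>t. t \<in> {0..h} \<Longrightarrow> f' t \<le> a * f t + c" and a: "a \<ge> 0" and c: "c \<ge> 0" and f0: "f 0 = 0"
  shows "f h \<le> c * h * exp (a * h)"
proof -
  define \<phi> where "\<phi> t = f t * exp (- a * t) - c * t" for t
  have D: "(\<phi> has_real_derivative (f' t - a * f t) * exp (- a * t) - c) (at t within {0..h})" if "t \<in> {0..h}" for t
    unfolding \<phi>_def by (auto intro!: derivative_eq_intros d[OF that] simp: algebra_simps)
  have "\<phi> h \<le> \<phi> 0"
  proof (rule DERIV_nonpos_imp_decreasing_open[OF h])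
    fix t assume t: "0 < t" "t < h"
    have "(f' t - a * f t) * exp (- a * t) \<le> c * 1"
      using le[of t] t a c by (intro mult_mono) auto
    moreover have "(\<phi> has_real_derivative (f' t - a * f t) * exp (- a * t) - c) (at t)"
      using D[of t] t by (simp add: at_within_Icc_at)
    ultimately show "\<exists>y. (\<phi> has_real_derivative y) (at t) \<and> y \<le> 0"
      by (intro exI[of _ "(f' t - a * f t) * exp (- a * t) - c"]) auto
  next
    show "continuous_on {0..h} \<phi>"
      using D has_field_derivative_imp_has_derivative has_derivative_continuous
      by (metis DERIV_continuous continuous_on_eq_continuous_within)
  qed
  then have "f h * exp (- a * h) \<le> c * h" by (simp add: \<phi>_def f0)
  then show ?thesis by (simp add: exp_minus field_simps)
qed

text \<open>Energy estimate for v - p, run from the centre forwards (\<sigma> = 1) or backwards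
  (\<sigma> = -1). It is carried out for the squared norm, since the norm itself may fail to be
  differentiable at the start, where the error vanishes.\<close>

lemma taylor_error:
  assumes s: "0 < s" "s \<le> 1" and h: "0 < h" "h \<le> 1" and \<sigma>: "\<sigma> = 1 \<or> \<sigma> = (-1::real)"
    and v: "\<And>\<tau>. \<tau> \<in> {0..h} \<Longrightarrow> v \<tau> \<in> trig_space N" and vb: "\<And>\<tau> x. \<tau> \<in> {0..h} \<Longrightarrow> cmod (v \<tau> x) \<le> K"
    and d: "\<And>\<tau> x. \<tau> \<in> {0..h} \<Longrightarrow> ((\<lambda>\<tau>. v \<tau> x) has_vector_derivative of_real \<sigma> * nls_rhs s N (v \<tau>) x) (at \<tau> within {0..h})"
    and yb: "\<And>j. j < 5 \<Longrightarrow> wiener N 2 (taylor s N (v 0) j) \<le> L" and L: "5 * L \<le> K"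
  shows "L2_norm (\<lambda>x. v h x - poly4 (taylor s N (v 0)) (\<sigma> * h) x) \<le> 3 * growth L * exp (2 * K\<^sup>2 + 1) * h ^ 5"
proof -
  let ?y = "taylor s N (v 0)"
  define G where "G = 3 * growth L"
  have y: "?y j \<in> trig_space N" for j using v[of 0] h by (intro taylor_in_trig_space) auto
  have L0: "L \<ge> 0" using yb[of 0] wiener_nonneg[of N 2 "?y 0"] by linarith
  have G0: "G \<ge> 0" using L0 by (simp add: G_def growth_nonneg)
  have K0: "K \<ge> 0" using L L0 by linarith
  define p where "p \<tau> = poly4 ?y (\<sigma> * \<tau>)" for \<tau>
  define \<rho> where "\<rho> \<tau> = F_remainder s N ?y (\<sigma> * \<tau>)" for \<tau>
  have \<sigma>1: "\<bar>\<sigma>\<bar> = 1" "\<sigma> ^ 4 = 1" using \<sigma> by auto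
  have small: "\<bar>\<sigma> * \<tau>\<bar> \<le> 1" if "\<tau> \<in> {0..h}" for \<tau> using that h \<sigma>1 by (simp add: abs_mult)
  have p: "p \<tau> \<in> trig_space N" for \<tau> unfolding p_def by (intro poly4_in_trig_space y)
  have pb: "cmod (p \<tau> x) \<le> K" if "\<tau> \<in> {0..h}" for \<tau> x
    using poly4_bound[of ?y N "\<sigma> * \<tau>" 2 L x, OF y small[OF that] yb] L unfolding p_def by simp
  have \<rho>: "\<rho> \<tau> \<in> trig_space N" for \<tau> unfolding \<rho>_def by (intro F_remainder_in_trig_space y)
  have \<rho>b: "L2_norm (\<rho> \<tau>) \<le> G" if "\<tau> \<in> {0..h}" for \<tau>
  proof -
    have "wiener N 0 (\<rho> \<tau>) \<le> growth L"
      unfolding \<rho>_def by (rule wiener_F_remainder[OF s small[OF that] y yb])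
    then show ?thesis using L2_norm_le_wiener[OF \<rho>, of \<tau> 0] by (simp add: G_def)
  qed
  have pd: "((\<lambda>\<tau>. p \<tau> x) has_vector_derivative
      of_real \<sigma> * nls_rhs s N (p \<tau>) x - of_real (\<sigma> * \<tau> ^ 4) * \<rho> \<tau> x) (at \<tau> within {0..h})" for \<tau> x
  proof -
    have "(((\<lambda>\<tau>. poly4 ?y \<tau> x) \<circ> (\<lambda>\<tau>. \<sigma> * \<tau>)) has_vector_derivative
       \<sigma> *\<^sub>R (nls_rhs s N (poly4 ?y (\<sigma> * \<tau>)) x - of_real ((\<sigma> * \<tau>) ^ 4) * F_remainder s N ?y (\<sigma> * \<tau>) x)) (at \<tau> within {0..h})"
    proof (rule vector_diff_chain_within)
      show "((\<lambda>\<tau>. \<sigma> * \<tau>) has_vector_derivative \<sigma>) (at \<tau> within {0..h})"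
        by (auto intro!: derivative_eq_intros)
    qed (use y[of 0] in \<open>intro taylor_poly4_derivative, simp add: taylor_0\<close>)
    then show ?thesis
      by (simp add: o_def p_def \<rho>_def scaleR_conv_of_real algebra_simps power_mult_distrib \<sigma>1 flip: of_real_power)
  qed
  define e where "e \<tau> = (\<lambda>x. v \<tau> x - p \<tau> x)" for \<tau>
  define e' where "e' \<tau> = (\<lambda>x. of_real \<sigma> * (nls_rhs s N (v \<tau>) x - nls_rhs s N (p \<tau>) x) + of_real (\<sigma> * \<tau> ^ 4) * \<rho> \<tau> x)" for \<tau>
  have e: "e \<tau> \<in> trig_space N" "e' \<tau> \<in> trig_space N" if "\<tau> \<in> {0..h}" for \<tau>
    unfolding e_def e'_def using that by (auto intro!: trig_space_intros v p \<rho>)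
  define f where "f \<tau> = (L2_norm (e \<tau>))\<^sup>2" for \<tau>
  \<comment> \<open>The term 1/h in the rate costs only a factor e on an interval of length h, while
    the source h * G^2 * h^8 integrates to order h^10, the square of the desired order.\<close>
  have "f h \<le> (h * G\<^sup>2 * h ^ 8) * h * exp ((4 * K\<^sup>2 + 1 / h) * h)"
  proof (rule gronwall)
    show "0 \<le> h" using h by simp
    show "f 0 = 0"
      by (simp add: f_def e_def p_def poly4_def sum.lessThan_Suc_shift eval_nat_numeral taylor_0 L2_norm_def
           del: sum.lessThan_Suc)
    fix t assume t: "t \<in> {0..h}"
    show "(f has_real_derivative 2 * Re (L2_inner (e' t) (e t))) (at t within {0..h})"
      unfolding f_def
      by (rule L2_norm_sq_has_derivative[OF e])
         (use t in \<open>auto intro!: derivative_eq_intros d pd simp: e_def e'_def algebra_simps\<close>)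
    have cont: "continuous_on {-pi..pi} (e t)" "continuous_on {-pi..pi} (\<rho> t)"
       "continuous_on {-pi..pi} (\<lambda>x. nls_rhs s N (v t) x - nls_rhs s N (p t) x)"
      using t by (auto intro!: continuous_on_trig_space[of _ N] e \<rho> trig_space_diff nls_rhs_in_trig_space v p)
    have "\<bar>Re (L2_inner (\<lambda>x. nls_rhs s N (v t) x - nls_rhs s N (p t) x) (e t))\<bar> \<le> K * (K + K) * f t"
      unfolding f_def e_def by (rule nls_rhs_monotone[OF v p vb pb]) (use t in auto)
    then have 1: "\<sigma> * Re (L2_inner (\<lambda>x. nls_rhs s N (v t) x - nls_rhs s N (p t) x) (e t)) \<le> 2 * K\<^sup>2 * f t"
      using \<sigma> by (auto simp: power2_eq_square)
    have "t ^ 4 * L2_norm (\<rho> t) \<le> h ^ 4 * G"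
      using t \<rho>b[OF t] by (intro mult_mono power_mono) auto
    have "\<bar>Re (L2_inner (\<rho> t) (e t))\<bar> \<le> L2_norm (\<rho> t) * L2_norm (e t)"
      using order_trans[OF abs_Re_le_cmod cauchy_schwarz_L2_inner[OF cont(2,1)]] .
    then have "t ^ 4 * \<bar>Re (L2_inner (\<rho> t) (e t))\<bar> \<le> t ^ 4 * (L2_norm (\<rho> t) * L2_norm (e t))"
      by (intro mult_left_mono) auto
    also have "\<dots> \<le> (h ^ 4 * G) * L2_norm (e t)"
      using \<open>t ^ 4 * L2_norm (\<rho> t) \<le> h ^ 4 * G\<close> by (metis L2_norm_nonneg mult.assoc mult_right_mono)
    \<comment> \<open>Young's inequality with weights h and 1/h, from the nonnegative square below;
      it replaces the factor |e| by |e|^2.\<close>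
    also have "2 * \<dots> \<le> h * (h ^ 4 * G)\<^sup>2 + (L2_norm (e t))\<^sup>2 / h"
    proof -
      have "0 \<le> h * (h ^ 4 * G - L2_norm (e t) / h)\<^sup>2" using h by simp
      also have "\<dots> = h * (h ^ 4 * G)\<^sup>2 + (L2_norm (e t))\<^sup>2 / h - 2 * ((h ^ 4 * G) * L2_norm (e t))"
        using h by (simp add: power2_diff right_diff_distrib distrib_left power_divide) (simp add: power2_eq_square)
      finally show ?thesis by linarith
    qed
    finally have "2 * (t ^ 4 * \<bar>Re (L2_inner (\<rho> t) (e t))\<bar>) \<le> h * (h ^ 4 * G)\<^sup>2 + f t / h"
      by (simp add: f_def)
    moreover have "\<sigma> * t ^ 4 * Re (L2_inner (\<rho> t) (e t)) \<le> t ^ 4 * \<bar>Re (L2_inner (\<rho> t) (e t))\<bar>"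
    proof -
      have "\<sigma> * t ^ 4 * Re (L2_inner (\<rho> t) (e t)) \<le> \<bar>\<sigma> * t ^ 4 * Re (L2_inner (\<rho> t) (e t))\<bar>" by simp
      also have "\<dots> = t ^ 4 * \<bar>Re (L2_inner (\<rho> t) (e t))\<bar>" using \<sigma>1 by (simp add: abs_mult)
      finally show ?thesis .
    qed
    ultimately have 2: "2 * (\<sigma> * t ^ 4 * Re (L2_inner (\<rho> t) (e t))) \<le> h * (h ^ 4 * G)\<^sup>2 + f t / h" by linarith
    have "L2_inner (e' t) (e t) = of_real \<sigma> * L2_inner (\<lambda>x. nls_rhs s N (v t) x - nls_rhs s N (p t) x) (e t) + of_real (\<sigma> * t ^ 4) * L2_inner (\<rho> t) (e t)"
      unfolding e'_def by (rule L2_inner_lincomb_left[OF cont(3,2,1)])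
    then have "2 * Re (L2_inner (e' t) (e t)) = 2 * (\<sigma> * Re (L2_inner (\<lambda>x. nls_rhs s N (v t) x - nls_rhs s N (p t) x) (e t)))
        + 2 * (\<sigma> * t ^ 4 * Re (L2_inner (\<rho> t) (e t)))"
      by (simp del: of_real_mult of_real_power)
    also have "\<dots> \<le> 2 * (2 * K\<^sup>2 * f t) + (h * (h ^ 4 * G)\<^sup>2 + f t / h)"
      using 1 2 by linarith
    also have "\<dots> = (4 * K\<^sup>2 + 1 / h) * f t + h * G\<^sup>2 * h ^ 8"
      by (simp add: power_mult_distrib algebra_simps flip: power_mult)
    finally show "2 * Re (L2_inner (e' t) (e t)) \<le> (4 * K\<^sup>2 + 1 / h) * f t + h * G\<^sup>2 * h ^ 8" .
  qed (use h G0 in auto)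
  also have "\<dots> = G\<^sup>2 * h ^ 10 * exp (4 * K\<^sup>2 * h + 1)"
    using h by (simp add: distrib_right eval_nat_numeral)
  also have "\<dots> \<le> G\<^sup>2 * h ^ 10 * exp (2 * (2 * K\<^sup>2 + 1))"
  proof (intro mult_left_mono)
    have "4 * K\<^sup>2 * h \<le> 4 * K\<^sup>2 * 1" using h by (intro mult_left_mono) auto
    then show "exp (4 * K\<^sup>2 * h + 1) \<le> exp (2 * (2 * K\<^sup>2 + 1))" by simp
  qed (use h in auto)
  also have "\<dots> = (G * exp (2 * K\<^sup>2 + 1) * h ^ 5)\<^sup>2"
  proof -
    have "h ^ 10 = (h ^ 5)\<^sup>2" by (simp flip: power_mult)
    then show ?thesis unfolding exp_double power_mult_distrib by (simp only: mult_ac)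
  qed
  finally have "L2_norm (e h) \<le> G * exp (2 * K\<^sup>2 + 1) * h ^ 5"
    unfolding f_def by (rule power2_le_imp_le) (use h G0 in auto)
  then show ?thesis by (simp add: e_def p_def G_def)
qed

lemma L2_norm_diff_commute: "L2_norm (\<lambda>x. f x - g x) = L2_norm (\<lambda>x. g x - f x)"
  by (simp add: L2_norm_def norm_minus_commute)

text \<open>From b (2 - \<theta>) = 1 follows b \<theta> = 2b - 1, hence (2b - 1)^3 = 2 b^3 because
  \<theta>^3 = 2. Both cubic conditions are this identity expanded. The crude bounds 1 <= \<theta>
  <= 4/3 yield the range of b.\<close>

lemma comp_coeff_conditions:
  defines "b \<equiv> comp_coeff 1"
  shows "1 \<le> b" "b \<le> 3/2" "4 * (b - 1/2) ^ 3 = b ^ 3" "6 * b * (b - 1)\<^sup>2 = 1"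
    "comp_coeff 2 = 1 - 2 * b" "comp_coeff 3 = b"
proof -
  define \<theta> :: real where "\<theta> = 2 powr (1/3)"
  have t3: "\<theta> ^ 3 = 2" by (simp add: \<theta>_def powr_powr flip: powr_realpow)
  have t0: "\<theta> > 0" by (simp add: \<theta>_def)
  have t1: "1 \<le> \<theta>"
  proof (rule ccontr)
    assume "\<not> 1 \<le> \<theta>"
    then have "\<theta> ^ 3 \<le> 1 ^ 3" using t0 by (intro power_mono) auto
    then show False using t3 by simp
  qed
  have t2: "\<theta> \<le> 4/3"
  proof (rule ccontr)
    assume "\<not> \<theta> \<le> 4/3"
    then have "(4/3) ^ 3 \<le> \<theta> ^ 3" by (intro power_mono) auto
    then show False using t3 by (simp add: power3_eq_cube)
  qed
  have b: "b = 1 / (2 - \<theta>)" by (simp add: b_def comp_coeff_def \<theta>_def)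
  show "1 \<le> b" "b \<le> 3/2" using t1 t2 unfolding b by (simp_all add: field_simps)
  have bt: "b * \<theta> = 2 * b - 1" using t2 unfolding b by (simp add: field_simps)
  have "(2 * b - 1) ^ 3 = 2 * b ^ 3" using t3 by (simp flip: bt add: power_mult_distrib)
  then show "4 * (b - 1/2) ^ 3 = b ^ 3" "6 * b * (b - 1)\<^sup>2 = 1"
    by (simp_all add: power3_eq_cube power2_eq_square algebra_simps)
  show "comp_coeff 2 = 1 - 2 * b" "comp_coeff 3 = b" by (simp_all add: b_def comp_coeff_def)
qed

section \<open>Mass bounds and the error of one composition step\<close>

lemma semidiscrete_trig_space:
  "semidiscrete_solution s T N u0 uN \<Longrightarrow> t \<in> {0..T} \<Longrightarrow> uN t \<in> trig_space N"
  by (auto simp: semidiscrete_solution_def)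

text \<open>Zero is a solution, and comparison with it in \<open>nls_rhs_monotone\<close> has
  \<open>K = 0\<close>, so the norm cannot grow. The pointwise bound on \<open>uN\<close> used for
  this may depend on N.\<close>

lemma semidiscrete_L2_norm:
  assumes N: "N \<ge> 1" and uN: "semidiscrete_solution s T N u0 uN" and t: "t \<in> {0..T}"
  shows "L2_norm (uN t) \<le> L2_norm (trig_proj N u0)"
proof -
  note tp = semidiscrete_trig_space[OF uN]
  define f where "f \<tau> = (L2_norm (uN \<tau>))\<^sup>2 - (L2_norm (uN 0))\<^sup>2" for \<tau>
  have "f t \<le> 0 * t * exp (0 * t)"
  proof (rule gronwall)
    fix \<tau> assume "\<tau> \<in> {0..t}"
    then have \<tau>: "\<tau> \<in> {0..T}" using t by auto
    have "((\<lambda>\<tau>. uN \<tau> x) has_vector_derivative nls_rhs s N (uN \<tau>) x) (at \<tau> within {0..T})" for x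
      using uN \<tau> by (auto simp: semidiscrete_solution_def)
    then have "((\<lambda>\<tau>. uN \<tau> x) has_vector_derivative nls_rhs s N (uN \<tau>) x) (at \<tau> within {0..t})" for x
      by (rule has_vector_derivative_within_subset) (use t in auto)
    then have "((\<lambda>\<tau>. (L2_norm (uN \<tau>))\<^sup>2) has_real_derivative 2 * Re (L2_inner (nls_rhs s N (uN \<tau>)) (uN \<tau>))) (at \<tau> within {0..t})"
      using tp t \<tau> \<open>\<tau> \<in> {0..t}\<close> by (intro L2_norm_sq_has_derivative[where N = N] nls_rhs_in_trig_space) auto
    then show "(f has_real_derivative 2 * Re (L2_inner (nls_rhs s N (uN \<tau>)) (uN \<tau>))) (at \<tau> within {0..t})"
      unfolding f_def using DERIV_diff[OF _ DERIV_const] by fastforce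
    have "cmod (uN \<tau> x) \<le> sqrt (real N * (L2_norm (uN \<tau>))\<^sup>2)" for x
      using trig_space_sup_le[OF N tp[OF \<tau>], of x] by (rule real_le_rsqrt)
    from nls_rhs_monotone[OF tp[OF \<tau>] trig_space_0 this, of 0]
    show "2 * Re (L2_inner (nls_rhs s N (uN \<tau>)) (uN \<tau>)) \<le> 0 * f \<tau> + 0"
      by (simp add: nls_rhs_0)
  qed (use t in \<open>auto simp: f_def\<close>)
  then have "(L2_norm (uN t))\<^sup>2 \<le> (L2_norm (uN 0))\<^sup>2" by (simp add: f_def)
  then have "L2_norm (uN t) \<le> L2_norm (uN 0)" by (rule power2_le_imp_le) simp
  then show ?thesis using uN by (simp add: semidiscrete_solution_def)
qed

text \<open>\<open>midpoint_mass\<close> has no sign condition on the step length, so the negative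
  middle step is covered.\<close>

lemma composition_mass:
  assumes N: "N \<ge> 1" and Z0: "Z0 \<in> trig_space N" and Z: "composition_stages s N k q \<beta> Z0 Z"
  shows "j \<le> q \<Longrightarrow> L2_norm (Z j) \<le> L2_norm Z0 \<and> Z j \<in> trig_space N"
proof (induction j)
  case 0
  then show ?case using Z Z0 by (simp add: composition_stages_def)
next
  case (Suc j)
  have "Suc j \<in> {1..q}" using Suc.prems by simp
  then have step: "Z (Suc j) \<in> trig_space N"
    "Z (Suc j) x = Z (Suc j - 1) x + of_real (k * \<beta> (Suc j)) * nls_rhs s N (\<lambda>y. (Z (Suc j) y + Z (Suc j - 1) y) / 2) x" for x
    using Z unfolding composition_stages_def by blast+
  have "L2_norm (Z (Suc j)) \<le> L2_norm (Z j)"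
    by (rule midpoint_mass[OF N _ step(1) step(2)[unfolded diff_Suc_1]]) (use Suc in simp)
  then show ?case using Suc step(1) by simp
qed

text \<open>The two half steps from the centre m stay inside [t, t + k]; the backward one is the
  substitution of m - \<tau> for time. The factor (1/2)^5 is given away.\<close>

lemma local_taylor_error:
  fixes b :: real
  assumes s: "0 < s" "s \<le> 1" and b: "0 \<le> b" "b \<le> 3/2" and uN: "semidiscrete_solution s T N u0 uN"
    and M: "\<And>\<tau>. \<tau> \<in> {0..T} \<Longrightarrow> wiener N 10 (uN \<tau>) \<le> M"
    and k: "0 < k" "k \<le> 1" and t: "0 \<le> t" "t + k \<le> T" and \<sigma>: "\<sigma> = 1 \<or> \<sigma> = (-1::real)"
  defines "K \<equiv> 3 * growth (growth ((growth ^^ 5) M))"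
  shows "L2_norm (\<lambda>x. uN (t + k / 2 + \<sigma> * (k / 2)) x - poly4 (taylor s N (uN (t + k / 2))) (\<sigma> * (k / 2)) x)
    \<le> 3 * growth K * exp (2 * (5 * K)\<^sup>2 + 1) * k ^ 5"
proof -
  note tp = semidiscrete_trig_space[OF uN]
  have M0: "M \<ge> 0" using M[of t] t k order_trans[OF wiener_nonneg] by fastforce
  define L where "L = (growth ^^ 5) M"
  have L0: "L \<ge> 0" unfolding L_def by (rule growth_pow_nonneg[OF M0])
  have "M \<le> L" unfolding L_def using growth_pow_mono[OF M0, of 0 5] by simp
  then have MK: "M \<le> 5 * K" and K0: "0 \<le> K"
    using growth_ge[OF L0] growth_ge[OF growth_nonneg[OF L0]] L0 growth_nonneg[OF growth_nonneg[OF L0]]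
    unfolding K_def L_def[symmetric] by linarith+
  define m where "m = t + k / 2"
  have in_T: "m + \<sigma> * \<tau> \<in> {0..T}" if "\<tau> \<in> {0..k / 2}" for \<tau>
    using that t k \<sigma> by (auto simp: m_def)
  define v where "v \<tau> = uN (m + \<sigma> * \<tau>)" for \<tau>
  have v0: "v 0 = uN m" by (simp add: v_def)
  have m_T: "m \<in> {0..T}" using in_T[of 0] k by simp
  have "L2_norm (\<lambda>x. v (k / 2) x - poly4 (taylor s N (v 0)) (\<sigma> * (k / 2)) x)
      \<le> 3 * growth K * exp (2 * (5 * K)\<^sup>2 + 1) * (k / 2) ^ 5"
  proof (rule taylor_error[OF s _ _ \<sigma>])
    fix \<tau> x assume \<tau>: "\<tau> \<in> {0..k / 2}"
    show vtp: "v \<tau> \<in> trig_space N" unfolding v_def by (rule tp[OF in_T[OF \<tau>]])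
    have "wiener N 10 (v \<tau>) \<le> M" unfolding v_def by (rule M[OF in_T[OF \<tau>]])
    then show "cmod (v \<tau> x) \<le> 5 * K"
      using wiener_sup[OF vtp, of x 10] MK by linarith
    have "((\<lambda>t. uN t x) has_vector_derivative nls_rhs s N (uN (m + \<sigma> * \<tau>)) x) (at (m + \<sigma> * \<tau>) within {0..T})"
      using uN in_T[OF \<tau>] by (auto simp: semidiscrete_solution_def)
    then have "((\<lambda>t. uN t x) has_vector_derivative nls_rhs s N (uN (m + \<sigma> * \<tau>)) x)
        (at (m + \<sigma> * \<tau>) within (\<lambda>\<tau>. m + \<sigma> * \<tau>) ` {0..k / 2})"
      by (rule has_vector_derivative_within_subset) (use in_T in blast)
    moreover have "((\<lambda>\<tau>. m + \<sigma> * \<tau>) has_vector_derivative \<sigma>) (at \<tau> within {0..k / 2})"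
      by (auto intro!: derivative_eq_intros)
    ultimately have "(((\<lambda>t. uN t x) \<circ> (\<lambda>\<tau>. m + \<sigma> * \<tau>)) has_vector_derivative \<sigma> *\<^sub>R nls_rhs s N (uN (m + \<sigma> * \<tau>)) x)
        (at \<tau> within {0..k / 2})"
      by (intro vector_diff_chain_within)
    then show "((\<lambda>\<tau>. v \<tau> x) has_vector_derivative of_real \<sigma> * nls_rhs s N (v \<tau>) x) (at \<tau> within {0..k / 2})"
      by (simp add: o_def v_def scaleR_conv_of_real)
  next
    fix j :: nat assume "j < 5"
    then show "wiener N 2 (taylor s N (v 0) j) \<le> K"
      unfolding K_def v0 by (intro wiener_stage_coeff(1)[OF tp[OF m_T] s b M[OF m_T]])
  qed (use k in auto)
  also have "\<dots> \<le> 3 * growth K * exp (2 * (5 * K)\<^sup>2 + 1) * k ^ 5"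
    using k K0 by (intro mult_left_mono power_mono) (auto intro!: mult_nonneg_nonneg growth_nonneg)
  finally show ?thesis unfolding v0 unfolding v_def m_def .
qed

text \<open>\<open>k0\<close> and \<open>C\<close> are chosen before N, k, t and the solution, which
  enters only through the bound M. The computed stages are compared with the polynomial ones step by
  step, and the flow with the latter at both ends of the step.\<close>

lemma local_error:
  assumes s: "0 < s" "s \<le> 1"
  shows "\<exists>k0>0. \<exists>C. \<forall>N k t T u0 uN Z. N \<ge> 1 \<longrightarrow> 0 < k \<longrightarrow> k \<le> k0 \<longrightarrow> 0 \<le> t \<longrightarrow> t + k \<le> T \<longrightarrow>
    semidiscrete_solution s T N u0 uN \<longrightarrow> (\<forall>\<tau>\<in>{0..T}. wiener N 10 (uN \<tau>) \<le> M) \<longrightarrow>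
    k * real N * (L2_norm (uN t))\<^sup>2 \<le> 1 \<longrightarrow> composition_stages s N k 3 comp_coeff (uN t) Z \<longrightarrow>
    L2_norm (\<lambda>x. uN (t + k) x - Z 3 x) \<le> C * k ^ 5"
proof -
  define b where "b = comp_coeff 1"
  note cc = comp_coeff_conditions[folded b_def]
  have b: "0 \<le> b" "b \<le> 3/2" using cc by auto
  define K0 where "K0 = 3 * growth (growth ((growth ^^ 5) M))"
  define K where "K = 5 * K0"
  define C1 where "C1 = 3 * growth K0 * exp (2 * (5 * K0)\<^sup>2 + 1)"
  \<comment> \<open>Chosen so that sqrt k * K <= 1/4 for k <= k0, which brings the stability factor
    below 1; it also makes k0 <= 1.\<close>
  define k0 where "k0 = 1 / (4 * (\<bar>K\<bar> + 1))\<^sup>2"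
  have k0: "k0 > 0" unfolding k0_def by (auto intro!: divide_pos_pos zero_less_power)
  show ?thesis
  \<comment> \<open>28 = 27 + 1: the initial error C1 is tripled by each of three steps, and the
    final comparison adds C1 once more. 156 = 12 (1 + 3 + 9) sums the propagated defects.\<close>
  proof (rule exI[of _ k0], rule conjI[OF k0], rule exI[of _ "28 * C1 + 156 * growth K0"], intro allI impI)
    fix N :: nat and k t T :: real and u0 :: "real \<Rightarrow> complex" and uN and Z :: "nat \<Rightarrow> real \<Rightarrow> complex"
    assume N: "N \<ge> 1" and k: "0 < k" "k \<le> k0" and t: "0 \<le> t" "t + k \<le> T"
      and uN: "semidiscrete_solution s T N u0 uN" and "\<forall>\<tau>\<in>{0..T}. wiener N 10 (uN \<tau>) \<le> M"
      and cfl: "k * real N * (L2_norm (uN t))\<^sup>2 \<le> 1" and Z: "composition_stages s N k 3 comp_coeff (uN t) Z"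
    then have M: "\<And>\<tau>. \<tau> \<in> {0..T} \<Longrightarrow> wiener N 10 (uN \<tau>) \<le> M" by blast
    have "k0 \<le> 1" unfolding k0_def by (simp add: divide_le_eq one_le_power)
    then have k1: "k \<le> 1" using k by simp
    note tp = semidiscrete_trig_space[OF uN]
    note cont = continuous_on_trig_space[of _ N "{-pi..pi}"]
    have T: "t \<in> {0..T}" "t + k / 2 \<in> {0..T}" "t + k \<in> {0..T}" using t k by auto
    note taylor_err = local_taylor_error[OF s b uN M k(1) k1 t, folded K0_def C1_def]
    obtain W R where W: "W 0 = poly4 (taylor s N (uN (t + k/2))) (- k / 2)" "W 3 = poly4 (taylor s N (uN (t + k/2))) (k / 2)"
      and Wtp: "\<And>j. j \<le> 3 \<Longrightarrow> W j \<in> trig_space N" and Wb: "\<And>j x. j \<le> 3 \<Longrightarrow> cmod (W j x) \<le> K"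
      and Rtp: "\<And>j. j < 3 \<Longrightarrow> R j \<in> trig_space N" and Rb: "\<And>j. j < 3 \<Longrightarrow> L2_norm (R j) \<le> 6 * growth K0 * k ^ 5"
      and step: "\<And>j x. j < 3 \<Longrightarrow> W (Suc j) x = W j x +
       of_real (k * (if j = 1 then 1 - 2 * b else b)) * nls_rhs s N (\<lambda>y. (W (Suc j) y + W j y) / 2) x + R j x"
      by (rule approximate_stages[OF s b cc(3,4) tp[OF T(2)] M[OF T(2)] less_imp_le[OF k(1)] k1, folded K0_def K_def])
         (rule that; assumption)
    have K: "K \<ge> 0" using order_trans[OF norm_ge_zero Wb[of 0 0]] by simp
    have Z0: "Z 0 = uN t" using Z by (simp add: composition_stages_def)
    have Ztp: "Z j \<in> trig_space N" and mass: "L2_norm (Z j) \<le> L2_norm (uN t)" if "j \<le> 3" for j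
      using composition_mass[OF N tp[OF T(1)] Z that] by auto
    define \<beta> where "\<beta> j = k * (if j = 1 then 1 - 2 * b else b)" for j :: nat
    have Zstep: "Z (Suc j) x = Z j x + of_real (\<beta> j) * nls_rhs s N (\<lambda>y. (Z (Suc j) y + Z j y) / 2) x" if "j < 3" for j x
    proof -
      have "comp_coeff (Suc j) = (if j = 1 then 1 - 2 * b else b)"
        using that cc(5,6) b_def by (auto simp: less_Suc_eq eval_nat_numeral)
      moreover have "Suc j \<in> {1..3}" using that by simp
      moreover have "\<forall>j\<in>{1..3}. \<forall>x. Z j x = Z (j - 1) x
           + of_real (k * comp_coeff j) * nls_rhs s N (\<lambda>y. (Z j y + Z (j - 1) y) / 2) x"
        using Z unfolding composition_stages_def by blast
      then have "Z (Suc j) x = Z (Suc j - 1) x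
           + of_real (k * comp_coeff (Suc j)) * nls_rhs s N (\<lambda>y. (Z (Suc j) y + Z (Suc j - 1) y) / 2) x"
        using \<open>Suc j \<in> {1..3}\<close> by blast
      ultimately show ?thesis by (simp only: \<beta>_def diff_Suc_1)
    qed
    have sk: "sqrt k > 0" using k by simp
    \<comment> \<open>Inverse inequality plus mass: |z|^2 <= N |uN t|^2 <= 1/k for every midpoint
      z.\<close>
    have zb: "cmod ((Z (Suc j) x + Z j x) / 2) \<le> 1 / sqrt k" if "j < 3" for j x
    proof -
      have m: "(\<lambda>x. (Z (Suc j) x + Z j x) / 2) \<in> trig_space N" using that by (intro trig_space_midpoint Ztp) auto
      have "(\<lambda>x. (Z (Suc j) x + Z j x) / 2) = (\<lambda>x. (1/2) * (Z (Suc j) x + Z j x))" by auto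
      then have "L2_norm (\<lambda>x. (Z (Suc j) x + Z j x) / 2) = (1/2) * L2_norm (\<lambda>x. Z (Suc j) x + Z j x)"
        by (simp only: L2_norm_scale) simp
      also have "\<dots> \<le> (1/2) * (L2_norm (Z (Suc j)) + L2_norm (Z j))"
        using that by (intro mult_left_mono L2_norm_triangle cont Ztp) auto
      also have "\<dots> \<le> (1/2) * (L2_norm (uN t) + L2_norm (uN t))"
        using that by (intro mult_left_mono add_mono mass) auto
      finally have "L2_norm (\<lambda>x. (Z (Suc j) x + Z j x) / 2) \<le> L2_norm (uN t)" by simp
      then have "real N * (L2_norm (\<lambda>x. (Z (Suc j) x + Z j x) / 2))\<^sup>2 \<le> real N * (L2_norm (uN t))\<^sup>2"
        by (intro mult_left_mono power_mono) auto
      then have "(cmod ((Z (Suc j) x + Z j x) / 2))\<^sup>2 \<le> real N * (L2_norm (uN t))\<^sup>2"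
        using trig_space_sup_le[OF N m, of x] by linarith
      also have "\<dots> \<le> 1 / k" using cfl k by (simp add: field_simps)
      finally have "cmod ((Z (Suc j) x + Z j x) / 2) \<le> sqrt (1 / k)" by (rule real_le_rsqrt)
      then show ?thesis by (simp add: real_sqrt_divide)
    qed
    have wb: "cmod ((W (Suc j) x + W j x) / 2) \<le> K" if "j < 3" for j x
    proof -
      have "cmod (W (Suc j) x + W j x) \<le> K + K"
        using that by (intro order_trans[OF norm_triangle_ineq] add_mono Wb) auto
      then show ?thesis by (simp add: norm_divide)
    qed
    \<comment> \<open>With |\<beta> j| <= 2k this is at most 2 (sqrt k * K)^2 + 2 sqrt k * K <= 1/8
      + 1/2. The factor 1 / sqrt k is beaten because it occurs to the first power only.\<close>
    have c: "\<bar>\<beta> j\<bar> * K * (K + 1 / sqrt k) \<le> 1" if "j < 3" for j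
    proof -
      have "sqrt k \<le> sqrt k0" using k by simp
      also have "\<dots> = 1 / (4 * (K + 1))" using K by (simp add: k0_def real_sqrt_divide)
      finally have r: "sqrt k * (4 * (K + 1)) \<le> 1" using K by (simp add: field_simps)
      have rK: "sqrt k * K \<le> 1/4"
      proof -
        have "sqrt k * (4 * K) \<le> sqrt k * (4 * (K + 1))" using K sk by (intro mult_left_mono) auto
        then show ?thesis using r by simp
      qed
      have "\<bar>\<beta> j\<bar> \<le> 2 * k" using b cc(1) k by (auto simp: \<beta>_def abs_mult)
      then have "\<bar>\<beta> j\<bar> * (K * (K + 1 / sqrt k)) \<le> (2 * k) * (K * (K + 1 / sqrt k))"
        using K sk by (intro mult_right_mono) auto
      also have "\<dots> = 2 * (sqrt k * K) * (sqrt k * K) + 2 * (sqrt k * K)"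
      proof -
        have kr: "k = sqrt k * sqrt k" using k by simp
        have "2 * (r * r) * (K * (K + 1 / r)) = 2 * (r * K) * (r * K) + 2 * (r * K)" if "r > 0" for r
          using that by (simp add: field_simps)
        from this[OF sk] show ?thesis by (subst kr)
      qed
      also have "\<dots> \<le> 2 * (1/4) * (1/4) + 2 * (1/4)"
        using rK K sk by (intro add_mono mult_mono) auto
      also have "\<dots> \<le> 1" by simp
      finally show ?thesis by (simp only: mult.assoc)
    qed
    define a where "a j = L2_norm (\<lambda>x. Z j x - W j x)" for j
    \<comment> \<open>With the stability factor at most 1, A - B <= (A + B) / 2 + r, that is A <= 3
      B + 2 r.\<close>
    have rec: "a (Suc j) \<le> 3 * a j + 12 * growth K0 * k ^ 5" if j: "j < 3" for j
    proof -
      have "a (Suc j) - a j \<le> \<bar>\<beta> j\<bar> * K * (K + 1 / sqrt k) * (a (Suc j) + a j) / 2 + L2_norm (R j)"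
        unfolding a_def
        by (rule midpoint_stability[OF Ztp Ztp Wtp Wtp Rtp[OF j] Zstep[OF j] step[OF j, folded \<beta>_def] zb[OF j] wb[OF j]])
           (use j in auto)
      moreover have "\<bar>\<beta> j\<bar> * K * (K + 1 / sqrt k) * (a (Suc j) + a j) \<le> 1 * (a (Suc j) + a j)"
        by (intro mult_right_mono c[OF j]) (simp add: a_def)
      moreover have "A \<le> 3 * B + 2 * r'" if "A - B \<le> X / 2 + r" "X \<le> 1 * (A + B)" "r \<le> r'" for A B X r r' :: real
        using that by simp
      ultimately have "a (Suc j) \<le> 3 * a j + 2 * (6 * growth K0 * k ^ 5)" using Rb[OF j] by blast
      then show ?thesis by simp
    qed
    have "a 0 \<le> C1 * k ^ 5"
      using taylor_err[of "-1"] by (simp add: a_def Z0 W C1_def)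
    moreover have "a 1 \<le> 3 * a 0 + 12 * growth K0 * k ^ 5" "a 2 \<le> 3 * a 1 + 12 * growth K0 * k ^ 5" "a 3 \<le> 3 * a 2 + 12 * growth K0 * k ^ 5"
      using rec[of 0] rec[of 1] rec[of 2] by (simp_all add: eval_nat_numeral)
    ultimately have a3: "a 3 \<le> 27 * (C1 * k ^ 5) + 156 * growth K0 * k ^ 5" by linarith
    have "L2_norm (\<lambda>x. uN (t + k) x - Z 3 x) \<le> L2_norm (\<lambda>x. uN (t + k) x - W 3 x) + L2_norm (\<lambda>x. W 3 x - Z 3 x)"
    proof -
      have "continuous_on {-pi..pi} (\<lambda>x. uN (t + k) x - W 3 x)" "continuous_on {-pi..pi} (\<lambda>x. W 3 x - Z 3 x)"
        by (intro cont trig_space_diff tp[OF T(3)] Wtp Ztp; simp)+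
      from L2_norm_triangle[OF this] show ?thesis by simp
    qed
    also have "L2_norm (\<lambda>x. W 3 x - Z 3 x) = a 3" unfolding a_def by (rule L2_norm_diff_commute)
    also have "L2_norm (\<lambda>x. uN (t + k) x - W 3 x) \<le> C1 * k ^ 5"
    proof -
      have "t + k / 2 + 1 * (k / 2) = t + k" by simp
      from taylor_err[of 1, unfolded this] show ?thesis by (simp add: W C1_def)
    qed
    finally show "L2_norm (\<lambda>x. uN (t + k) x - Z 3 x) \<le> (28 * C1 + 156 * growth K0) * k ^ 5"
      using a3 by (simp add: algebra_simps)
  qed
qed

section \<open>Fourier series\<close>

text \<open>Telescoping: the two terms of modulus n + 1 add 2 / (n + 2)^2 <= 2 / (n + 1) - 2 / (n +
  2), and the single term at 0 is 1 = 3 - 2.\<close>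

lemma sum_inverse_square_int:
  fixes F :: "int set"
  assumes "finite F" shows "(\<Sum>m\<in>F. 1 / (1 + \<bar>real_of_int m\<bar>)\<^sup>2) \<le> 3"
proof -
  have modes: "(\<Sum>m\<in>modes n. 1 / (1 + \<bar>real_of_int m\<bar>)\<^sup>2) \<le> 3 - 2 / (real n + 1)" for n
  proof (induction n)
    case (Suc n)
    have "modes (Suc n) = insert (int (Suc n)) (insert (- int (Suc n)) (modes n))"
      by (auto simp: modes_def)
    then have "(\<Sum>m\<in>modes (Suc n). 1 / (1 + \<bar>real_of_int m\<bar>)\<^sup>2) = 2 / (real n + 2)\<^sup>2 + (\<Sum>m\<in>modes n. 1 / (1 + \<bar>real_of_int m\<bar>)\<^sup>2)"
      by (simp add: modes_def add.commute)
    also have "2 / (real n + 2)\<^sup>2 \<le> 2 / (real n + 1) - 2 / (real n + 2)"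
      by (simp add: divide_simps power2_eq_square)
    also have "2 / (real n + 1) - 2 / (real n + 2) + (\<Sum>m\<in>modes n. 1 / (1 + \<bar>real_of_int m\<bar>)\<^sup>2) \<le> 3 - 2 / (real n + 2)"
      using Suc.IH by linarith
    also have "\<dots> = 3 - 2 / (real (Suc n) + 1)" by (simp add: add.commute)
    finally show ?case by simp
  qed (simp add: modes_def)
  obtain n where n: "\<bar>m\<bar> \<le> int n" if "m \<in> F" for m
  proof
    fix m assume "m \<in> F"
    then have "nat \<bar>m\<bar> \<le> Max ((\<lambda>m. nat \<bar>m\<bar>) ` F)" using assms by (intro Max_ge) auto
    then show "\<bar>m\<bar> \<le> int (Max ((\<lambda>m. nat \<bar>m\<bar>) ` F))" by linarith
  qed
  have "(\<Sum>m\<in>F. 1 / (1 + \<bar>real_of_int m\<bar>)\<^sup>2) \<le> (\<Sum>m\<in>modes n. 1 / (1 + \<bar>real_of_int m\<bar>)\<^sup>2)"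
    by (intro sum_mono2) (auto simp: modes_iff n)
  also have "\<dots> \<le> 3" using modes[of n] by (rule order_trans) simp
  finally show ?thesis .
qed

lemma summable_inverse_square_int: "(\<lambda>m::int. B / (1 + \<bar>real_of_int m\<bar>)\<^sup>2) summable_on UNIV"
proof -
  have "(\<lambda>m::int. 1 / (1 + \<bar>real_of_int m\<bar>)\<^sup>2) summable_on UNIV"
    by (rule nonneg_bounded_partial_sums_imp_summable_on[of _ _ 3]) (auto intro!: eventually_finite_subsets_at_top_weakI sum_inverse_square_int)
  from summable_on_cmult_right[OF this, of B] show ?thesis by simp
qed

lemma fourier_coeff_bound:
  assumes f: "continuous_on {-pi..pi} f" and b: "\<And>x. cmod (f x) \<le> K"
  shows "cmod (fourier_coeff f m) \<le> 2 * K"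
proof -
  have K: "K \<ge> 0" using order_trans[OF norm_ge_zero b] .
  have c: "continuous_on {-pi..pi} (\<lambda>x. cis (of_int m * x))" by (intro continuous_intros)
  have "cmod (L2_inner f (\<lambda>x. cis (of_int m * x))) \<le> L2_norm f * L2_norm (\<lambda>x. cis (of_int m * x))"
    by (rule cauchy_schwarz_L2_inner[OF f c])
  also have "\<dots> \<le> (3 * K) * (3 * 1)"
    by (intro mult_mono L2_norm_le_sup f b c) (auto simp: K)
  finally have "cmod (L2_inner f (\<lambda>x. cis (of_int m * x))) / (2 * pi) \<le> (9 * K) / (2 * pi)"
    by (intro divide_right_mono) auto
  moreover have "cmod (fourier_coeff f m) = cmod (L2_inner f (\<lambda>x. cis (of_int m * x))) / (2 * pi)"
    unfolding fourier_coeff_L2_inner[OF f] norm_divide by simp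
  moreover have "(9 * K) / (2 * pi) \<le> 2 * K"
  proof -
    have "9 * K \<le> (4 * pi) * K" using K pi_gt3 by (intro mult_right_mono) auto
    then show ?thesis by (simp add: divide_le_eq mult_ac)
  qed
  ultimately show ?thesis by linarith
qed

lemma uniform_limit_fourier_series:
  assumes b: "\<And>m. cmod (c m) \<le> B / (1 + \<bar>of_int m\<bar>)\<^sup>2"
  shows "uniform_limit UNIV (\<lambda>F x. \<Sum>m\<in>F. c m * cis (of_int m * x)) (\<lambda>x. \<Sum>\<^sub>\<infinity>m. c m * cis (of_int m * x)) (finite_subsets_at_top UNIV)"
  by (rule Weierstrass_m_test_general[OF _ summable_inverse_square_int[of B]]) (simp add: norm_mult b)

text \<open>Quadratic decay makes the partial sums converge uniformly by the M-test, and both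
  continuity and the Fourier coefficients pass to a uniform limit.\<close>

lemma fourier_series:
  assumes b: "\<And>m. cmod (c m) \<le> B / (1 + \<bar>of_int m\<bar>)\<^sup>2"
  defines "g \<equiv> \<lambda>x. \<Sum>\<^sub>\<infinity>m. c m * cis (of_int m * x)"
  shows "continuous_on UNIV g" and "fourier_coeff g m = c m"
    and "((\<lambda>m. c m * cis (of_int m * x)) has_sum g x) UNIV"
proof -
  note ul = uniform_limit_fourier_series[OF b, folded g_def]
  show cont: "continuous_on UNIV g"
    by (rule uniform_limit_theorem[OF _ ul]) (auto intro!: always_eventually continuous_intros)
  show "((\<lambda>m. c m * cis (of_int m * x)) has_sum g x) UNIV"
    unfolding has_sum_def using tendsto_uniform_limitI[OF ul] by simp
  have "cmod (fourier_coeff g m - c m) \<le> 2 * e" if e: "e > 0" for e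
  proof -
    have "\<forall>\<^sub>F F in finite_subsets_at_top UNIV. \<forall>x\<in>UNIV. dist (\<Sum>m\<in>F. c m * cis (of_int m * x)) (g x) < e"
      by (rule uniform_limitD[OF ul e])
    moreover have "\<forall>\<^sub>F F in finite_subsets_at_top UNIV. finite F \<and> {m} \<subseteq> F \<and> F \<subseteq> UNIV"
      unfolding eventually_finite_subsets_at_top by (intro exI[of _ "{m}"]) auto
    ultimately have "\<forall>\<^sub>F F in finite_subsets_at_top UNIV. (\<forall>x. dist (\<Sum>m\<in>F. c m * cis (of_int m * x)) (g x) < e) \<and> finite F \<and> m \<in> F"
      by eventually_elim auto
    then obtain F where F: "\<And>x. dist (\<Sum>m\<in>F. c m * cis (of_int m * x)) (g x) < e" "finite F" "m \<in> F"
      using eventually_happens'[OF finite_subsets_at_top_neq_bot] by blast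
    have cg: "continuous_on {-pi..pi} g" using cont continuous_on_subset by blast
    have cF: "continuous_on {-pi..pi} (\<lambda>x. \<Sum>m\<in>F. c m * cis (of_int m * x))" by (intro continuous_intros)
    have "cmod (fourier_coeff (\<lambda>x. g x - (\<Sum>m\<in>F. c m * cis (of_int m * x))) m) \<le> 2 * e"
      by (rule fourier_coeff_bound) (auto intro!: continuous_intros cg cF less_imp_le simp: F(1)[unfolded dist_norm] norm_minus_commute[of "g _"])
    moreover have "fourier_coeff (\<lambda>x. \<Sum>m\<in>F. c m * cis (of_int m * x)) m = c m"
      using F by (subst fourier_coeff_sum_cis) auto
    ultimately show ?thesis by (simp add: fourier_coeff_diff[OF cg cF])
  qed
  \<comment> \<open>With e a quarter of the difference d the bound reads d <= d / 2, so d =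
    0.\<close>
  from this[of "cmod (fourier_coeff g m - c m) / 4"] show "fourier_coeff g m = c m"
    by (cases "fourier_coeff g m = c m") auto
qed

section \<open>Density of trigonometric polynomials and uniqueness of Fourier coefficients\<close>

lemma cis_in_trig_space: "\<bar>m\<bar> \<le> int N \<Longrightarrow> (\<lambda>x. cis (of_int m * x)) \<in> trig_space N"
proof -
  assume m: "\<bar>m\<bar> \<le> int N"
  have "(\<Sum>l\<in>modes N. (if l = m then 1 else 0) * cis (of_int l * x)) = cis (of_int m * x)" for x
  proof -
    have "(\<Sum>l\<in>modes N. (if l = m then 1 else 0) * cis (of_int l * x)) = (\<Sum>l\<in>modes N. if l = m then cis (of_int m * x) else 0)"
      by (intro sum.cong) auto
    then show ?thesis using m by (simp add: modes_iff)
  qed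
  then show ?thesis unfolding trig_space_iff by (intro exI[of _ "\<lambda>l. if l = m then 1 else 0"]) presburger
qed

lemma trig_space_mono: "f \<in> trig_space N \<Longrightarrow> N \<le> N' \<Longrightarrow> f \<in> trig_space N'"
proof -
  assume f: "f \<in> trig_space N" and N: "N \<le> N'"
  have "(\<lambda>x. \<Sum>m\<in>modes N. fourier_coeff f m * cis (of_int m * x)) \<in> trig_space N'"
    using N by (intro trig_space_intros cis_in_trig_space) (auto simp: modes_iff)
  then show ?thesis by (simp flip: trig_space_expand[OF f])
qed

lemma trig_space_mult:
  assumes f: "f \<in> trig_space N" and g: "g \<in> trig_space N'"
  shows "(\<lambda>x. f x * g x) \<in> trig_space (N + N')"
proof -
  have "f x * g x = (\<Sum>m\<in>modes N. \<Sum>l\<in>modes N'. (fourier_coeff f m * fourier_coeff g l) * cis (of_int (m + l) * x))" for x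
    by (subst trig_space_expand[OF f], subst trig_space_expand[OF g])
       (simp add: sum_product cis_mult distrib_left distrib_right mult_ac flip: mult.assoc)
  moreover have "(\<lambda>x. \<Sum>m\<in>modes N. \<Sum>l\<in>modes N'. (fourier_coeff f m * fourier_coeff g l) * cis (of_int (m + l) * x)) \<in> trig_space (N + N')"
    by (intro trig_space_intros cis_in_trig_space) (auto simp: modes_iff)
  ultimately show ?thesis by presburger
qed

text \<open>On the circle a real-linear form is a combination of cos and sin, that is of the modes 1
  and -1; sums and products remain trigonometric polynomials, of growing degree. This turns
  Stone-Weierstrass on the circle into approximation by \<open>trig_space\<close>.\<close>

lemma real_polynomial_cis_in_trig_space:
  "real_polynomial_function p \<Longrightarrow> \<exists>N. (\<lambda>x. complex_of_real (p (cis x))) \<in> trig_space N"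
proof (induction rule: real_polynomial_function.induct)
  case (linear f)
  interpret bounded_linear f by fact
  have lin: "f (cis x) = f 1 * cos x + f \<i> * sin x" for x
  proof -
    have "cis x = cos x *\<^sub>R 1 + sin x *\<^sub>R \<i>" by (simp add: complex_eq_iff)
    then have "f (cis x) = cos x *\<^sub>R f 1 + sin x *\<^sub>R f \<i>" by (simp only: add scaleR)
    then show ?thesis by simp
  qed
  have trig: "complex_of_real (cos x) = (1/2) * (cis (of_int 1 * x) + cis (of_int (-1) * x))"
      "complex_of_real (sin x) = (- \<i> / 2) * (cis (of_int 1 * x) - cis (of_int (-1) * x))" for x
    by (simp_all add: complex_eq_iff)
  have "(\<lambda>x. of_real (f 1) * ((1/2) * (cis (of_int 1 * x) + cis (of_int (-1) * x)))
      + of_real (f \<i>) * ((- \<i> / 2) * (cis (of_int 1 * x) - cis (of_int (-1) * x)))) \<in> trig_space 1"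
    by (intro trig_space_intros cis_in_trig_space; simp)
  then have "(\<lambda>x. complex_of_real (f (cis x))) \<in> trig_space 1"
    unfolding lin of_real_add of_real_mult trig .
  then show ?case ..
next
  case (const c)
  have "(\<lambda>x. of_real c * cis (of_int 0 * x)) \<in> trig_space 0"
    by (intro trig_space_intros cis_in_trig_space) simp
  then have "(\<lambda>x. complex_of_real c) \<in> trig_space 0" by simp
  then show ?case ..
next
  case (add f g)
  then obtain N N' where N: "(\<lambda>x. complex_of_real (f (cis x))) \<in> trig_space N" "(\<lambda>x. complex_of_real (g (cis x))) \<in> trig_space N'"
    by blast
  have "(\<lambda>x. complex_of_real (f (cis x)) + complex_of_real (g (cis x))) \<in> trig_space (N + N')"
    by (intro trig_space_add trig_space_mono[OF N(1)] trig_space_mono[OF N(2)]) simp_all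
  then show ?case unfolding of_real_add ..
next
  case (mult f g)
  then obtain N N' where N: "(\<lambda>x. complex_of_real (f (cis x))) \<in> trig_space N" "(\<lambda>x. complex_of_real (g (cis x))) \<in> trig_space N'"
    by blast
  show ?case unfolding of_real_mult using trig_space_mult[OF N] ..
qed

text \<open>\<open>Arg\<close> jumps on the negative axis and \<open>Arg2pi\<close> on the positive
  one. They differ by 0 or 2 pi, which f does not see, so continuity at each point can be taken from
  the branch that is continuous there.\<close>

lemma periodic_lift_continuous:
  fixes f :: "real \<Rightarrow> complex"
  assumes f: "continuous_on UNIV f" and p: "\<And>x. f (x + 2 * pi) = f x"
  shows "continuous_on (sphere 0 1) (\<lambda>z. f (Arg z))"
proof -
  have eq: "f (Arg z) = f (Arg2pi z)" if "z \<noteq> 0" for z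
  proof (cases "Arg z < 0")
    case True
    have "exp (\<i> * (2 * complex_of_real pi)) = 1"
      using exp_two_pi_i by (simp add: mult_ac)
    then have "exp (\<i> * complex_of_real (Arg z + 2 * pi)) = exp (\<i> * complex_of_real (Arg z))"
      by (simp add: distrib_left exp_add)
    then have z: "complex_of_real (cmod z) * exp (\<i> * complex_of_real (Arg z + 2 * pi)) = z"
      by (simp only: Arg_eq[OF that, symmetric])
    have pos: "0 < cmod z" using that by simp
    have bd: "0 \<le> Arg z + 2 * pi" "Arg z + 2 * pi < 2 * pi"
      using True Arg_bounded[of z] pi_gt_zero by linarith+
    have "Arg2pi z = Arg z + 2 * pi"
      by (rule Arg2pi_unique[OF z pos bd])
    then show ?thesis by (simp add: p)
  next
    case False
    have pos: "0 < cmod z" using that by simp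
    have bd: "0 \<le> Arg z" "Arg z < 2 * pi"
      using False Arg_bounded[of z] pi_gt_zero by linarith+
    have "Arg2pi z = Arg z"
      by (rule Arg2pi_unique[OF Arg_eq[OF that, symmetric] pos bd])
    then show ?thesis by simp
  qed
  have "isCont (\<lambda>z. f (Arg z)) z" if z: "z \<in> sphere 0 1" for z
  proof (cases "z \<in> \<real>\<^sub>\<le>\<^sub>0")
    case False
    then have "isCont Arg z" by (rule continuous_at_Arg)
    moreover have "isCont f (Arg z)" using f continuous_on_eq_continuous_at by blast
    ultimately show ?thesis by (rule isCont_o2)
  next
    case True
    have "z \<notin> \<real>\<^sub>\<ge>\<^sub>0"
    proof
      assume "z \<in> \<real>\<^sub>\<ge>\<^sub>0"
      then have "z = 0" using True by (auto simp: complex_nonneg_Reals_iff complex_nonpos_Reals_iff complex_eq_iff)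
      then show False using z by simp
    qed
    then have "isCont Arg2pi z" by (rule continuous_at_Arg2pi)
    moreover have "isCont f (Arg2pi z)" using f continuous_on_eq_continuous_at by blast
    ultimately have c: "isCont (\<lambda>z. f (Arg2pi z)) z" by (rule isCont_o2)
    have "z \<in> - {0}" using z by auto
    then have "\<forall>\<^sub>F w in nhds z. w \<in> - {0}" by (intro eventually_nhds_in_open) auto
    then have ev: "\<forall>\<^sub>F w in nhds z. f (Arg w) = f (Arg2pi w)"
      by (rule eventually_mono) (rule eq, simp)
    show ?thesis unfolding isCont_cong[OF ev] by (rule c)
  qed
  then show ?thesis by (intro continuous_at_imp_continuous_on) auto
qed

text \<open>Approximate f uniformly on the circle by a trigonometric polynomial g. All coefficients
  of f vanish, so <f, g> = 0 and |f|^2 = <f - g, f>, which is arbitrarily small.\<close>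

lemma fourier_uniqueness:
  fixes f :: "real \<Rightarrow> complex"
  assumes f: "continuous_on UNIV f" and p: "periodic_fun_simple f (2 * pi)" and 0: "\<And>m. fourier_coeff f m = 0"
  shows "f x = 0"
proof -
  interpret periodic_fun_simple f "2 * pi" by fact
  have fc: "continuous_on {-pi..pi} f" using f continuous_on_subset by blast
  have lift: "continuous_on (sphere 0 1) (\<lambda>z. f (Arg z))"
    by (rule periodic_lift_continuous[OF f]) (rule plus_1)
  have Arg_cis: "f (Arg (cis x)) = f x" if "x \<in> {-pi..pi}" for x
  proof (cases "x = -pi")
    case True
    have "cis (-pi) = -1" by (simp add: complex_eq_iff)
    moreover have "Arg (-1) = pi" by (simp add: Arg_eq_pi)
    moreover have "f pi = f (-pi)" using plus_1[of "-pi"] by simp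
    ultimately show ?thesis using True by simp
  next
    case False
    then have "Arg (cis x) = x" using that by (intro cis_Arg_unique) auto
    then show ?thesis by simp
  qed
  have small: "cmod (L2_inner f f) \<le> L2_norm f * (6 * e)" if e: "e > 0" for e
  proof -
    have cR: "continuous_on (sphere 0 1) (\<lambda>z. Re (f (Arg z)))" "continuous_on (sphere 0 1) (\<lambda>z. Im (f (Arg z)))"
      by (rule continuous_on_Re[OF lift] continuous_on_Im[OF lift])+
    obtain p where p: "real_polynomial_function p" "\<And>z. z \<in> sphere 0 1 \<Longrightarrow> \<bar>Re (f (Arg z)) - p z\<bar> < e"
      by (rule Stone_Weierstrass_real_polynomial_function[OF compact_sphere cR(1) e]) (rule that)
    obtain q where q: "real_polynomial_function q" "\<And>z. z \<in> sphere 0 1 \<Longrightarrow> \<bar>Im (f (Arg z)) - q z\<bar> < e"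
      by (rule Stone_Weierstrass_real_polynomial_function[OF compact_sphere cR(2) e]) (rule that)
    obtain N where N: "(\<lambda>x. complex_of_real (p (cis x))) \<in> trig_space N"
      using real_polynomial_cis_in_trig_space[OF p(1)] ..
    obtain N' where N': "(\<lambda>x. complex_of_real (q (cis x))) \<in> trig_space N'"
      using real_polynomial_cis_in_trig_space[OF q(1)] ..
    define g where "g x = complex_of_real (p (cis x)) + \<i> * complex_of_real (q (cis x))" for x
    have g: "g \<in> trig_space (N + N')"
      unfolding g_def[abs_def] by (intro trig_space_add trig_space_scale trig_space_mono[OF N] trig_space_mono[OF N']) simp_all
    have gc: "continuous_on {-pi..pi} g" by (rule continuous_on_trig_space[OF g])
    have close: "cmod (f x - g x) \<le> 2 * e" if x: "x \<in> {-pi..pi}" for x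
    proof -
      have "cis x \<in> sphere 0 1" by simp
      note pq = p(2)[OF this] q(2)[OF this]
      have "Re (f x - g x) = Re (f (Arg (cis x))) - p (cis x)" "Im (f x - g x) = Im (f (Arg (cis x))) - q (cis x)"
        by (simp_all add: g_def Arg_cis[OF x])
      then show ?thesis using pq cmod_le[of "f x - g x"] by linarith
    qed
    have "L2_inner f g = 0" by (simp add: L2_inner_trig_space_right[OF fc g] 0)
    then have "L2_inner g f = 0" using L2_inner_cnj[of f g] by simp
    have "L2_inner (\<lambda>x. (f x - g x) + g x) f = L2_inner (\<lambda>x. f x - g x) f + L2_inner g f"
      by (intro L2_inner_add_left continuous_intros fc gc)
    then have "L2_inner f f = L2_inner (\<lambda>x. f x - g x) f" using \<open>L2_inner g f = 0\<close> by simp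
    also have "cmod \<dots> \<le> L2_norm (\<lambda>x. f x - g x) * L2_norm f"
      by (intro cauchy_schwarz_L2_inner continuous_intros fc gc)
    also have "L2_norm (\<lambda>x. f x - g x) \<le> 3 * (2 * e)"
    proof -
      \<comment> \<open>Cut off outside [-pi, pi]: the estimate \<open>close\<close> is known only
        there, while \<open>L2_norm_le_sup\<close> asks for a bound at every point.\<close>
      define h where "h x = (if x \<in> {-pi..pi} then f x - g x else 0)" for x
      have "L2_norm (\<lambda>x. f x - g x) = L2_norm h"
        unfolding L2_norm_def by (intro arg_cong[of _ _ sqrt] set_lebesgue_integral_cong) (auto simp: h_def)
      also have "\<dots> \<le> 3 * (2 * e)"
      proof (rule L2_norm_le_sup)
        show "continuous_on {-pi..pi} h"
          by (rule continuous_on_eq[of _ "\<lambda>x. f x - g x"]) (auto intro!: continuous_intros fc gc simp: h_def)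
        show "cmod (h x) \<le> 2 * e" for x using close e by (auto simp: h_def)
      qed
      finally show ?thesis .
    qed
    finally show ?thesis by (simp add: mult_right_mono mult.commute)
  qed
  have "cmod (L2_inner f f) \<le> 0"
  proof (cases "L2_norm f = 0")
    case False
    show ?thesis
    proof (rule field_le_epsilon)
      fix e :: real assume "e > 0"
      then show "cmod (L2_inner f f) \<le> 0 + e"
        using small[of "e / (6 * L2_norm f)"] False by (simp add: less_le)
    qed
  qed (use small[of 1] in simp)
  then have "integral {-pi..pi} (\<lambda>x. (cmod (f x))\<^sup>2) = 0"
    using L2_norm_L2_inner[OF fc] by simp
  then have z: "\<And>x. x \<in> {-pi..pi} \<Longrightarrow> f x = 0"
    by (subst (asm) integral_eq_0_iff) (auto intro!: continuous_intros fc)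
  define n where "n = \<lfloor>(x + pi) / (2 * pi)\<rfloor>"
  have "x - of_int n * (2 * pi) \<in> {-pi..pi}"
  proof -
    have "of_int n \<le> (x + pi) / (2 * pi)" "(x + pi) / (2 * pi) < of_int n + 1" unfolding n_def by linarith+
    then show ?thesis by (simp add: field_simps)
  qed
  from z[OF this] show "f x = 0" by (simp add: minus_of_int)
qed

section \<open>Uniform regularity of the semidiscrete solution\<close>

text \<open>A single term of the series is at most the sum. As (1 + |m|)^2 <= 2 (1 + m^2), the 20th
  power costs 2^20, hence 1024 = 2^10 after the root. The exponent 20 supplies all powers of N
  consumed later.\<close>

lemma bounded_in_H_decay:
  assumes "bounded_in_H \<mu> T u" and \<mu>: "\<mu> \<ge> 20"
  obtains B where "B \<ge> 0" "\<forall>t\<in>{0..T}. \<forall>m. (1 + \<bar>of_int m\<bar>) ^ 20 * cmod (fourier_coeff (u t) m) \<le> B"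
proof -
  obtain H where H: "\<And>t. t \<in> {0..T} \<Longrightarrow> in_H \<mu> (u t) \<and> H_norm \<mu> (u t) \<le> H"
    using assms(1) unfolding bounded_in_H_def by blast
  show ?thesis
  proof
    show "1024 * \<bar>H\<bar> \<ge> 0" by simp
    show "\<forall>t\<in>{0..T}. \<forall>m. (1 + \<bar>of_int m\<bar>) ^ 20 * cmod (fourier_coeff (u t) m) \<le> 1024 * \<bar>H\<bar>"
    proof (intro ballI allI)
      fix t :: real and m :: int assume t: "t \<in> {0..T}"
      define c where "c = cmod (fourier_coeff (u t) m)"
      define w where "w = 1 + \<bar>real_of_int m\<bar>"
      let ?f = "\<lambda>m::int. (1 + (of_int m)\<^sup>2) powr \<mu> * (cmod (fourier_coeff (u t) m))\<^sup>2"
      have "sum ?f {m} \<le> infsum ?f UNIV"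
        using H[OF t] by (intro finite_sum_le_infsum) (auto simp: in_H_def)
      also have "\<dots> \<le> H\<^sup>2" using H[OF t] by (intro sqrt_le_D) (simp add: H_norm_def)
      finally have 1: "(1 + (of_int m)\<^sup>2) powr \<mu> * c\<^sup>2 \<le> H\<^sup>2" by (simp add: c_def)
      have "(1 + (real_of_int m)\<^sup>2) ^ 20 = (1 + (of_int m)\<^sup>2) powr 20"
        by (subst powr_realpow[symmetric]) (auto intro: add_pos_nonneg)
      also have "\<dots> \<le> (1 + (of_int m)\<^sup>2) powr \<mu>" using \<mu> by (intro powr_mono) auto
      finally have "(1 + (real_of_int m)\<^sup>2) ^ 20 * c\<^sup>2 \<le> H\<^sup>2"
        using 1 by (meson mult_right_mono order_trans zero_le_power2)
      moreover have "(w\<^sup>2) ^ 20 \<le> (2 * (1 + (real_of_int m)\<^sup>2)) ^ 20"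
      proof (rule power_mono)
        have "0 \<le> (1 - \<bar>real_of_int m\<bar>)\<^sup>2" by simp
        then show "w\<^sup>2 \<le> 2 * (1 + (real_of_int m)\<^sup>2)" by (simp add: w_def power2_eq_square algebra_simps)
      qed simp
      then have "(w\<^sup>2) ^ 20 * c\<^sup>2 \<le> 2 ^ 20 * (1 + (real_of_int m)\<^sup>2) ^ 20 * c\<^sup>2"
        unfolding power_mult_distrib by (rule mult_right_mono) simp
      ultimately have "(w\<^sup>2) ^ 20 * c\<^sup>2 \<le> 2 ^ 20 * H\<^sup>2" by simp
      moreover have "(w ^ 20 * c)\<^sup>2 = (w\<^sup>2) ^ 20 * c\<^sup>2" by (simp add: power_mult_distrib flip: power_mult)
      moreover have "(1024 * \<bar>H\<bar>)\<^sup>2 = 2 ^ 20 * H\<^sup>2" by (simp add: power_mult_distrib)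
      ultimately have "(w ^ 20 * c)\<^sup>2 \<le> (1024 * \<bar>H\<bar>)\<^sup>2" by simp
      then have "w ^ 20 * c \<le> 1024 * \<bar>H\<bar>" by (rule power2_le_imp_le) simp
      then show "(1 + \<bar>of_int m\<bar>) ^ 20 * cmod (fourier_coeff (u t) m) \<le> 1024 * \<bar>H\<bar>"
        by (simp add: w_def c_def)
    qed
  qed
qed

text \<open>At the first zero p of f - g the derivative is negative, so f - g is positive just
  before p and has an earlier zero by the intermediate value theorem. Derivatives are compared only
  where f = g: there the size of the error is known, which a Gronwall estimate would have to
  presuppose.\<close>

lemma first_crossing_barrier:
  fixes f g :: "real \<Rightarrow> real"
  assumes f: "\<And>t. t \<in> {0..T} \<Longrightarrow> (f has_real_derivative f' t) (at t within {0..T})"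
    and g: "\<And>t. t \<in> {0..T} \<Longrightarrow> (g has_real_derivative g' t) (at t within {0..T})"
    and 0: "f 0 < g 0" and cross: "\<And>t. t \<in> {0..T} \<Longrightarrow> f t = g t \<Longrightarrow> f' t < g' t" and t: "t \<in> {0..T}"
  shows "f t < g t"
proof (rule ccontr)
  assume "\<not> f t < g t"
  define h where "h t = f t - g t" for t
  have hd: "(h has_real_derivative f' t - g' t) (at t within {0..T})" if "t \<in> {0..T}" for t
    unfolding h_def[abs_def] by (intro DERIV_diff f g that)
  have hc: "continuous_on {0..T} h"
    using hd DERIV_continuous continuous_on_eq_continuous_within by blast
  have zero: "\<exists>r\<in>{0..p}. h r = 0" if "p \<in> {0..T}" "h p \<ge> 0" for p
  proof -
    have "continuous_on {0..p} h" using hc that by (elim continuous_on_subset) auto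
    then show ?thesis using IVT'[of h 0 0 p] 0 that by (auto simp: h_def)
  qed
  define Z where "Z = {0..T} \<inter> h -` {0}"
  have "closed Z" unfolding Z_def by (rule continuous_closed_preimage[OF hc]) auto
  then have "compact Z" unfolding Z_def using bounded_subset[OF bounded_closed_interval[of 0 T]] compact_eq_bounded_closed by blast
  moreover have "Z \<noteq> {}"
  proof -
    obtain r where "r \<in> {0..t}" "h r = 0" using zero[OF t] \<open>\<not> f t < g t\<close> by (auto simp: h_def)
    then have "r \<in> Z" using t by (simp add: Z_def)
    then show ?thesis by blast
  qed
  ultimately obtain p where p: "p \<in> Z" and least: "\<And>r. r \<in> Z \<Longrightarrow> p \<le> r"
    using compact_attains_inf by metis
  have pT: "p \<in> {0..T}" and hp: "h p = 0" using p by (auto simp: Z_def)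
  then have "p \<noteq> 0" using 0 by (auto simp: h_def)
  then have p0: "p > 0" using pT by simp
  have "f' p - g' p < 0" using cross[OF pT] hp by (simp add: h_def)
  from has_real_derivative_neg_dec_left[OF hd[OF pT] this]
  obtain d where d: "d > 0" "\<And>e. e > 0 \<Longrightarrow> p - e \<in> {0..T} \<Longrightarrow> e < d \<Longrightarrow> h p < h (p - e)" by blast
  define e where "e = min (d / 2) p"
  have e: "e > 0" "e < d" "p - e \<in> {0..T}" using d(1) p0 pT by (auto simp: e_def min_def)
  then have "h (p - e) > 0" using d(2)[of e] hp by simp
  then obtain r where "r \<in> {0..p - e}" "h r = 0" using zero[OF e(3)] by auto
  then have "r \<in> Z" "r < p" using pT e by (auto simp: Z_def)
  then show False using least[of r] by simp
qed

text \<open>For the consistency error, where both arguments, u and its projection, are bounded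
  independently of N, so that quadratic dependence on the bound does no harm.\<close>

lemma cubic_lipschitz:
  fixes z w :: complex
  assumes "cmod z \<le> K" "cmod w \<le> K"
  shows "cmod (of_real ((cmod z)\<^sup>2) * z - of_real ((cmod w)\<^sup>2) * w) \<le> 3 * K\<^sup>2 * cmod (z - w)"
proof -
  have K: "K \<ge> 0" using assms(1) norm_ge_zero order_trans by blast
  have "of_real ((cmod z)\<^sup>2) * z - of_real ((cmod w)\<^sup>2) * w =
      of_real ((cmod z)\<^sup>2) * (z - w) + of_real (cmod z + cmod w) * of_real (cmod z - cmod w) * w"
    by (simp add: algebra_simps power2_eq_square)
  also have "cmod \<dots> \<le> (cmod z)\<^sup>2 * cmod (z - w) + (cmod z + cmod w) * \<bar>cmod z - cmod w\<bar> * cmod w"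
    by (rule order_trans[OF norm_triangle_ineq]) (simp add: norm_mult norm_power flip: of_real_add of_real_diff)
  also have "\<dots> \<le> K\<^sup>2 * cmod (z - w) + (K + K) * cmod (z - w) * K"
    by (intro add_mono mult_mono power_mono assms norm_triangle_ineq3) (use K in auto)
  finally show ?thesis by (simp add: power2_eq_square algebra_simps)
qed

text \<open>Equivalence of norms on a band: the weight costs (1 + N)^r and the number of modes one
  more power.\<close>

lemma wiener_le_L2_norm:
  assumes f: "f \<in> trig_space N"
  shows "wiener N r f \<le> 2 * (1 + real N) ^ Suc r * L2_norm f"
proof -
  have "cmod (fourier_coeff f m) \<le> L2_norm f" if m: "m \<in> modes N" for m
  proof (rule power2_le_imp_le)
    have "(cmod (fourier_coeff f m))\<^sup>2 \<le> (\<Sum>m\<in>modes N. (cmod (fourier_coeff f m))\<^sup>2)"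
      by (rule member_le_sum[OF m]) auto
    also have "\<dots> \<le> 2 * pi * (\<Sum>m\<in>modes N. (cmod (fourier_coeff f m))\<^sup>2)"
      using pi_gt3 mult_right_mono[of 1 "2 * pi" "\<Sum>m\<in>modes N. (cmod (fourier_coeff f m))\<^sup>2"] by (simp add: sum_nonneg)
    finally show "(cmod (fourier_coeff f m))\<^sup>2 \<le> (L2_norm f)\<^sup>2" by (simp add: parseval_trig_space[OF f])
  qed simp
  moreover have "(1 + \<bar>real_of_int m\<bar>) ^ r \<le> (1 + real N) ^ r" if "m \<in> modes N" for m
  proof (rule power_mono)
    have "real_of_int \<bar>m\<bar> \<le> real_of_int (int N)" using that unfolding modes_iff of_int_le_iff .
    then show "1 + \<bar>real_of_int m\<bar> \<le> 1 + real N" by simp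
  qed simp
  ultimately have "wiener N r f \<le> (\<Sum>m\<in>modes N. (1 + real N) ^ r * L2_norm f)"
    unfolding wiener_def by (intro sum_mono mult_mono) auto
  also have "\<dots> = (2 * real N + 1) * ((1 + real N) ^ r * L2_norm f)" by (simp add: modes_def)
  also have "\<dots> \<le> (2 * (1 + real N)) * ((1 + real N) ^ r * L2_norm f)"
    by (intro mult_right_mono) auto
  finally show ?thesis by (simp only: power_Suc mult_ac)
qed

section \<open>Galerkin error against the projected exact solution\<close>

context
  fixes s T B :: real and u0 :: "real \<Rightarrow> complex" and u :: "real \<Rightarrow> real \<Rightarrow> complex"
  assumes s: "0 < s" "s \<le> 1" and T: "0 < T" and sol: "nls_solution s T u0 u"
    and B: "0 \<le> B" and decay: "\<forall>t\<in>{0..T}. \<forall>m. (1 + \<bar>of_int m\<bar>) ^ 20 * cmod (fourier_coeff (u t) m) \<le> B"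
begin

lemma continuous_on_solution: "t \<in> {0..T} \<Longrightarrow> continuous_on S (u t)"
proof -
  assume t: "t \<in> {0..T}"
  have "continuous_on ({0..T} \<times> UNIV) (\<lambda>(t, x). u t x)" using sol by (simp add: nls_solution_def)
  moreover have "continuous_on S (\<lambda>x. (t, x))" by (intro continuous_intros)
  moreover have "(\<lambda>x. (t, x)) ` S \<subseteq> {0..T} \<times> UNIV" using t by auto
  ultimately have "continuous_on S (\<lambda>x. case (t, x) of (t, x) \<Rightarrow> u t x)" by (rule continuous_on_compose2)
  then show ?thesis by simp
qed

lemma fourier_coeff_decay:
  assumes t: "t \<in> {0..T}" and a: "a + l \<le> 20"
  shows "(1 + \<bar>of_int m\<bar>) ^ a * cmod (fourier_coeff (u t) m) \<le> B / (1 + \<bar>of_int m\<bar>) ^ l"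
proof -
  have "(1 + \<bar>of_int m\<bar>) ^ (a + l) * cmod (fourier_coeff (u t) m) \<le> (1 + \<bar>of_int m\<bar>) ^ 20 * cmod (fourier_coeff (u t) m)"
    using a by (intro mult_right_mono power_increasing) auto
  also have "\<dots> \<le> B" using decay t by blast
  finally show ?thesis by (simp add: power_add field_simps)
qed

text \<open>The sum of the series is continuous, periodic and has the coefficients of
  \<open>u t\<close>, so uniqueness identifies the two. Decay of coefficients thereby yields
  pointwise statements about u.\<close>

lemma has_sum_fourier_series:
  assumes t: "t \<in> {0..T}"
  shows "((\<lambda>m. fourier_coeff (u t) m * cis (of_int m * x)) has_sum u t x) UNIV"
proof -
  have b: "cmod (fourier_coeff (u t) m) \<le> B / (1 + \<bar>of_int m\<bar>)\<^sup>2" for m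
    using fourier_coeff_decay[OF t, of 0 2 m] by simp
  note fs = fourier_series[OF b]
  define g where "g x = (\<Sum>\<^sub>\<infinity>m. fourier_coeff (u t) m * cis (of_int m * x))" for x
  have gc: "continuous_on S g" for S
    using fs(1) continuous_on_subset unfolding g_def[abs_def] by blast
  have per: "periodic_fun_simple (\<lambda>x. u t x - g x) (2 * pi)"
  proof
    fix x
    have "cis (of_int m * (x + 2 * pi)) = cis (of_int m * x)" for m
    proof -
      have "cis (of_int m * (x + 2 * pi)) = cis (of_int m * x) * cis (2 * pi * of_int m)"
        by (simp add: cis_mult algebra_simps)
      then show ?thesis by (simp add: cis_multiple_2pi)
    qed
    moreover have "periodic_fun_simple (u t) (2 * pi)" using sol t by (simp add: nls_solution_def)
    ultimately show "u t (x + 2 * pi) - g (x + 2 * pi) = u t x - g x"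
      by (simp add: g_def periodic_fun_simple.plus_period)
  qed
  have "fourier_coeff (\<lambda>x. u t x - g x) m = 0" for m
    using fourier_coeff_diff[OF continuous_on_solution[OF t] gc] fs(2) by (simp add: g_def[abs_def])
  then have "u t x - g x = 0"
    by (intro fourier_uniqueness[OF _ per]) (intro continuous_intros continuous_on_solution t gc)
  then show ?thesis using fs(3)[of x] by (simp add: g_def)
qed

lemma fourier_partial_sum_bound:
  assumes t: "t \<in> {0..T}" and A: "finite A" and F: "finite F" "\<And>m. m \<in> F \<Longrightarrow> m \<notin> A"
    and q: "0 \<le> q" "\<And>m. m \<notin> A \<Longrightarrow> cmod (fourier_coeff (u t) m) \<le> q / (1 + \<bar>of_int m\<bar>)\<^sup>2"
  shows "cmod (\<Sum>m\<in>F. fourier_coeff (u t) m * cis (of_int m * x)) \<le> 3 * q"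
proof -
  have "cmod (\<Sum>m\<in>F. fourier_coeff (u t) m * cis (of_int m * x)) \<le> (\<Sum>m\<in>F. q / (1 + \<bar>of_int m\<bar>)\<^sup>2)"
    by (rule sum_norm_le) (use F(2) q(2) in \<open>auto simp: norm_mult\<close>)
  also have "\<dots> = q * (\<Sum>m\<in>F. 1 / (1 + \<bar>of_int m\<bar>)\<^sup>2)" by (simp add: sum_distrib_left)
  also have "\<dots> \<le> q * 3" by (intro mult_left_mono sum_inverse_square_int F q)
  finally show ?thesis by simp
qed

text \<open>A is the set of modes taken out: the empty set gives the sup bound on u, and
  \<open>modes N\<close> the projection error.\<close>

lemma fourier_tail_bound:
  assumes t: "t \<in> {0..T}" and A: "finite A"
    and q: "0 \<le> q" "\<And>m. m \<notin> A \<Longrightarrow> cmod (fourier_coeff (u t) m) \<le> q / (1 + \<bar>of_int m\<bar>)\<^sup>2"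
  shows "cmod (u t x - (\<Sum>m\<in>A. fourier_coeff (u t) m * cis (of_int m * x))) \<le> 3 * q"
proof (rule Lim_norm_ubound[OF finite_subsets_at_top_neq_bot])
  let ?c = "\<lambda>m. fourier_coeff (u t) m * cis (of_int m * x)"
  show "((\<lambda>F. sum ?c F - sum ?c A) \<longlongrightarrow> u t x - sum ?c A) (finite_subsets_at_top UNIV)"
    using has_sum_fourier_series[OF t, of x] unfolding has_sum_def by (intro tendsto_intros)
  have "cmod (sum ?c F - sum ?c A) \<le> 3 * q" if F: "finite F" "A \<subseteq> F" for F
  proof -
    have "sum ?c F - sum ?c A = sum ?c (F - A)" using sum_diff[OF F, of ?c] by simp
    then show ?thesis using fourier_partial_sum_bound[OF t A, of "F - A"] F q by simp
  qed
  then show "\<forall>\<^sub>F F in finite_subsets_at_top UNIV. cmod (sum ?c F - sum ?c A) \<le> 3 * q"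
    unfolding eventually_finite_subsets_at_top using A by (intro exI[of _ A]) auto
qed

lemma solution_sup: "t \<in> {0..T} \<Longrightarrow> cmod (u t x) \<le> 3 * B"
  using fourier_tail_bound[of t "{}" B x] fourier_coeff_decay[of t 0 2] B by simp

lemma wiener_trig_proj_solution:
  assumes t: "t \<in> {0..T}" shows "wiener N 10 (trig_proj N (u t)) \<le> 3 * B"
proof -
  have "wiener N 10 (trig_proj N (u t)) \<le> (\<Sum>m\<in>modes N. B / (1 + \<bar>of_int m\<bar>)\<^sup>2)"
    unfolding wiener_trig_proj unfolding wiener_def by (intro sum_mono fourier_coeff_decay[OF t]) simp
  also have "\<dots> = B * (\<Sum>m\<in>modes N. 1 / (1 + \<bar>of_int m\<bar>)\<^sup>2)" by (simp add: sum_distrib_left)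
  also have "\<dots> \<le> B * 3" by (intro mult_left_mono sum_inverse_square_int B finite_modes)
  finally show ?thesis by simp
qed

lemma trig_proj_error:
  assumes t: "t \<in> {0..T}" shows "cmod (u t x - trig_proj N (u t) x) \<le> 3 * (B / (1 + real N) ^ 18)"
  unfolding trig_proj_modes
proof (rule fourier_tail_bound[OF t finite_modes])
  fix m assume "m \<notin> modes N"
  then have "real N \<le> \<bar>of_int m\<bar>" by (simp add: modes_iff)
  then have w: "(1 + real N) ^ 18 \<le> (1 + \<bar>of_int m\<bar>) ^ 18" by (intro power_mono) auto
  have "cmod (fourier_coeff (u t) m) \<le> B / (1 + \<bar>of_int m\<bar>) ^ 20"
    using fourier_coeff_decay[OF t, of 0 20 m] by simp
  \<comment> \<open>20 = 18 + 2: two powers pay for summability, the other 18 become smallness in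
    N.\<close>
  also have "\<dots> = B / (1 + \<bar>of_int m\<bar>) ^ 18 / (1 + \<bar>of_int m\<bar>)\<^sup>2"
    by (simp flip: power_add)
  also have "\<dots> \<le> B / (1 + real N) ^ 18 / (1 + \<bar>of_int m\<bar>)\<^sup>2"
    by (intro divide_right_mono divide_left_mono w B) auto
  finally show "cmod (fourier_coeff (u t) m) \<le> B / (1 + real N) ^ 18 / (1 + \<bar>of_int m\<bar>)\<^sup>2" .
qed (use B in auto)

lemma frac_lap_coeff_decay:
  assumes t: "t \<in> {0..T}"
  shows "cmod (of_real (\<bar>of_int m\<bar> powr (2 * s)) * fourier_coeff (u t) m) \<le> B / (1 + \<bar>of_int m\<bar>)\<^sup>2"
proof -
  have "\<bar>real_of_int m\<bar> powr (2 * s) \<le> (1 + \<bar>of_int m\<bar>) ^ 2" by (rule frac_lap_symbol_le[OF s])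
  then have "\<bar>real_of_int m\<bar> powr (2 * s) * cmod (fourier_coeff (u t) m) \<le> (1 + \<bar>of_int m\<bar>) ^ 2 * cmod (fourier_coeff (u t) m)"
    by (rule mult_right_mono) simp
  also have "\<dots> \<le> B / (1 + \<bar>of_int m\<bar>)\<^sup>2" by (rule fourier_coeff_decay[OF t]) simp
  finally show ?thesis by (simp add: norm_mult)
qed

definition solution_rhs :: "real \<Rightarrow> real \<Rightarrow> complex" where
  "solution_rhs t x = (- \<i>) * frac_lap s (u t) x + \<i> * (of_real ((cmod (u t x))\<^sup>2) * u t x)"

lemma solution_has_derivative:
  assumes t: "t \<in> {0..T}"
  shows "((\<lambda>\<tau>. u \<tau> x) has_vector_derivative solution_rhs t x) (at t within {0..T})"
proof -
  obtain ut where ut: "((\<lambda>\<tau>. u \<tau> x) has_vector_derivative ut) (at t within {0..T})"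
    "\<i> * ut - frac_lap s (u t) x + of_real ((cmod (u t x))\<^sup>2) * u t x = 0"
    using sol t unfolding nls_solution_def by blast
  have "(- \<i>) * (\<i> * ut - frac_lap s (u t) x + of_real ((cmod (u t x))\<^sup>2) * u t x) = 0" using ut(2) by simp
  then have "ut = solution_rhs t x"
    by (simp add: solution_rhs_def algebra_simps)
  then show ?thesis using ut(1) by simp
qed

lemma continuous_on_fourier_coeff_solution: "continuous_on {0..T} (\<lambda>t. fourier_coeff (u t) m)"
proof -
  have joint: "continuous_on ({0..T} \<times> {-pi..pi}) (\<lambda>(t, x). u t x)"
    using sol unfolding nls_solution_def by (auto elim: continuous_on_subset)
  have "continuous_on {0..T} (\<lambda>t. integral (cbox (-pi) pi) (\<lambda>x. u t x * cnj (cis (of_int m * x))))"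
    by (rule integral_continuous_on_param)
       (use joint in \<open>auto simp: split_def intro!: continuous_intros\<close>)
  then have "continuous_on {0..T} (\<lambda>t. integral {-pi..pi} (\<lambda>x. u t x * cnj (cis (of_int m * x))) / (2 * pi))"
    by (intro continuous_intros) auto
  then show ?thesis
    by (rule continuous_on_eq) (simp add: fourier_coeff_L2_inner continuous_on_solution L2_inner_def)
qed

text \<open>\<open>nls_solution\<close> grants a time derivative at each point; its joint continuity
  follows from the equation, as the decay makes the series of \<open>frac_lap\<close> converge
  uniformly in t and x. Differentiation under the integral sign rests on this.\<close>

lemma continuous_on_solution_rhs: "continuous_on ({0..T} \<times> UNIV) (\<lambda>(t, x). solution_rhs t x)"
proof -
  let ?f = "\<lambda>m p. of_real (\<bar>of_int m\<bar> powr (2 * s)) * fourier_coeff (u (fst p)) m * cis (of_int m * snd p)"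
  have "uniform_limit ({0..T} \<times> UNIV) (\<lambda>F p. \<Sum>m\<in>F. ?f m p) (\<lambda>p. \<Sum>\<^sub>\<infinity>m. ?f m p) (finite_subsets_at_top UNIV)"
    by (rule Weierstrass_m_test_general[OF _ summable_inverse_square_int[of B]])
       (use frac_lap_coeff_decay in \<open>auto simp: norm_mult\<close>)
  moreover have "continuous_on ({0..T} \<times> UNIV) (\<lambda>p. \<Sum>m\<in>F. ?f m p)" for F
    by (intro continuous_intros continuous_on_compose2[OF continuous_on_fourier_coeff_solution]) auto
  ultimately have "continuous_on ({0..T} \<times> UNIV) (\<lambda>p. \<Sum>\<^sub>\<infinity>m. ?f m p)"
    by (intro uniform_limit_theorem[where F = "finite_subsets_at_top UNIV"]) auto
  moreover have "continuous_on ({0..T} \<times> UNIV) (\<lambda>p. u (fst p) (snd p))"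
    using sol by (simp add: nls_solution_def split_def)
  ultimately show ?thesis
    unfolding solution_rhs_def frac_lap_def split_def by (intro continuous_intros)
qed

lemma solution_rhs_continuous: "t \<in> {0..T} \<Longrightarrow> continuous_on S (solution_rhs t)"
proof -
  assume t: "t \<in> {0..T}"
  have "continuous_on S (\<lambda>x. (t, x))" by (intro continuous_intros)
  moreover have "(\<lambda>x. (t, x)) ` S \<subseteq> {0..T} \<times> UNIV" using t by auto
  ultimately have "continuous_on S (\<lambda>x. case (t, x) of (t, x) \<Rightarrow> solution_rhs t x)"
    by (rule continuous_on_compose2[OF continuous_on_solution_rhs])
  then show ?thesis by simp
qed

lemma fourier_coeff_solution_has_derivative:
  assumes t: "t \<in> {0..T}"
  shows "((\<lambda>\<tau>. fourier_coeff (u \<tau>) m) has_vector_derivative fourier_coeff (solution_rhs t) m) (at t within {0..T})"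
proof -
  have joint: "continuous_on ({0..T} \<times> {-pi..pi}) (\<lambda>(t, x). solution_rhs t x)"
    using continuous_on_solution_rhs by (rule continuous_on_subset) auto
  have "((\<lambda>\<tau>. integral (cbox (-pi) pi) (\<lambda>x. u \<tau> x * cnj (cis (of_int m * x)))) has_vector_derivative
      integral (cbox (-pi) pi) (\<lambda>x. solution_rhs t x * cnj (cis (of_int m * x)))) (at t within {0..T})"
  proof (rule leibniz_rule_vector_derivative[OF _ _ _ t])
    fix \<tau> x assume "\<tau> \<in> {0..T}"
    then show "((\<lambda>\<tau>. u \<tau> x * cnj (cis (of_int m * x))) has_vector_derivative solution_rhs \<tau> x * cnj (cis (of_int m * x))) (at \<tau> within {0..T})"
      by (intro has_vector_derivative_mult_left solution_has_derivative)
  next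
    fix \<tau> assume "\<tau> \<in> {0..T}"
    then show "(\<lambda>x. u \<tau> x * cnj (cis (of_int m * x))) integrable_on cbox (-pi) pi"
      by (intro integrable_continuous continuous_intros continuous_on_solution)
  next
    show "continuous_on ({0..T} \<times> cbox (-pi) pi) (\<lambda>(\<tau>, x). solution_rhs \<tau> x * cnj (cis (of_int m * x)))"
      using joint by (auto simp: split_def intro!: continuous_intros)
  qed simp
  then have "((\<lambda>\<tau>. L2_inner (u \<tau>) (\<lambda>x. cis (of_int m * x)) / (2 * pi)) has_vector_derivative
      L2_inner (solution_rhs t) (\<lambda>x. cis (of_int m * x)) / (2 * pi)) (at t within {0..T})"
    unfolding L2_inner_def cbox_interval by (rule has_vector_derivative_divide)
  then show ?thesis
    unfolding fourier_coeff_L2_inner[OF solution_rhs_continuous[OF t]]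
    by (rule has_vector_derivative_transform[OF t, rotated])
       (simp add: fourier_coeff_L2_inner continuous_on_solution)
qed

lemma trig_proj_solution_has_derivative:
  assumes t: "t \<in> {0..T}"
  shows "((\<lambda>\<tau>. trig_proj N (u \<tau>) x) has_vector_derivative trig_proj N (solution_rhs t) x) (at t within {0..T})"
  unfolding trig_proj_modes
  by (intro has_vector_derivative_sum has_vector_derivative_mult_left fourier_coeff_solution_has_derivative t)

text \<open>Multiplier and projection commute on coefficients, so the projected equation differs
  from the semidiscrete one only in the argument of the cubic term.\<close>

lemma trig_proj_solution_rhs:
  assumes t: "t \<in> {0..T}"
  shows "trig_proj N (solution_rhs t) x = - \<i> * frac_lap s (trig_proj N (u t)) x
    + \<i> * trig_proj N (\<lambda>x. of_real ((cmod (u t x))\<^sup>2) * u t x) x"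
proof -
  have fs: "continuous_on UNIV (frac_lap s (u t))"
    "fourier_coeff (frac_lap s (u t)) m = of_real (\<bar>of_int m\<bar> powr (2 * s)) * fourier_coeff (u t) m" for m
    unfolding frac_lap_def[abs_def] by (rule fourier_series[OF frac_lap_coeff_decay[OF t]])+
  have c: "continuous_on {-pi..pi} (frac_lap s (u t))" "continuous_on {-pi..pi} (\<lambda>x. of_real ((cmod (u t x))\<^sup>2) * u t x)"
    using fs(1) continuous_on_subset by (blast, intro continuous_intros continuous_on_solution t)
  have "fourier_coeff (solution_rhs t) m = (-\<i>) * fourier_coeff (frac_lap s (u t)) m
      + \<i> * fourier_coeff (\<lambda>x. of_real ((cmod (u t x))\<^sup>2) * u t x) m" for m
    unfolding solution_rhs_def[abs_def] fourier_coeff_scale[symmetric]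
    by (rule fourier_coeff_add) (intro continuous_intros c)+
  moreover have "(\<Sum>m\<in>modes N. ((-\<i>) * P m + \<i> * Q m) * e m) = - \<i> * (\<Sum>m\<in>modes N. P m * e m) + \<i> * (\<Sum>m\<in>modes N. Q m * e m)"
    for P Q e :: "int \<Rightarrow> complex"
    by (simp add: sum_distrib_left algebra_simps sum_subtractf sum_negf)
  moreover have "frac_lap s (trig_proj N (u t)) x =
      (\<Sum>m\<in>modes N. (of_real (\<bar>of_int m\<bar> powr (2 * s)) * fourier_coeff (u t) m) * cis (of_int m * x))"
    unfolding frac_lap_trig_space[OF trig_proj_in_trig_space] by (simp add: fourier_coeff_trig_proj)
  ultimately show ?thesis by (simp only: trig_proj_modes fs)
qed

text \<open>Where the error touches the barrier \<epsilon> exp (\<Lambda> t / 2), it is at most 1 /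
  (1 + N) by \<open>large\<close>, so the inverse inequality bounds \<open>uN\<close> by K + 1 and
  the energy rate stays below \<Lambda>. In \<Lambda> the first term is the cubic cancellation, 54 =
  2 * 27 is the consistency error, and the 1 makes the crossing strict.\<close>

lemma semidiscrete_error:
  assumes N: "N \<ge> 1" and uN: "semidiscrete_solution s T N u0 uN" and t: "t \<in> {0..T}"
  defines "K \<equiv> 3 * B"
  defines "\<Lambda> \<equiv> 2 * (K * (2 * K + 1)) + 54 * K\<^sup>2 * B + 1"
  assumes large: "exp (\<Lambda> * T / 2) \<le> 1 + real N"
  shows "L2_norm (\<lambda>x. uN t x - trig_proj N (u t) x) \<le> exp (\<Lambda> * T / 2) / (1 + real N) ^ 13"
proof -
  note tp = semidiscrete_trig_space[OF uN]
  have K: "K \<ge> 0" using B by (simp add: K_def)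
  have \<Lambda>: "\<Lambda> > 0" using K B by (auto simp: \<Lambda>_def intro!: add_nonneg_pos add_nonneg_nonneg)
  define w where "w t = trig_proj N (u t)" for t
  \<comment> \<open>As 13 <= 18, the consistency error fits below; 12 powers survive the growth
    factor 1 + N, and 13 also covers the 11 powers that weight 10 will cost. Positivity leaves room
    at t = 0, where the error is zero.\<close>
  define \<epsilon> where "\<epsilon> = 1 / (1 + real N) ^ 13"
  have \<epsilon>: "\<epsilon> > 0" by (simp add: \<epsilon>_def)
  define c where "c t = (\<lambda>x. of_real ((cmod (u t x))\<^sup>2) * u t x - of_real ((cmod (w t x))\<^sup>2) * w t x)" for t
  define e where "e t = (\<lambda>x. uN t x - w t x)" for t
  define e' where "e' t = (\<lambda>x. 1 * (nls_rhs s N (uN t) x - nls_rhs s N (w t) x) + (- \<i>) * trig_proj N (c t) x)" for t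
  have w: "w t \<in> trig_space N" for t by (simp add: w_def trig_proj_in_trig_space)
  have wb: "cmod (w t x) \<le> K" if "t \<in> {0..T}" for t x
    using wiener_sup[OF w, of t x 10] wiener_trig_proj_solution[OF that, of N] by (simp add: K_def w_def)
  have e_tp: "e t \<in> trig_space N" "e' t \<in> trig_space N" if "t \<in> {0..T}" for t
    unfolding e_def e'_def by (intro trig_space_intros tp w nls_rhs_in_trig_space trig_proj_in_trig_space that)+
  have cont: "continuous_on {-pi..pi} (u t)" "continuous_on {-pi..pi} (w t)" if "t \<in> {0..T}" for t
    using that by (auto intro: continuous_on_solution continuous_on_trig_space w)
  have c_cont: "continuous_on {-pi..pi} (c t)" if "t \<in> {0..T}" for t
    unfolding c_def by (intro continuous_intros cont that)
  have cb: "L2_norm (c t) \<le> 27 * K\<^sup>2 * B * \<epsilon>" if t: "t \<in> {0..T}" for t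
  proof -
    have "cmod (c t x) \<le> 9 * K\<^sup>2 * B * \<epsilon>" for x
    proof -
      have "cmod (c t x) \<le> 3 * K\<^sup>2 * cmod (u t x - w t x)"
        unfolding c_def by (rule cubic_lipschitz) (use wb[OF t] solution_sup[OF t] in \<open>auto simp: K_def\<close>)
      also have "\<dots> \<le> 3 * K\<^sup>2 * (3 * (B / (1 + real N) ^ 18))"
        using trig_proj_error[OF t] by (intro mult_left_mono) (auto simp: w_def)
      also have "\<dots> \<le> 3 * K\<^sup>2 * (3 * (B / (1 + real N) ^ 13))"
        using B by (intro mult_left_mono divide_left_mono power_increasing) auto
      finally show ?thesis by (simp add: \<epsilon>_def)
    qed
    from L2_norm_le_sup[OF c_cont[OF t] this] show ?thesis by simp
  qed
  define f where "f t = (L2_norm (e t))\<^sup>2" for t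
  have "f t < \<epsilon>\<^sup>2 * exp (\<Lambda> * t)"
  proof (rule first_crossing_barrier[OF _ _ _ _ t])
    show "f 0 < \<epsilon>\<^sup>2 * exp (\<Lambda> * 0)"
    proof -
      have "uN 0 = w 0" using uN sol by (simp add: semidiscrete_solution_def nls_solution_def w_def)
      then show ?thesis using \<epsilon> by (simp add: f_def e_def L2_norm_def)
    qed
    fix t assume t: "t \<in> {0..T}"
    show "((\<lambda>t. \<epsilon>\<^sup>2 * exp (\<Lambda> * t)) has_real_derivative \<Lambda> * (\<epsilon>\<^sup>2 * exp (\<Lambda> * t))) (at t within {0..T})"
      by (auto intro!: derivative_eq_intros)
    have wd: "((\<lambda>\<tau>. w \<tau> x) has_vector_derivative nls_rhs s N (w t) x + \<i> * trig_proj N (c t) x) (at t within {0..T})" for x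
    proof -
      have "trig_proj N (solution_rhs t) x = nls_rhs s N (w t) x + \<i> * trig_proj N (c t) x"
        unfolding trig_proj_solution_rhs[OF t] nls_rhs_def c_def
        by (subst trig_proj_diff) (auto intro!: continuous_intros cont t continuous_on_trig_space[OF trig_proj_in_trig_space] simp: w_def algebra_simps)
      then show ?thesis
        using trig_proj_solution_has_derivative[OF t, of N x] by (simp add: w_def)
    qed
    have ud: "((\<lambda>\<tau>. uN \<tau> x) has_vector_derivative nls_rhs s N (uN t) x) (at t within {0..T})" for x
      using uN t by (simp add: semidiscrete_solution_def)
    have ed: "((\<lambda>\<tau>. e \<tau> x) has_vector_derivative e' t x) (at t within {0..T})" for x
      using has_vector_derivative_diff[OF ud wd, of x] by (simp add: e_def e'_def algebra_simps)
    show "(f has_real_derivative 2 * Re (L2_inner (e' t) (e t))) (at t within {0..T})"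
      unfolding f_def[abs_def] by (rule L2_norm_sq_has_derivative[OF e_tp(1) e_tp(2)[OF t] t ed])
    assume eq: "f t = \<epsilon>\<^sup>2 * exp (\<Lambda> * t)"
    define l where "l = L2_norm (e t)"
    have l_eq: "l = \<epsilon> * exp (\<Lambda> * t / 2)"
    proof -
      have "l\<^sup>2 = (\<epsilon> * exp (\<Lambda> * t / 2))\<^sup>2"
        using eq exp_double[of "\<Lambda> * t / 2"] by (simp add: f_def l_def power_mult_distrib)
      then show ?thesis using \<epsilon> by (simp add: power2_eq_iff_nonneg l_def)
    qed
    have l0: "l > 0" using \<epsilon> by (simp add: l_eq)
    \<comment> \<open>On the barrier the error is at least \<epsilon>, so the source \<epsilon> l
      can be charged to l^2.\<close>
    have "\<epsilon> * 1 \<le> l" unfolding l_eq using \<epsilon> \<Lambda> t by (intro mult_left_mono) auto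
    have l_le: "l \<le> 1 / (1 + real N)"
    proof -
      have "\<Lambda> * t / 2 \<le> \<Lambda> * T / 2" using t \<Lambda> by simp
      then have "exp (\<Lambda> * t / 2) \<le> exp (\<Lambda> * T / 2)" unfolding exp_le_cancel_iff .
      then have "exp (\<Lambda> * t / 2) \<le> 1 + real N" using large by (rule order_trans)
      then have "l \<le> \<epsilon> * (1 + real N)" unfolding l_eq using \<epsilon> by (intro mult_left_mono) auto
      also have "\<dots> = 1 / (1 + real N) ^ 12" by (simp add: \<epsilon>_def field_simps flip: power_Suc)
      also have "\<dots> \<le> 1 / (1 + real N) ^ 1" by (intro divide_left_mono power_increasing) auto
      finally show ?thesis by simp
    qed
    have zb: "cmod (uN t x) \<le> K + 1" for x
    proof -
      have "(cmod (e t x))\<^sup>2 \<le> real N * l\<^sup>2" unfolding l_def by (rule trig_space_sup_le[OF N e_tp(1)[OF t]])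
      also have "\<dots> \<le> (1 + real N) * (1 / (1 + real N))\<^sup>2"
        using l_le l0 by (intro mult_mono power_mono) auto
      also have "\<dots> \<le> 1\<^sup>2" by (simp add: power2_eq_square)
      finally have "cmod (e t x) \<le> 1" by (rule power2_le_imp_le) simp
      moreover have "cmod (uN t x) \<le> cmod (w t x) + cmod (e t x)"
        using norm_triangle_ineq[of "w t x" "e t x"] by (simp add: e_def)
      ultimately show ?thesis using wb[OF t, of x] by linarith
    qed
    have ce: "continuous_on {-pi..pi} (e t)" by (rule continuous_on_trig_space[OF e_tp(1)[OF t]])
    have "L2_inner (e' t) (e t) = 1 * L2_inner (\<lambda>x. nls_rhs s N (uN t) x - nls_rhs s N (w t) x) (e t) + (- \<i>) * L2_inner (trig_proj N (c t)) (e t)"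
      unfolding e'_def
      by (rule L2_inner_lincomb_left)
         (auto intro!: continuous_on_trig_space[of _ N] trig_space_diff nls_rhs_in_trig_space tp t w e_tp)
    also have "L2_inner (trig_proj N (c t)) (e t) = L2_inner (c t) (e t)"
      by (rule L2_inner_trig_proj[OF c_cont[OF t] e_tp(1)[OF t]])
    finally have "Re (L2_inner (e' t) (e t)) = Re (L2_inner (\<lambda>x. nls_rhs s N (uN t) x - nls_rhs s N (w t) x) (e t)) + Im (L2_inner (c t) (e t))"
      by simp
    also have "\<dots> \<le> K * (K + (K + 1)) * l\<^sup>2 + (27 * K\<^sup>2 * B * \<epsilon>) * l"
    proof (rule add_mono)
      have "\<bar>Re (L2_inner (\<lambda>x. nls_rhs s N (uN t) x - nls_rhs s N (w t) x) (e t))\<bar> \<le> K * (K + (K + 1)) * l\<^sup>2"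
        unfolding l_def e_def by (rule nls_rhs_monotone[OF tp[OF t] w zb wb[OF t]])
      then show "Re (L2_inner (\<lambda>x. nls_rhs s N (uN t) x - nls_rhs s N (w t) x) (e t)) \<le> K * (K + (K + 1)) * l\<^sup>2" by linarith
      have "Im (L2_inner (c t) (e t)) \<le> L2_norm (c t) * l"
        unfolding l_def using order_trans[OF abs_Im_le_cmod cauchy_schwarz_L2_inner[OF c_cont[OF t] ce]] by linarith
      also have "\<dots> \<le> (27 * K\<^sup>2 * B * \<epsilon>) * l" using cb[OF t] l0 by (intro mult_right_mono) auto
      finally show "Im (L2_inner (c t) (e t)) \<le> (27 * K\<^sup>2 * B * \<epsilon>) * l" .
    qed
    also have "(27 * K\<^sup>2 * B * \<epsilon>) * l \<le> (27 * K\<^sup>2 * B * l) * l"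
      using \<open>\<epsilon> * 1 \<le> l\<close> l0 B by (intro mult_right_mono mult_left_mono) auto
    finally have "2 * Re (L2_inner (e' t) (e t)) \<le> (\<Lambda> - 1) * l\<^sup>2"
      by (simp add: \<Lambda>_def power2_eq_square algebra_simps)
    also have "\<dots> < \<Lambda> * l\<^sup>2" using l0 by simp
    finally show "2 * Re (L2_inner (e' t) (e t)) < \<Lambda> * (\<epsilon>\<^sup>2 * exp (\<Lambda> * t))"
      using eq by (simp add: f_def l_def)
  qed
  also have "\<dots> \<le> \<epsilon>\<^sup>2 * exp (\<Lambda> * T)" using t \<Lambda> by (intro mult_left_mono) auto
  also have "\<dots> = (\<epsilon> * exp (\<Lambda> * T / 2))\<^sup>2"
    using exp_double[of "\<Lambda> * T / 2"] by (simp add: power_mult_distrib)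
  finally have "(L2_norm (e t))\<^sup>2 \<le> (\<epsilon> * exp (\<Lambda> * T / 2))\<^sup>2" by (simp add: f_def)
  then have "L2_norm (e t) \<le> \<epsilon> * exp (\<Lambda> * T / 2)" by (rule power2_le_imp_le) (use \<epsilon> in simp)
  then show ?thesis by (simp add: e_def w_def \<epsilon>_def)
qed

text \<open>E is the threshold of \<open>semidiscrete_error\<close>. Above it the error of order (1
  + N)^(-13) beats the factor (1 + N)^11 of the norm equivalence; below it that factor is at most
  E^11, and 9 B bounds the mass. Either way N disappears.\<close>

lemma semidiscrete_uniform_bound:
  obtains M where "\<And>N uN t. N \<ge> 1 \<Longrightarrow> semidiscrete_solution s T N u0 uN \<Longrightarrow> t \<in> {0..T} \<Longrightarrow> wiener N 10 (uN t) \<le> M"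
proof -
  define K where "K = 3 * B"
  define \<Lambda> where "\<Lambda> = 2 * (K * (2 * K + 1)) + 54 * K\<^sup>2 * B + 1"
  define E where "E = exp (\<Lambda> * T / 2)"
  have E: "E > 0" by (simp add: E_def)
  show ?thesis
  proof
    fix N :: nat and uN :: "real \<Rightarrow> real \<Rightarrow> complex" and t
    assume N: "N \<ge> 1" and uN: "semidiscrete_solution s T N u0 uN" and t: "t \<in> {0..T}"
    note tp = semidiscrete_trig_space[OF uN t]
    have w: "wiener N 10 (trig_proj N (u r)) \<le> 3 * B" if "r \<in> {0..T}" for r
      by (rule wiener_trig_proj_solution[OF that])
    show "wiener N 10 (uN t) \<le> 3 * B + 2 * E + 2 * E ^ 11 * (9 * B)"
    proof (cases "E \<le> 1 + real N")
      case True
      let ?e = "\<lambda>x. uN t x - trig_proj N (u t) x"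
      have e: "?e \<in> trig_space N" by (intro trig_space_diff tp trig_proj_in_trig_space)
      have "L2_norm ?e \<le> E / (1 + real N) ^ 13"
        using semidiscrete_error[OF N uN t] True unfolding E_def \<Lambda>_def K_def by simp
      then have "2 * (1 + real N) ^ Suc 10 * L2_norm ?e \<le> 2 * (1 + real N) ^ Suc 10 * (E / (1 + real N) ^ 13)"
        by (intro mult_left_mono) auto
      also have "\<dots> \<le> 2 * (1 + real N) ^ 13 * (E / (1 + real N) ^ 13)"
        using E by (intro mult_right_mono mult_left_mono power_increasing) auto
      also have "\<dots> = 2 * E" by simp
      finally have "wiener N 10 ?e \<le> 2 * E" using wiener_le_L2_norm[OF e, of 10] by linarith
      moreover have "wiener N 10 (\<lambda>x. ?e x + trig_proj N (u t) x) \<le> wiener N 10 ?e + wiener N 10 (trig_proj N (u t))"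
        by (intro wiener_add continuous_on_trig_space[of _ N] e trig_proj_in_trig_space)
      ultimately have "wiener N 10 (uN t) \<le> 2 * E + 3 * B" using w[OF t] by simp
      then show ?thesis using E B by (simp add: add_increasing2)
    next
      case False
      have "L2_norm (uN t) \<le> L2_norm (trig_proj N u0)" by (rule semidiscrete_L2_norm[OF N uN t])
      also have "\<dots> \<le> 3 * wiener N 10 (trig_proj N (u 0))"
        using sol by (simp add: nls_solution_def L2_norm_le_wiener)
      also have "\<dots> \<le> 9 * B" using w[of 0] T by simp
      finally have m: "L2_norm (uN t) \<le> 9 * B" .
      have "wiener N 10 (uN t) \<le> 2 * (1 + real N) ^ Suc 10 * L2_norm (uN t)" by (rule wiener_le_L2_norm[OF tp])
      also have "\<dots> \<le> 2 * E ^ Suc 10 * (9 * B)"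
        using False m E by (intro mult_mono power_mono) auto
      finally show ?thesis using E B by simp
    qed
  qed
qed

end

section \<open>One constant for all step sizes and all bands\<close>

theorem propositionA2:
  fixes s :: real
  assumes "0 < s" and "s \<le> 1"
  shows "\<exists>\<mu>0::real. \<forall>\<mu>\<ge>\<mu>0. \<forall>(T::real) (u0 :: real \<Rightarrow> complex) (u :: real \<Rightarrow> real \<Rightarrow> complex).
    T > 0 \<longrightarrow> smooth_fun u0 \<longrightarrow> periodic_fun_simple u0 (2 * pi) \<longrightarrow>
    nls_solution s T u0 u \<longrightarrow> bounded_in_H \<mu> T u \<longrightarrow>
    (\<exists>C::real. \<forall>(N::nat) (M::nat) (k::real) (uN :: real \<Rightarrow> real \<Rightarrow> complex)
        (Z :: nat \<Rightarrow> nat \<Rightarrow> real \<Rightarrow> complex).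
      N \<ge> 1 \<longrightarrow> k > 0 \<longrightarrow> T = real M * k \<longrightarrow>
      3 * (L2_norm (trig_proj N u0))\<^sup>2 * k * real N * (MAX j\<in>{1..3}. \<bar>comp_coeff j\<bar>) < 1 \<longrightarrow>
      semidiscrete_solution s T N u0 uN \<longrightarrow>
      (\<forall>n\<in>{0..M - 1}. composition_stages s N k 3 comp_coeff (uN (real n * k)) (Z n)) \<longrightarrow>
      (MAX n\<in>{0..M - 1}. L2_norm (\<lambda>x. uN (real (n + 1) * k) x - Z n 3 x)) \<le> C * k ^ 5)"
proof (rule exI[of _ 20], intro allI impI, goal_cases)
  case (1 \<mu> T u0 u)
  note s = assms and T = 1(2) and sol = 1(5)
  \<comment> \<open>The threshold 20 for \<mu> is the exponent that the coefficient decay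
    requires.\<close>
  obtain B where B: "B \<ge> 0" "\<forall>t\<in>{0..T}. \<forall>m. (1 + \<bar>of_int m\<bar>) ^ 20 * cmod (fourier_coeff (u t) m) \<le> B"
    using bounded_in_H_decay[OF 1(6) 1(1)] by blast
  obtain A where A: "\<And>N uN t. N \<ge> 1 \<Longrightarrow> semidiscrete_solution s T N u0 uN \<Longrightarrow> t \<in> {0..T} \<Longrightarrow> wiener N 10 (uN t) \<le> A"
    by (rule semidiscrete_uniform_bound[OF s T sol B]) (rule that)
  obtain C k0 where k0: "k0 > 0" and C: "\<forall>N k t T u0 uN Z. N \<ge> 1 \<longrightarrow> 0 < k \<longrightarrow> k \<le> k0 \<longrightarrow> 0 \<le> t \<longrightarrow> t + k \<le> T \<longrightarrow>
    semidiscrete_solution s T N u0 uN \<longrightarrow> (\<forall>\<tau>\<in>{0..T}. wiener N 10 (uN \<tau>) \<le> A) \<longrightarrow>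
    k * real N * (L2_norm (uN t))\<^sup>2 \<le> 1 \<longrightarrow> composition_stages s N k 3 comp_coeff (uN t) Z \<longrightarrow>
    L2_norm (\<lambda>x. uN (t + k) x - Z 3 x) \<le> C * k ^ 5"
    using local_error[OF s, of A] by blast
  \<comment> \<open>The second entry serves k > k0, where the error is at most 6 A <= 6 A (k /
    k0)^5. The 6 comes from two masses, each at most 3 A.\<close>
  define C' where "C' = max C (6 * A / k0 ^ 5)"
  show ?case
  proof (intro exI[of _ C'] allI impI)
    fix N M :: nat and k :: real and uN :: "real \<Rightarrow> real \<Rightarrow> complex" and Z :: "nat \<Rightarrow> nat \<Rightarrow> real \<Rightarrow> complex"
    assume N: "1 \<le> N" and k: "0 < k" and Mk: "T = real M * k"
      and cfl: "3 * (L2_norm (trig_proj N u0))\<^sup>2 * k * real N * (MAX j\<in>{1..3}. \<bar>comp_coeff j\<bar>) < 1"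
      and uN: "semidiscrete_solution s T N u0 uN"
      and Z: "\<forall>n\<in>{0..M - 1}. composition_stages s N k 3 comp_coeff (uN (real n * k)) (Z n)"
    \<comment> \<open>For M = 0 the truncated \<open>M - 1\<close> would leave the index set {0}. As
      T > 0 excludes this, the index set is exactly n < M.\<close>
    have "M \<noteq> 0" using T Mk by (cases "M = 0") auto
    define P where "P = L2_norm (trig_proj N u0)"
    \<comment> \<open>Since b_1 >= 1 the maximum is at least 1, so the smallness hypothesis yields
      the form that the stage bound uses.\<close>
    have small: "P\<^sup>2 * k * real N \<le> 1"
    proof -
      have "1 \<le> \<bar>comp_coeff 1\<bar>" using comp_coeff_conditions(1) by simp
      also have "\<dots> \<le> (MAX j\<in>{1..3}. \<bar>comp_coeff j\<bar>)" by (intro Max_ge) auto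
      finally have m: "1 \<le> (MAX j\<in>{1..3}. \<bar>comp_coeff j\<bar>)" .
      have nn: "0 \<le> P\<^sup>2 * k * real N" using k by simp
      have "P\<^sup>2 * k * real N * 1 \<le> P\<^sup>2 * k * real N * (MAX j\<in>{1..3}. \<bar>comp_coeff j\<bar>)"
        by (rule mult_left_mono[OF m nn])
      moreover have "3 * (P\<^sup>2 * k * real N * (MAX j\<in>{1..3}. \<bar>comp_coeff j\<bar>)) < 1"
        using cfl by (simp add: P_def mult.assoc)
      ultimately show ?thesis using nn by linarith
    qed
    have "L2_norm (\<lambda>x. uN (real (n + 1) * k) x - Z n 3 x) \<le> C' * k ^ 5" if n: "n \<in> {0..M - 1}" for n
    proof -
      define t where "t = real n * k"
      have t1: "real (n + 1) * k = t + k" by (simp add: t_def algebra_simps)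
      have "real (n + 1) \<le> real M" using n \<open>M \<noteq> 0\<close> by auto
      then have tk: "t + k \<le> T" unfolding t1[symmetric] Mk using k by (intro mult_right_mono) auto
      have t0: "0 \<le> t" using k by (simp add: t_def)
      have tT: "t \<in> {0..T}" "t + k \<in> {0..T}" using t0 tk k by auto
      have stages: "composition_stages s N k 3 comp_coeff (uN t) (Z n)" using Z n by (simp add: t_def)
      have mass: "L2_norm (uN t) \<le> P" unfolding P_def by (rule semidiscrete_L2_norm[OF N uN tT(1)])
      have "L2_norm (\<lambda>x. uN (t + k) x - Z n 3 x) \<le> C' * k ^ 5"
      proof (cases "k \<le> k0")
        case True
        have "k * real N * (L2_norm (uN t))\<^sup>2 \<le> k * real N * P\<^sup>2"
          using mass k by (intro mult_left_mono power_mono) auto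
        also have "\<dots> \<le> 1" using small by (simp add: mult_ac)
        finally have "L2_norm (\<lambda>x. uN (t + k) x - Z n 3 x) \<le> C * k ^ 5"
          using C N k True t0 tk uN A[OF N uN] stages by blast
        also have "\<dots> \<le> C' * k ^ 5" using k by (intro mult_right_mono) (auto simp: C'_def)
        finally show ?thesis .
      next
        case False
        have Z3: "L2_norm (Z n 3) \<le> L2_norm (uN t)" "Z n 3 \<in> trig_space N"
          using composition_mass[OF N semidiscrete_trig_space[OF uN tT(1)] stages, of 3] by simp_all
        have "L2_norm (uN r) \<le> 3 * A" if "r \<in> {0..T}" for r
          using L2_norm_le_wiener[OF semidiscrete_trig_space[OF uN that], of 10] A[OF N uN that] by linarith
        from this[OF tT(1)] this[OF tT(2)] Z3(1)
        have "L2_norm (uN (t + k)) + L2_norm (Z n 3) \<le> 6 * A" by linarith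
        then have le: "L2_norm (\<lambda>x. uN (t + k) x - Z n 3 x) \<le> 6 * A"
          by (rule order_trans[rotated])
             (intro L2_norm_triangle_diff continuous_on_trig_space[of _ N] semidiscrete_trig_space[OF uN tT(2)] Z3(2))
        have "0 \<le> A" using order_trans[OF wiener_nonneg A[OF N uN tT(1)]] .
        have "6 * A = 6 * A / k0 ^ 5 * k0 ^ 5" using k0 by simp
        also have "\<dots> \<le> C' * k ^ 5"
          using False k0 k \<open>0 \<le> A\<close> by (intro mult_mono power_mono) (auto simp: C'_def le_max_iff_disj)
        finally show ?thesis using le by linarith
      qed
      then show ?thesis by (simp only: t1)
    qed
    then show "(MAX n\<in>{0..M - 1}. L2_norm (\<lambda>x. uN (real (n + 1) * k) x - Z n 3 x)) \<le> C' * k ^ 5"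
      by (subst Max_le_iff) auto
  qed
qed

end
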